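(* Let $(\Sigma,\mathcal{T})$ be an ideally triangulated surface with boundary, and let $\eta:E\to(-1,+\infty)$ be a weight on the edges such that for every face $\{ijk\}\in F$ $$\eta_{ij}+\eta_{ik}\eta_{jk}\ge 0,\qquad \eta_{ik}+\eta_{ij}\eta_{jk}\ge 0,\qquad \eta_{jk}+\eta_{ij}\eta_{ik}\ge 0 .$$ Let $\overline K\in\mathbb{R}^n_{>0}$ be a positive function on $B=\{1,\dots,n\}$, let $\alpha_0\in\mathcal{W}^\alpha$, and let $s\in\mathbb{R}$. (a) The combinatorial Ricci flow and the combinatorial Calabi flow are negative gradient flows (each is the negative gradient flow, in the variable $\alpha\in\mathcal{W}^\alpha$, of some function on $\mathcal{W}^\alpha$). (b) Suppose there exists an admissible discrete conformal factor $\overline\alpha\in\mathcal{W}^\alpha$ with $K(\overline\alpha)=\overline K$. Then there exists $\delta>0$ such that if $\|\alpha_0-\overline\alpha\|<\delta$, the solutions of the combinatorial Ricci flow, the combinatorial Calabi flow and the fractional combinatorial Calabi flow with initial value $\alpha_0$ exist for all time and converge exponentially fast to $\overline\alpha$. (c) The solutions of the combinatorial Ricci flow, the combinatorial Calabi flow and the fractional combinatorial Calabi flow cannot reach the boundary of the admissible space $\mathcal{W}^\alpha$ in $(0,\frac{\pi}{2})^n$ (i.e. the boundary of $\mathcal{W}^\alpha$ relative to $(0,\frac{\pi}{2})^n$).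
   Context: Ideal triangulation: take a finite disjoint union of topological hexagons in each of which three pairwise non-adjacent edges are coloured red and the other three black; identify the red edges in pairs by homeomorphisms. The quotient is an ideally triangulated compact surface with boundary $(\Sigma,\mathcal{T})$. Faces are the images of the hexagons (set $F$), edges are the images of the red edges (set $E$), and the images of black edges are the boundary arcs, which make up the boundary of $\Sigma$, whose set of components is $B=\{1,\dots,n\}$. An edge joining boundary components $i,j$ is denoted $\{ij\}$, and a face adjacent to $i,j,k$ is denoted $\{ijk\}$. Discrete hyperbolic metric: any $l:E\to(0,+\infty)$. Each face is realized as the (unique up to isometry) right-angled hyperbolic hexagon whose red edges have the lengths given by $l$; gluing gives a hyperbolic metric on $\Sigma$ with totally geodesic boundary, and the generalized combinatorial curvature $K_i$ is the length of the boundary component $i\in B$. Discrete conformal factors: given $\eta:E\to(-1,+\infty)$, the admissible space $\mathcal{W}^\alpha$ is the set of $\alpha:B\to(0,\frac{\pi}{2})$ with $\frac{\cos\alpha_i\cos\alpha_j+\eta_{ij}}{\sin\alpha_i\sin\alpha_j}>1$ for every edge $\{ij\}\in E$; its elements are the admissible discrete conformal factors. Each $\alpha\in\mathcal{W}^\alpha$ determines a discrete hyperbolic metric by $\cosh l_{ij}=\frac{\cos\alpha_i\cos\alpha_j+\eta_{ij}}{\sin\alpha_i\sin\alpha_j}$, and $K=K(\alpha)$ denotes its generalized combinatorial curvature. (In terms of $u_i=-\ln\tan\alpha_i$ this reads $\cosh l_{ij}=e^{u_i+u_j}+\eta_{ij}\sqrt{(1+e^{2u_i})(1+e^{2u_j})}$.)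 Flows: under the stated condition on $\eta$ the Jacobian $\left(\frac{\partial K}{\partial\alpha}\right)$ is symmetric positive definite on $\mathcal{W}^\alpha$. Set $\Delta=-\left(\frac{\partial K}{\partial\alpha}\right)$ and, for $s\in\mathbb{R}$, $\Delta^s=-\left(\frac{\partial K}{\partial\alpha}\right)^s$, where for a symmetric positive definite matrix $A=P^T\mathrm{diag}\{\lambda_1,\dots,\lambda_n\}P$ with $P\in O(n)$ one puts $A^s=P^T\mathrm{diag}\{\lambda_1^s,\dots,\lambda_n^s\}P$. With initial value $\alpha(0)=\alpha_0\in\mathcal{W}^\alpha$: - combinatorial Ricci flow: $\frac{d\alpha_i}{dt}=\overline K_i-K_i$; - combinatorial Calabi flow: $\frac{d\alpha_i}{dt}=\Delta(K-\overline K)_i$; - fractional combinatorial Calabi flow: $\frac{d\alpha_i}{dt}=\Delta^s(K-\overline K)_i$. *)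

theory Defs
  imports "HOL-Analysis.Analysis"
begin

section \<open>Ideally triangulated surfaces with boundary\<close>

text \<open>
  An ideal triangulation is given by its gluing data. The hexagons are the elements of a finite
  type \<open>'f\<close>. The black edges of hexagon \<open>f\<close> are \<open>(f, i)\<close> with \<open>i :: 3\<close>, and for \<open>i \<noteq> j\<close> the triple
  \<open>(f, i, j)\<close> is the red edge of \<open>f\<close> between the black edges \<open>i\<close> and \<open>j\<close>, oriented from its endpoint
  on \<open>i\<close> to its endpoint on \<open>j\<close>. A homeomorphism between two red edges enters the construction only
  through the way it matches endpoints, so the identification of the red edges in pairs is an
  involution on oriented red edges. Orientability and connectedness are not required.
\<close>

type_synonym 'f black = "'f \<times> 3"
type_synonym 'f ored = "'f \<times> 3 \<times> 3"
type_synonym 'f edge = "'f ored set"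

definition ored_edges :: "'f ored set" where
  "ored_edges = {(f, i, j). i \<noteq> j}"

fun reverse :: "'f ored \<Rightarrow> 'f ored" where
  "reverse (f, i, j) = (f, j, i)"

definition red_gluing :: "('f ored \<Rightarrow> 'f ored) \<Rightarrow> bool" where
  "red_gluing \<sigma> \<longleftrightarrow> (\<forall>x\<in>ored_edges.
     \<sigma> x \<in> ored_edges \<and> \<sigma> (\<sigma> x) = x \<and> \<sigma> (reverse x) = reverse (\<sigma> x) \<and>
     \<sigma> x \<noteq> x \<and> \<sigma> x \<noteq> reverse x)"

text \<open>An edge of the triangulation: two red edges that are glued, each with both orientations.\<close>

definition edge_class :: "('f ored \<Rightarrow> 'f ored) \<Rightarrow> 'f ored \<Rightarrow> 'f edge" where
  "edge_class \<sigma> x = {x, reverse x, \<sigma> x, \<sigma> (reverse x)}"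

definition edges :: "('f ored \<Rightarrow> 'f ored) \<Rightarrow> 'f edge set" where
  "edges \<sigma> = edge_class \<sigma> ` ored_edges"

text \<open>
  The edge of the triangulation that is the image of the red edge of \<open>f\<close> opposite to the black edge
  \<open>k\<close>, i.e. joining the two other black edges; arithmetic in \<open>3\<close> is modulo 3.
\<close>

definition opp_edge :: "('f ored \<Rightarrow> 'f ored) \<Rightarrow> 'f \<Rightarrow> 3 \<Rightarrow> 'f edge" where
  "opp_edge \<sigma> f k = edge_class \<sigma> (f, k + 1, k + 2)"

text \<open>
  Two boundary arcs are adjacent if an endpoint of one is identified with an endpoint of the other.
  The boundary components are the classes of the equivalence relation this generates; the map
  \<open>bd\<close> labels them bijectively by the finite type \<open>'b\<close>, which plays the role of \<open>B = {1,...,n}\<close>.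
\<close>

definition arc_adjacent :: "('f ored \<Rightarrow> 'f ored) \<Rightarrow> ('f black \<times> 'f black) set" where
  "arc_adjacent \<sigma> = {((f, i), (g, k)) | f i g k. \<exists>j m. i \<noteq> j \<and> \<sigma> (f, i, j) = (g, k, m)}"

definition ideal_triangulation :: "('f ored \<Rightarrow> 'f ored) \<Rightarrow> ('f black \<Rightarrow> 'b) \<Rightarrow> bool" where
  "ideal_triangulation \<sigma> bd \<longleftrightarrow>
     red_gluing \<sigma> \<and> surj bd \<and> (\<forall>a a'. bd a = bd a' \<longleftrightarrow> (a, a') \<in> (arc_adjacent \<sigma>)\<^sup>*)"


section \<open>Right-angled hyperbolic hexagons\<close>

text \<open>The hyperbolic plane is the upper sheet of the hyperboloid in Minkowski 3-space.\<close>

definition mink :: "real^3 \<Rightarrow> real^3 \<Rightarrow> real" where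
  "mink x y = x $ 1 * y $ 1 + x $ 2 * y $ 2 - x $ 3 * y $ 3"

definition hyp_plane :: "(real^3) set" where
  "hyp_plane = {x. mink x x = - 1 \<and> x $ 3 > 0}"

definition hyp_dist :: "real^3 \<Rightarrow> real^3 \<Rightarrow> real" where
  "hyp_dist x y = arcosh (- mink x y)"

text \<open>\<open>hyp_dir p q\<close> is tangent at \<open>p\<close> to the geodesic from \<open>p\<close> to \<open>q\<close> (it is not normalised).\<close>

definition hyp_dir :: "real^3 \<Rightarrow> real^3 \<Rightarrow> real^3" where
  "hyp_dir p q = q + mink p q *\<^sub>R p"

definition right_angle :: "real^3 \<Rightarrow> real^3 \<Rightarrow> real^3 \<Rightarrow> bool" where
  "right_angle a p b \<longleftrightarrow> mink (hyp_dir p a) (hyp_dir p b) = 0"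

text \<open>
  For distinct \<open>a\<close> and \<open>b\<close>, the geodesic line through them is \<open>{x. mink \<nu> x = 0}\<close>, where the normal
  \<open>\<nu>\<close> is unique up to scaling.
\<close>

definition strictly_one_side :: "real^3 \<Rightarrow> real^3 \<Rightarrow> (real^3) set \<Rightarrow> bool" where
  "strictly_one_side a b S \<longleftrightarrow>
     (\<exists>\<nu>. mink \<nu> a = 0 \<and> mink \<nu> b = 0 \<and> (\<forall>x\<in>S. mink \<nu> x > 0))"

text \<open>
  The vertices of a hexagon are indexed cyclically, with arithmetic modulo 6. The last condition
  (every side line supports the hexagon) says that they are the vertices of an embedded, necessarily
  convex, hexagon; it excludes self-intersecting closed right-angled paths and reflex angles.
\<close>

definition right_angled_hexagon :: "(6 \<Rightarrow> real^3) \<Rightarrow> bool" where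
  "right_angled_hexagon v \<longleftrightarrow>
     inj v \<and> range v \<subseteq> hyp_plane \<and>
     (\<forall>k. right_angle (v (k - 1)) (v k) (v (k + 1))) \<and>
     (\<forall>k. strictly_one_side (v k) (v (k + 1)) (v ` (- {k, k + 1})))"

text \<open>\<open>b k\<close> is the length of the black edge \<open>k\<close> and \<open>r k\<close> that of the red edge opposite to it.\<close>

definition has_side_lengths :: "(6 \<Rightarrow> real^3) \<Rightarrow> (3 \<Rightarrow> real) \<Rightarrow> (3 \<Rightarrow> real) \<Rightarrow> bool" where
  "has_side_lengths v b r \<longleftrightarrow>
     hyp_dist (v 0) (v 1) = b 0 \<and> hyp_dist (v 1) (v 2) = r 2 \<and>
     hyp_dist (v 2) (v 3) = b 1 \<and> hyp_dist (v 3) (v 4) = r 0 \<and>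
     hyp_dist (v 4) (v 5) = b 2 \<and> hyp_dist (v 5) (v 0) = r 1"

definition black_lengths :: "(3 \<Rightarrow> real) \<Rightarrow> 3 \<Rightarrow> real" where
  "black_lengths r = (THE b. \<exists>v. right_angled_hexagon v \<and> has_side_lengths v b r)"


section \<open>Generalized combinatorial curvature and discrete conformal factors\<close>

definition arc_length ::
  "('f ored \<Rightarrow> 'f ored) \<Rightarrow> ('f edge \<Rightarrow> real) \<Rightarrow> 'f black \<Rightarrow> real" where
  "arc_length \<sigma> l = (\<lambda>(f, i). black_lengths (\<lambda>k. l (opp_edge \<sigma> f k)) i)"

definition curvature ::
  "('f::finite ored \<Rightarrow> 'f ored) \<Rightarrow> ('f black \<Rightarrow> 'b::finite) \<Rightarrow> ('f edge \<Rightarrow> real) \<Rightarrow> real^'b" where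
  "curvature \<sigma> bd l = (\<chi> i. \<Sum>a | bd a = i. arc_length \<sigma> l a)"

text \<open>
  The right-hand side of the formula for \<open>cosh l\<close>. On an edge of an ideal triangulation it does not
  depend on the chosen representative, as all of them join the same two boundary components.
\<close>

definition cosh_length ::
  "('f black \<Rightarrow> 'b) \<Rightarrow> ('f edge \<Rightarrow> real) \<Rightarrow> real^'b::finite \<Rightarrow> 'f edge \<Rightarrow> real" where
  "cosh_length bd \<eta> \<alpha> e =
     (let (f, i, j) = (SOME x. x \<in> e); a = \<alpha> $ bd (f, i); a' = \<alpha> $ bd (f, j)
      in (cos a * cos a' + \<eta> e) / (sin a * sin a'))"

definition angle_box :: "(real^'b::finite) set" where
  "angle_box = {\<alpha>. \<forall>i. 0 < \<alpha> $ i \<and> \<alpha> $ i < pi / 2}"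

definition admissible ::
  "('f ored \<Rightarrow> 'f ored) \<Rightarrow> ('f black \<Rightarrow> 'b) \<Rightarrow> ('f edge \<Rightarrow> real) \<Rightarrow> (real^'b::finite) set" where
  "admissible \<sigma> bd \<eta> = {\<alpha> \<in> angle_box. \<forall>e\<in>edges \<sigma>. cosh_length bd \<eta> \<alpha> e > 1}"

definition conformal_metric ::
  "('f black \<Rightarrow> 'b) \<Rightarrow> ('f edge \<Rightarrow> real) \<Rightarrow> real^'b::finite \<Rightarrow> 'f edge \<Rightarrow> real" where
  "conformal_metric bd \<eta> \<alpha> e = arcosh (cosh_length bd \<eta> \<alpha> e)"

definition conformal_curvature ::
  "('f::finite ored \<Rightarrow> 'f ored) \<Rightarrow> ('f black \<Rightarrow> 'b) \<Rightarrow> ('f edge \<Rightarrow> real) \<Rightarrow>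
   real^'b::finite \<Rightarrow> real^'b" where
  "conformal_curvature \<sigma> bd \<eta> \<alpha> = curvature \<sigma> bd (conformal_metric bd \<eta> \<alpha>)"


section \<open>Combinatorial flows\<close>

definition diag_matrix :: "('n \<Rightarrow> real) \<Rightarrow> real^'n^'n::finite" where
  "diag_matrix d = (\<chi> i j. if i = j then d i else 0)"

text \<open>Meaningful for symmetric positive definite \<open>A\<close> only.\<close>

definition matrix_powr :: "real^'n^'n::finite \<Rightarrow> real \<Rightarrow> real^'n^'n" where
  "matrix_powr A s = (THE B. \<exists>P d. orthogonal_matrix P \<and> (\<forall>i. d i > 0) \<and>
     A = transpose P ** diag_matrix d ** P \<and>
     B = transpose P ** diag_matrix (\<lambda>i. d i powr s) ** P)"

text \<open>
  The right-hand sides of the three flows, for a curvature map \<open>K\<close> and a target \<open>Kbar\<close>.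
\<close>

definition ricci_field :: "(real^'b \<Rightarrow> real^'b) \<Rightarrow> real^'b \<Rightarrow> real^'b \<Rightarrow> real^'b::finite" where
  "ricci_field K Kbar \<alpha> = Kbar - K \<alpha>"

definition laplacian :: "(real^'b \<Rightarrow> real^'b) \<Rightarrow> real^'b \<Rightarrow> real^'b^'b::finite" where
  "laplacian K \<alpha> = - jacobian K (at \<alpha>)"

definition calabi_field :: "(real^'b \<Rightarrow> real^'b) \<Rightarrow> real^'b \<Rightarrow> real^'b \<Rightarrow> real^'b::finite" where
  "calabi_field K Kbar \<alpha> = laplacian K \<alpha> *v (K \<alpha> - Kbar)"

definition frac_laplacian :: "real \<Rightarrow> (real^'b \<Rightarrow> real^'b) \<Rightarrow> real^'b \<Rightarrow> real^'b^'b::finite" where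
  "frac_laplacian s K \<alpha> = - matrix_powr (jacobian K (at \<alpha>)) s"

definition frac_calabi_field ::
  "real \<Rightarrow> (real^'b \<Rightarrow> real^'b) \<Rightarrow> real^'b \<Rightarrow> real^'b \<Rightarrow> real^'b::finite" where
  "frac_calabi_field s K Kbar \<alpha> = frac_laplacian s K \<alpha> *v (K \<alpha> - Kbar)"

definition negative_gradient_on :: "('a::real_inner) set \<Rightarrow> ('a \<Rightarrow> 'a) \<Rightarrow> bool" where
  "negative_gradient_on W V \<longleftrightarrow> (\<exists>\<Phi>. \<forall>x\<in>W. GDERIV \<Phi> x :> - V x)"

text \<open>A solution in \<open>W\<close>, on a time interval starting at 0, of the initial value problem for \<open>V\<close>.\<close>

definition flow_solution ::
  "('a::real_normed_vector) set \<Rightarrow> ('a \<Rightarrow> 'a) \<Rightarrow> 'a \<Rightarrow> real set \<Rightarrow> (real \<Rightarrow> 'a) \<Rightarrow> bool" where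
  "flow_solution W V x0 I x \<longleftrightarrow>
     is_interval I \<and> 0 \<in> I \<and> I \<subseteq> {0..} \<and> x 0 = x0 \<and>
     (\<forall>t\<in>I. x t \<in> W \<and> (x has_vector_derivative V (x t)) (at t within I))"

text \<open>
  The solution exists for all time, in the sense that a global solution exists and every solution on
  any time interval is a restriction of it.
\<close>

definition global_solution ::
  "('a::real_normed_vector) set \<Rightarrow> ('a \<Rightarrow> 'a) \<Rightarrow> 'a \<Rightarrow> (real \<Rightarrow> 'a) \<Rightarrow> bool" where
  "global_solution W V x0 x \<longleftrightarrow>
     flow_solution W V x0 {0..} x \<and>
     (\<forall>I y. flow_solution W V x0 I y \<longrightarrow> (\<forall>t\<in>I. y t = x t))"

definition converges_exponentially :: "(real \<Rightarrow> 'a::real_normed_vector) \<Rightarrow> 'a \<Rightarrow> bool" where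
  "converges_exponentially x z \<longleftrightarrow>
     (\<exists>C>0. \<exists>c>0. \<forall>t\<ge>0. norm (x t - z) \<le> C * exp (- c * t))"

end

theory Submission
  imports Defs
begin

text \<open>
  In every face the arc lengths \<open>\<theta>\<^sub>i\<close> are explicit functions of the angles by the hexagon cosine law.
  Differentiating through the edge lengths factors their Jacobian as \<open>G J\<close> up to a positive scalar;
  the sign patterns of \<open>G\<close> and \<open>J\<close> make all leading minors positive, so \<open>\<partial>K/\<partial>\<alpha>\<close> is symmetric positive
  definite on \<open>W\<close>. As \<open>W\<close> is defined by \<open>cos (\<alpha>\<^sub>i + \<alpha>\<^sub>j) > - \<eta>\<^sub>i\<^sub>j\<close>, it is open and convex, whence \<open>K\<close> is
  a gradient. The three flows are the fractional flows with exponents \<open>0\<close>, \<open>1\<close> and \<open>s\<close>, and along each of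
  them \<open>|K - Kbar|\<^sup>2\<close> is nonincreasing: it is a Lyapunov function near an equilibrium, and it bounds \<open>K\<close>, which
  tends to infinity at the relative frontier of \<open>W\<close>, where an edge length tends to 0.
\<close>
section \<open>Right-angled hexagons\<close>

text \<open>Two notions of the statement are definite descriptions and carry no information until
  existence and uniqueness are shown. For \<open>black_lengths\<close> uniqueness is the cosine law,
  and existence is an explicit hexagon built from three vectors with prescribed Minkowski products.
  For \<open>matrix_powr\<close> one estimate does two jobs: diagonalisations of nearby matrices
  have nearby powers, so equal matrices have equal powers, and the fractional field is locally
  Lipschitz without differentiating a matrix power. The scalar that splits off the face Jacobian is
  common to the three arcs because the radicand coming out of the cosine law is symmetric in the
  edges; only then are G and J enough for symmetry and definiteness. Global existence is a separate
  obstacle, as the fields are controlled only near the equilibrium. They are cut off by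
  nearest-point projection onto a small ball and solved for all time; the Lyapunov function shows
  that neither this solution nor a competing one on any interval leaves the ball.\<close>

lemma mink_commute: "mink x y = mink y x"
  by (simp add: mink_def)

lemma mink_linear [simp]:
  "mink (x + y) z = mink x z + mink y z" "mink z (x + y) = mink z x + mink z y"
  "mink (x - y) z = mink x z - mink y z" "mink z (x - y) = mink z x - mink z y"
  "mink (c *\<^sub>R x) z = c * mink x z" "mink z (c *\<^sub>R x) = c * mink z x"
  "mink (- x) z = - mink x z" "mink z (- x) = - mink z x"
  "mink 0 z = 0" "mink z 0 = 0"
  by (simp_all add: mink_def algebra_simps)

lemma hyp_plane_mink: "x \<in> hyp_plane \<Longrightarrow> mink x x = - 1"
  by (simp add: hyp_plane_def)

text \<open>Reversed Cauchy-Schwarz inequality on the hyperboloid: by a Lagrange identity the square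
  of \<open>x $ 3 * y $ 3\<close> exceeds that of \<open>1 + x $ 1 * y $ 1 + x $ 2 * y $ 2\<close>
  by a sum of three squares.\<close>

lemma mink_le_minus_one:
  assumes "x \<in> hyp_plane" "y \<in> hyp_plane"
  shows "mink x y \<le> - 1"
proof -
  have x: "x $ 3 = sqrt (1 + (x $ 1)\<^sup>2 + (x $ 2)\<^sup>2)" if "x \<in> hyp_plane" for x
  proof -
    have "(x $ 3)\<^sup>2 = 1 + (x $ 1)\<^sup>2 + (x $ 2)\<^sup>2" "x $ 3 > 0"
      using that by (simp_all add: hyp_plane_def mink_def power2_eq_square)
    then show ?thesis by (metis less_eq_real_def real_sqrt_unique)
  qed
  define a b where "a = x $ 1 * y $ 1 + x $ 2 * y $ 2" and "b = x $ 3 * y $ 3"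
  have b: "b > 0" using assms by (simp add: b_def hyp_plane_def)
  have sq: "(x $ 3)\<^sup>2 = 1 + (x $ 1)\<^sup>2 + (x $ 2)\<^sup>2" "(y $ 3)\<^sup>2 = 1 + (y $ 1)\<^sup>2 + (y $ 2)\<^sup>2"
    using assms by (simp_all add: hyp_plane_def mink_def power2_eq_square)
  have "b\<^sup>2 = (1 + (x $ 1)\<^sup>2 + (x $ 2)\<^sup>2) * (1 + (y $ 1)\<^sup>2 + (y $ 2)\<^sup>2)"
    unfolding b_def power_mult_distrib sq by simp
  also have "\<dots> = (1 + a)\<^sup>2 + (x $ 1 - y $ 1)\<^sup>2 + (x $ 2 - y $ 2)\<^sup>2 + (x $ 1 * y $ 2 - x $ 2 * y $ 1)\<^sup>2"
    unfolding a_def by algebra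
  finally have "(1 + a)\<^sup>2 \<le> b\<^sup>2" by (simp add: sum_power2_ge_zero)
  with b have "1 + a \<le> b" by (meson less_eq_real_def power2_le_imp_le)
  then show ?thesis by (simp add: mink_def a_def b_def)
qed

text \<open>In the equality case the three squares of that identity vanish, so the first two
  coordinates agree, and on the upper sheet they determine the third.\<close>

lemma mink_less_minus_one:
  assumes "x \<in> hyp_plane" "y \<in> hyp_plane" "x \<noteq> y"
  shows "mink x y < - 1"
proof (rule ccontr)
  assume "\<not> ?thesis"
  then have "mink x y = - 1" using mink_le_minus_one assms by (meson less_eq_real_def)
  then have eq: "1 + (x $ 1 * y $ 1 + x $ 2 * y $ 2) = x $ 3 * y $ 3" by (simp add: mink_def)
  have sq: "(x $ 3)\<^sup>2 = 1 + (x $ 1)\<^sup>2 + (x $ 2)\<^sup>2" "(y $ 3)\<^sup>2 = 1 + (y $ 1)\<^sup>2 + (y $ 2)\<^sup>2"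
    and pos: "x $ 3 > 0" "y $ 3 > 0"
    using assms by (simp_all add: hyp_plane_def mink_def power2_eq_square)
  have "(x $ 1 - y $ 1)\<^sup>2 + (x $ 2 - y $ 2)\<^sup>2 + (x $ 1 * y $ 2 - x $ 2 * y $ 1)\<^sup>2 = 0"
    using sq eq by algebra
  then have "x $ 1 = y $ 1" "x $ 2 = y $ 2"
    by (smt (verit, best) zero_le_power2 zero_eq_power2)+
  moreover from this have "x $ 3 = y $ 3" using sq pos
    by (metis less_eq_real_def power2_eq_iff_nonneg)
  ultimately show False using assms(3) by (simp add: vec_eq_iff forall_3)
qed

text \<open>Both \<open>n\<close> and \<open>m\<close> are multiples of the Lorentzian cross product of \<open>p\<close> and \<open>q\<close>.\<close>

lemma mink_orthogonal_parallel:
  assumes n: "mink n p = 0" "mink n q = 0" and m: "mink m p = 0" "mink m q = 0"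
    and pq: "mink p p = - 1" "mink q q = - 1" "(mink p q)\<^sup>2 \<noteq> 1"
  shows "mink m m *\<^sub>R n = mink m n *\<^sub>R m"
proof -
  define w where "w = (vector [p$2*q$3 - p$3*q$2, p$3*q$1 - p$1*q$3, - (p$1*q$2 - p$2*q$1)] :: real^3)"
  have par: "\<exists>t. n = t *\<^sub>R w" if "mink n p = 0" "mink n q = 0" for n
  proof -
    \<comment> \<open>Lorentzian Lagrange identity; for points of the hyperboloid the right side is
      \<open>(mink p q)\<^sup>2 - 1\<close>.\<close>
    have w2: "mink w w = (mink p q)\<^sup>2 - mink p p * mink q q"
      by (simp add: w_def mink_def power2_eq_square algebra_simps)
    then have w0: "mink w w \<noteq> 0" using pq by simp
    have "mink w w *\<^sub>R n = mink n w *\<^sub>R w"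
      unfolding vec_eq_iff forall_3
      using that unfolding mink_def w_def
      by (simp, intro conjI; algebra)
    then have "n = (mink n w / mink w w) *\<^sub>R w"
      using w0 by (metis (no_types, lifting) divide_inverse_commute eq_vector_fraction_iff inverse_eq_divide scaleR_scaleR)
    then show ?thesis by blast
  qed
  obtain s t where "n = s *\<^sub>R w" "m = t *\<^sub>R w" using par n m by blast
  then show ?thesis by (simp add: algebra_simps)
qed

section \<open>The cosine law of right-angled hexagons\<close>

lemma right_angle_mink:
  assumes "p \<in> hyp_plane"
  shows "right_angle a p b \<longleftrightarrow> mink a b = - mink a p * mink p b"
  using hyp_plane_mink[OF assms]
  by (auto simp: right_angle_def hyp_dir_def mink_commute[of p a] algebra_simps)

text \<open>A geodesic line has one unit normal up to sign, the same vector at each of its points.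
  Right angles make the unit tangents at \<open>p\<close> towards \<open>a\<close> and at
  \<open>q\<close> towards \<open>b\<close> both normal to the line through \<open>p\<close> and
  \<open>q\<close>, and lying on one side gives them the same sign.\<close>

lemma same_side_perpendiculars:
  assumes hyp: "{a, p, q, b} \<subseteq> hyp_plane" and pq: "mink p q < - 1"
    and ra: "right_angle a p q" "right_angle p q b"
    and side: "strictly_one_side p q {a, b}"
    and len: "mink p a = - cosh s" "mink q b = - cosh t" "s > 0" "t > 0"
  obtains n where "mink n n = 1" "mink n p = 0" "mink n q = 0"
    "a = cosh s *\<^sub>R p + sinh s *\<^sub>R n" "b = cosh t *\<^sub>R q + sinh t *\<^sub>R n"
proof -
  have pp: "mink p p = -1" "mink q q = -1" "mink a a = -1" "mink b b = -1"
    using hyp by (auto simp: hyp_plane_mink)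
  obtain \<nu> where \<nu>: "mink \<nu> p = 0" "mink \<nu> q = 0" "mink \<nu> a > 0" "mink \<nu> b > 0"
    using side by (auto simp: strictly_one_side_def)
  define n where "n = (1 / sinh s) *\<^sub>R (a - cosh s *\<^sub>R p)"
  define m where "m = (1 / sinh t) *\<^sub>R (b - cosh t *\<^sub>R q)"
  have S: "sinh s > 0" "sinh t > 0" using len by auto
  have cs: "cosh s * cosh s = 1 + sinh s * sinh s" "cosh t * cosh t = 1 + sinh t * sinh t"
    using cosh_square_eq[of s] cosh_square_eq[of t] by (simp_all add: power2_eq_square)
  have aq: "mink a q = cosh s * mink p q" and pb: "mink p b = cosh t * mink p q"
    using ra hyp len by (auto simp: right_angle_mink mink_commute)
  have n: "mink n p = 0" "mink n q = 0" "mink n n = 1"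
    using S cs len pp aq by (simp_all add: n_def mink_commute[of a p] field_simps)
  have m: "mink m p = 0" "mink m q = 0" "mink m m = 1"
    using S cs len pp pb by (simp_all add: m_def mink_commute[of b q] mink_commute[of b p] mink_commute[of q p] field_simps)
  have nz: "(mink p q)\<^sup>2 \<noteq> 1" using pq by (auto simp: power2_eq_1_iff)
  \<comment> \<open>Two parallel unit vectors differ by a sign; their positive products with
    \<open>\<nu>\<close> exclude the minus.\<close>
  have nm: "n = mink m n *\<^sub>R m"
    using mink_orthogonal_parallel[OF n(1,2) m(1,2) pp(1,2) nz] m(3) by simp
  then have "1 = mink m n * mink m n" using n(3) m(3)
    by (metis mink_linear(6) mink_commute)
  moreover have "mink \<nu> n > 0" "mink \<nu> m > 0" using \<nu> S by (simp_all add: n_def m_def)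
  then have "mink m n > 0" using nm by (metis mink_linear(6) zero_less_mult_pos2)
  ultimately have "mink m n = 1"
    by (metis abs_mult_self_eq abs_of_pos real_sqrt_abs2 real_sqrt_one)
  then have "n = m" using nm by simp
  show ?thesis
  proof (rule that[of n])
    show "a = cosh s *\<^sub>R p + sinh s *\<^sub>R n" using S by (simp add: n_def)
    show "b = cosh t *\<^sub>R q + sinh t *\<^sub>R n" unfolding \<open>n = m\<close> using S by (simp add: m_def)
  qed (use n in auto)
qed

text \<open>The product of the unit normals \<open>n2\<close> and \<open>n4\<close> of the two other
  black lines is computed twice. Along their common perpendicular through \<open>v3\<close> and
  \<open>v4\<close> it is \<open>- cosh z\<close>; through \<open>v0\<close> and \<open>v1\<close>
  it is \<open>cosh x * cosh y - c * sinh x * sinh y\<close>, where \<open>c\<close> is the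
  unknown.\<close>

lemma hexagon_cosine_law:
  assumes hyp: "{v0, v1, v2, v3, v4, v5} \<subseteq> hyp_plane"
    and ra: "right_angle v5 v0 v1" "right_angle v0 v1 v2" "right_angle v1 v2 v3"
      "right_angle v2 v3 v4" "right_angle v3 v4 v5" "right_angle v4 v5 v0"
    and side: "strictly_one_side v0 v1 {v5, v2}" "strictly_one_side v2 v3 {v1, v4}"
      "strictly_one_side v4 v5 {v3, v0}"
    and dist: "mink v0 v1 < - 1" "mink v2 v3 < - 1" "mink v4 v5 < - 1"
    and len: "mink v5 v0 = - cosh x" "mink v1 v2 = - cosh y" "mink v3 v4 = - cosh z"
    and pos: "x > 0" "y > 0" "z > 0"
  shows "- mink v0 v1 = (cosh z + cosh x * cosh y) / (sinh x * sinh y)"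
proof -
  have S: "sinh x > 0" "sinh y > 0" "sinh z > 0" using pos by auto
  have sq: "cosh x ^ 2 = sinh x ^ 2 + 1" "cosh y ^ 2 = sinh y ^ 2 + 1" "cosh z ^ 2 = sinh z ^ 2 + 1"
    by (simp_all add: cosh_square_eq)
  note cm = mink_commute
  obtain n0 where n0: "mink n0 n0 = 1" "mink n0 v0 = 0" "mink n0 v1 = 0"
    "v5 = cosh x *\<^sub>R v0 + sinh x *\<^sub>R n0" "v2 = cosh y *\<^sub>R v1 + sinh y *\<^sub>R n0"
    using same_side_perpendiculars[of v5 v0 v1 v2 x y] hyp ra side dist len pos by (auto simp: cm)
  obtain n2 where n2: "mink n2 n2 = 1" "mink n2 v2 = 0" "mink n2 v3 = 0"
    "v1 = cosh y *\<^sub>R v2 + sinh y *\<^sub>R n2" "v4 = cosh z *\<^sub>R v3 + sinh z *\<^sub>R n2"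
    using same_side_perpendiculars[of v1 v2 v3 v4 y z] hyp ra side dist len pos by (auto simp: cm)
  obtain n4 where n4: "mink n4 n4 = 1" "mink n4 v4 = 0" "mink n4 v5 = 0"
    "v3 = cosh z *\<^sub>R v4 + sinh z *\<^sub>R n4" "v0 = cosh x *\<^sub>R v5 + sinh x *\<^sub>R n4"
    using same_side_perpendiculars[of v3 v4 v5 v0 z x] hyp ra side dist len pos by (auto simp: cm)
  have vv: "mink v0 v0 = -1" "mink v1 v1 = -1" "mink v2 v2 = -1" "mink v3 v3 = -1" "mink v4 v4 = -1" "mink v5 v5 = -1"
    using hyp by (auto simp: hyp_plane_mink)
  define c where "c = - mink v0 v1"
  have "v4 - cosh z *\<^sub>R v3 = sinh z *\<^sub>R n2" "v3 - cosh z *\<^sub>R v4 = sinh z *\<^sub>R n4"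
    using n2(5) n4(4) by (metis add_diff_cancel_left')+
  then have "sinh z ^ 2 * mink n2 n4 = mink (v4 - cosh z *\<^sub>R v3) (v3 - cosh z *\<^sub>R v4)"
    by (simp only: mink_linear) (simp add: power2_eq_square)
  also have "\<dots> = - cosh z * (cosh z ^ 2 - 1)"
    using len vv by (simp add: cm[of v4 v3] power2_eq_square algebra_simps)
  also have "\<dots> = sinh z ^ 2 * (- cosh z)" using sq(3) by (simp add: algebra_simps)
  finally have z: "mink n2 n4 = - cosh z"
    using S(3) by (metis less_irrefl mult_cancel_left power_not_zero)
  have d2: "v1 - cosh y *\<^sub>R v2 = sinh y *\<^sub>R n2" and d4: "v0 - cosh x *\<^sub>R v5 = sinh x *\<^sub>R n4"
    using n2(4) n4(5) by (metis add_diff_cancel_left')+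
  have "sinh y * sinh x * mink n2 n4 = mink (v1 - cosh y *\<^sub>R v2) (v0 - cosh x *\<^sub>R v5)"
    unfolding d2 d4 by simp
  also have "\<dots> = - c * (cosh x ^ 2 - 1) * (cosh y ^ 2 - 1) + cosh x * cosh y * sinh x * sinh y"
    unfolding n0(4,5) c_def using vv n0(1-3)
    by (simp add: cm[of v1 v0] cm[of v0 n0] cm[of v1 n0] power2_eq_square algebra_simps)
  also have "\<dots> = sinh y * sinh x * (- c * sinh x * sinh y + cosh x * cosh y)"
    unfolding sq by (simp add: algebra_simps power2_eq_square)
  finally have "mink n2 n4 = - c * sinh x * sinh y + cosh x * cosh y"
    using S by simp
  with z have "c * (sinh x * sinh y) = cosh z + cosh x * cosh y" by simp
  then show ?thesis using S unfolding c_def by (simp add: field_simps)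
qed

section \<open>Existence and uniqueness of the hexagon with given red lengths\<close>

lemma exhaust_6: "(k::6) = 0 \<or> k = 1 \<or> k = 2 \<or> k = 3 \<or> k = 4 \<or> k = 5"
proof (cases k)
  case (of_int z)
  then have "z = 0 \<or> z = 1 \<or> z = 2 \<or> z = 3 \<or> z = 4 \<or> z = 5" by auto
  then show ?thesis using of_int by auto
qed

lemma cyclic_numerals:
  "(3::3) = 0" "(4::3) = 1" "(- 1::3) = 2" "(- 2::3) = 1" "(- 3::3) = 0" "(6::6) = 0" "(- 1::6) = 5"
  by simp_all

lemma exhaust_3': "(k::3) = 0 \<or> k = 1 \<or> k = 2"
  using exhaust_3[of k] cyclic_numerals(1) by auto

text \<open>Uniqueness half for the description \<open>black_lengths\<close>. The cosine law is
  applied to the three rotations of the hexagon that start at the vertices 0, 2 and 4, where the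
  black edges begin.\<close>

lemma black_length_law:
  assumes hex: "right_angled_hexagon v" and len: "has_side_lengths v b r" and pos: "\<And>k. r k > 0"
  shows "b i = arcosh ((cosh (r i) + cosh (r (i + 1)) * cosh (r (i + 2))) / (sinh (r (i + 1)) * sinh (r (i + 2))))"
proof -
  have hyp: "v k \<in> hyp_plane" for k
    using hex by (auto simp: right_angled_hexagon_def)
  have ra: "right_angle (v (k - 1)) (v k) (v (k + 1))" for k
    using hex by (auto simp: right_angled_hexagon_def)
  have side: "strictly_one_side (v k) (v (k + 1)) (v ` (- {k, k + 1}))" for k
    using hex by (auto simp: right_angled_hexagon_def)
  have inj: "v k \<noteq> v l" if "k \<noteq> l" for k l
    using hex that by (auto simp: right_angled_hexagon_def inj_def)
  define m where "m k l = mink (v k) (v l)" for k l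
  have m: "m k l < - 1" if "k \<noteq> l" for k l
    unfolding m_def using mink_less_minus_one hyp inj that by blast
  have red: "mink (v k) (v l) = - cosh d" if "hyp_dist (v k) (v l) = d" "k \<noteq> l" for k l d
    using m[OF that(2)] that(1) cosh_arcosh_real[of "- m k l"] by (auto simp: hyp_dist_def m_def)
  have black: "b j = arcosh X" if "hyp_dist (v k) (v l) = b j" "- mink (v k) (v l) = X" for k l j X
    using that by (simp add: hyp_dist_def)
  have sub: "strictly_one_side p q T" if "strictly_one_side p q S" "T \<subseteq> S" for p q S T
    using that unfolding strictly_one_side_def by blast
  note L = len[unfolded has_side_lengths_def]
  have ra': "right_angle (v 5) (v 0) (v 1)" "right_angle (v 0) (v 1) (v 2)" "right_angle (v 1) (v 2) (v 3)"
      "right_angle (v 2) (v 3) (v 4)" "right_angle (v 3) (v 4) (v 5)" "right_angle (v 4) (v 5) (v 0)"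
    using ra[of 0] ra[of 1] ra[of 2] ra[of 3] ra[of 4] ra[of 5] by (simp_all add: cyclic_numerals)
  have side': "strictly_one_side (v 0) (v 1) {v 5, v 2}" "strictly_one_side (v 2) (v 3) {v 1, v 4}"
      "strictly_one_side (v 4) (v 5) {v 3, v 0}"
    using sub[OF side[of 0]] sub[OF side[of 2]] sub[OF side[of 4]] by (auto simp: cyclic_numerals)
  have lt: "mink (v 0) (v 1) < - 1" "mink (v 2) (v 3) < - 1" "mink (v 4) (v 5) < - 1"
    using m[of 0 1] m[of 2 3] m[of 4 5] by (simp_all add: m_def)
  have L': "mink (v 5) (v 0) = - cosh (r 1)" "mink (v 1) (v 2) = - cosh (r 2)" "mink (v 3) (v 4) = - cosh (r 0)"
    using L by (auto intro!: red)
  have 0: "b 0 = arcosh ((cosh (r 0) + cosh (r 1) * cosh (r 2)) / (sinh (r 1) * sinh (r 2)))"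
    by (rule black[of 0 1]) (use L ra' side' lt L' pos hyp in \<open>auto intro!: hexagon_cosine_law[of _ _ "v 2" "v 3" "v 4" "v 5"]\<close>)
  have 1: "b 1 = arcosh ((cosh (r 1) + cosh (r 2) * cosh (r 0)) / (sinh (r 2) * sinh (r 0)))"
    by (rule black[of 2 3]) (use L ra' side' lt L' pos hyp in \<open>auto intro!: hexagon_cosine_law[of _ _ "v 4" "v 5" "v 0" "v 1"]\<close>)
  have 2: "b 2 = arcosh ((cosh (r 2) + cosh (r 0) * cosh (r 1)) / (sinh (r 0) * sinh (r 1)))"
    by (rule black[of 4 5]) (use L ra' side' lt L' pos hyp in \<open>auto intro!: hexagon_cosine_law[of _ _ "v 0" "v 1" "v 2" "v 3"]\<close>)
  show ?thesis
    using exhaust_3'[of i] 0 1 2 by (auto simp: cyclic_numerals)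
qed

text \<open>Existence half. Unit normals with products \<open>- c k\<close> describe three lines at
  mutual distances \<open>r k\<close>. Their Gram determinant is \<open>- E\<close>, and
  \<open>E > 0\<close> is what makes the first coordinate \<open>D / s 2\<close> of the third normal
  real.\<close>

lemma right_angled_hexagon_exists:
  assumes pos: "\<And>k. r k > 0"
  shows "\<exists>v b. right_angled_hexagon v \<and> has_side_lengths v b r"
proof -
  define c s where "c k = cosh (r k)" and "s k = sinh (r k)" for k
  have s: "s k > 0" and c0: "c k > 0" and cs: "c k ^ 2 = 1 + s k ^ 2" for k
    using pos[of k] by (auto simp: s_def c_def cosh_square_eq)
  define E where "E = c 0 ^ 2 + c 1 ^ 2 + c 2 ^ 2 + 2 * c 0 * c 1 * c 2 - 1"
  have E: "E > 0" unfolding E_def using c0 cs[of 0] zero_le_power2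
    by (smt (verit) mult_pos_pos)
  define D where "D = sqrt E"
  have D: "D ^ 2 = E" using E by (simp add: D_def)
  txt \<open>\<open>n0\<close>, \<open>n1\<close>, \<open>n2\<close> are the inner unit normals of the three black lines; their products have to be
    \<open>- c k\<close>. The vertex \<open>p n m k\<close> is the foot on line \<open>n\<close> of the common perpendicular to lines \<open>n\<close> and \<open>m\<close>.\<close>
  define n0 where "n0 = (vector [0, 1, 0] :: real^3)"
  define n1 where "n1 = (vector [0, - c 2, - s 2] :: real^3)"
  define n2 where "n2 = (vector [D / s 2, - c 1, - (c 0 + c 1 * c 2) / s 2] :: real^3)"
  have D2: "D * D = E" "s 2 * s 2 = c 2 * c 2 - 1" using D cs[of 2] by (simp_all add: power2_eq_square)
  have g22: "mink n2 n2 = 1"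
  proof -
    define X where "X = c 0 + c 1 * c 2"
    have "mink n2 n2 = (D * D - X * X) / (s 2 * s 2) + c 1 * c 1"
      unfolding n2_def mink_def vector_3 X_def[symmetric] by (simp add: diff_divide_distrib)
    also have "D * D - X * X = (s 2 * s 2) * (1 - c 1 * c 1)"
      unfolding D2 E_def X_def by (simp add: algebra_simps power2_eq_square)
    finally show ?thesis using s[of 2] by simp
  qed
  have g: "mink n0 n0 = 1" "mink n1 n1 = 1" "mink n2 n2 = 1" "mink n0 n1 = - c 2" "mink n0 n2 = - c 1" "mink n1 n2 = - c 0"
      "mink n1 n0 = - c 2" "mink n2 n0 = - c 1" "mink n2 n1 = - c 0"
    using s[of 2] cs[of 2] g22 by (simp_all add: n0_def n1_def n2_def mink_def power2_eq_square field_simps)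
  define p where "p n m k = - (1 / s k) *\<^sub>R (m + c k *\<^sub>R n)" for n m :: "real^3" and k
  define v where "v k = (if k = 0 then p n0 n2 1 else if k = 1 then p n0 n1 2 else if k = 2 then p n1 n0 2
     else if k = 3 then p n1 n2 0 else if k = 4 then p n2 n1 0 else p n2 n0 1)" for k :: 6
  have v: "v 0 = p n0 n2 1" "v 1 = p n0 n1 2" "v 2 = p n1 n0 2" "v 3 = p n1 n2 0" "v 4 = p n2 n1 0" "v 5 = p n2 n0 1"
    by (simp_all add: v_def)
  have sq: "s k * s k = c k * c k - 1" for k using cs[of k] by (simp add: power2_eq_square)
  have nz: "s k \<noteq> 0" for k using s[of k] by simp
  have p: "mink n (p l m k) = - (mink n m + c k * mink n l) / s k" for n l m k
    by (simp add: p_def add_divide_distrib diff_divide_distrib)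
  have p': "mink (p l m k) n = - (mink m n + c k * mink l n) / s k" for n l m k
    by (simp add: p_def add_divide_distrib diff_divide_distrib)
  \<comment> \<open>Each normal vanishes at the two vertices on its line and is positive at the four
    others. This gives the side conditions of the black edges and later helps to tell the vertices
    apart.\<close>
  have t: "mink (v 0) n0 = 0" "mink (v 0) n1 = (c 0 + c 1 * c 2) / s 1" "mink (v 0) n2 = s 1"
    "mink (v 1) n0 = 0" "mink (v 1) n1 = s 2" "mink (v 1) n2 = (c 0 + c 1 * c 2) / s 2"
    "mink (v 2) n0 = s 2" "mink (v 2) n1 = 0" "mink (v 2) n2 = (c 1 + c 0 * c 2) / s 2"
    "mink (v 3) n0 = (c 1 + c 0 * c 2) / s 0" "mink (v 3) n1 = 0" "mink (v 3) n2 = s 0"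
    "mink (v 4) n0 = (c 2 + c 0 * c 1) / s 0" "mink (v 4) n1 = s 0" "mink (v 4) n2 = 0"
    "mink (v 5) n0 = s 1" "mink (v 5) n1 = (c 2 + c 0 * c 1) / s 1" "mink (v 5) n2 = 0"
    unfolding v p' g using nz by (simp_all add: field_simps sq)
  have pos3: "c 0 + c 1 * c 2 > 0" "c 1 + c 0 * c 2 > 0" "c 2 + c 0 * c 1 > 0"
    using c0 by (simp_all add: add_pos_pos)
  have v1: "v 1 $ 1 = 0" "v 1 $ 2 = 0" "v 1 $ 3 = 1"
    using nz by (simp_all add: v p_def n0_def n1_def)
  \<comment> \<open>The coordinates place \<open>v 1\<close> at the apex \<open>(0, 0, 1)\<close>,
    so \<open>- mink (v k) (v 1)\<close> is the third coordinate of \<open>v k\<close>; its sign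
    puts every vertex on the upper sheet.\<close>
  have neg: "mink (v k) (v 1) < 0" for k
  proof -
    have "mink (v k) (v 1) = - (mink (v k) n1 + c 2 * mink (v k) n0) / s 2"
      unfolding v(2) p ..
    moreover have "mink (v k) n1 + c 2 * mink (v k) n0 > 0"
      using exhaust_6[of k] s c0 pos3 by (elim disjE) (simp_all add: t add_pos_pos)
    ultimately show ?thesis using s[of 2] by (simp add: divide_less_0_iff)
  qed
  have unit: "mink (v k) (v k) = - 1" for k
    using exhaust_6[of k] nz by (auto simp: v p p' g field_simps) (simp_all add: sq algebra_simps)
  have hyp: "v k \<in> hyp_plane" for k
    using neg[of k] unit[of k] by (simp add: hyp_plane_def mink_def[of "v k" "v 1"] v1)
  have mm: "mink (v 0) (v 1) = - ((c 0 + c 1 * c 2) / (s 1 * s 2))"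
    "mink (v 1) (v 2) = - c 2"
    "mink (v 2) (v 3) = - ((c 1 + c 0 * c 2) / (s 2 * s 0))"
    "mink (v 3) (v 4) = - c 0"
    "mink (v 4) (v 5) = - ((c 2 + c 0 * c 1) / (s 0 * s 1))"
    "mink (v 5) (v 0) = - c 1"
    subgoal unfolding v(2) p t using nz[of 0] nz[of 1] nz[of 2] sq[of 0] sq[of 1] sq[of 2] by (simp add: divide_simps) ((algebra)?)
    subgoal unfolding v(3) p t using nz[of 0] nz[of 1] nz[of 2] sq[of 0] sq[of 1] sq[of 2] by (simp add: divide_simps) ((algebra)?)
    subgoal unfolding v(4) p t using nz[of 0] nz[of 1] nz[of 2] sq[of 0] sq[of 1] sq[of 2] by (simp add: divide_simps) ((algebra)?)
    subgoal unfolding v(5) p t using nz[of 0] nz[of 1] nz[of 2] sq[of 0] sq[of 1] sq[of 2] by (simp add: divide_simps) ((algebra)?)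
    subgoal unfolding v(6) p t using nz[of 0] nz[of 1] nz[of 2] sq[of 0] sq[of 1] sq[of 2] by (simp add: divide_simps) ((algebra)?)
    subgoal unfolding v(1) p t using nz[of 0] nz[of 1] nz[of 2] sq[of 0] sq[of 1] sq[of 2] by (simp add: divide_simps) ((algebra)?)
    done
  have mm2: "mink (v 5) (v 1) = - (c 1 * ((c 0 + c 1 * c 2) / (s 1 * s 2)))"
    "mink (v 0) (v 2) = - (c 2 * ((c 0 + c 1 * c 2) / (s 1 * s 2)))"
    "mink (v 1) (v 3) = - (c 2 * ((c 1 + c 0 * c 2) / (s 2 * s 0)))"
    "mink (v 2) (v 4) = - (c 0 * ((c 1 + c 0 * c 2) / (s 2 * s 0)))"
    "mink (v 3) (v 5) = - (c 0 * ((c 2 + c 0 * c 1) / (s 0 * s 1)))"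
    "mink (v 4) (v 0) = - (c 1 * ((c 2 + c 0 * c 1) / (s 0 * s 1)))"
    subgoal unfolding v(2) p t using nz[of 0] nz[of 1] nz[of 2] sq[of 0] sq[of 1] sq[of 2] by (simp add: divide_simps) ((algebra)?)
    subgoal unfolding v(3) p t using nz[of 0] nz[of 1] nz[of 2] sq[of 0] sq[of 1] sq[of 2] by (simp add: divide_simps) ((algebra)?)
    subgoal unfolding v(4) p t using nz[of 0] nz[of 1] nz[of 2] sq[of 0] sq[of 1] sq[of 2] by (simp add: divide_simps) ((algebra)?)
    subgoal unfolding v(5) p t using nz[of 0] nz[of 1] nz[of 2] sq[of 0] sq[of 1] sq[of 2] by (simp add: divide_simps) ((algebra)?)
    subgoal unfolding v(6) p t using nz[of 0] nz[of 1] nz[of 2] sq[of 0] sq[of 1] sq[of 2] by (simp add: divide_simps) ((algebra)?)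
    subgoal unfolding v(1) p t using nz[of 0] nz[of 1] nz[of 2] sq[of 0] sq[of 1] sq[of 2] by (simp add: divide_simps) ((algebra)?)
    done
  have ra: "right_angle (v (k - 1)) (v k) (v (k + 1))" for k
    using exhaust_6[of k]
    by (elim disjE) (simp_all add: right_angle_mink[OF hyp] cyclic_numerals mm mm2)
  \<comment> \<open>The common perpendicular of the lines \<open>n\<close> and \<open>m\<close> lies
    in the span of these two vectors, so its normal is the part of \<open>l\<close> orthogonal to
    that span. The witness is this part times \<open>- (s' * s')\<close>, which clears the
    denominators.\<close>
  have red: "\<exists>\<nu>. mink \<nu> n = 0 \<and> mink \<nu> m = 0 \<and> mink \<nu> l < 0"
    if "mink n n = 1" "mink m m = 1" "mink l l = 1" "mink n m = - c'" "mink n l = - a" "mink m l = - b"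
      "c' * c' = 1 + s' * s'" "a * a + b * b + c' * c' + 2 * a * b * c' - 1 = E" for n m l a b c' s'
  proof (intro exI conjI)
    let ?\<nu> = "(a + b * c') *\<^sub>R n + (b + a * c') *\<^sub>R m - (s' * s') *\<^sub>R l"
    have s': "s' * s' = c' * c' - 1" using that(7) by simp
    note cm = mink_commute[of m n] mink_commute[of l n] mink_commute[of l m]
    show "mink ?\<nu> n = 0" "mink ?\<nu> m = 0" using that(1-6) cm
      unfolding s' by (simp_all add: algebra_simps)
    have "mink ?\<nu> l = - E" using that cm unfolding s' that(8)[symmetric] by (simp add: algebra_simps)
    then show "mink ?\<nu> l < 0" using E by simp
  qed
  have E': "c 0 * c 0 + c 1 * c 1 + c 2 * c 2 + 2 * c 0 * c 1 * c 2 - 1 = E"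
    by (simp add: E_def power2_eq_square)
  obtain m1 where m1: "mink m1 n0 = 0" "mink m1 n1 = 0" "mink m1 n2 < 0"
    using red[of n0 n1 n2 "c 2" "c 1" "c 0" "s 2"] g sq E' by (auto simp: algebra_simps)
  obtain m3 where m3: "mink m3 n1 = 0" "mink m3 n2 = 0" "mink m3 n0 < 0"
    using red[of n1 n2 n0 "c 0" "c 2" "c 1" "s 0"] g sq E' by (auto simp: algebra_simps)
  obtain m5 where m5: "mink m5 n2 = 0" "mink m5 n0 = 0" "mink m5 n1 < 0"
    using red[of n2 n0 n1 "c 1" "c 0" "c 2" "s 1"] g sq E' by (auto simp: algebra_simps)
  have side: "strictly_one_side (v k) (v (k + 1)) (v ` (- {k, k + 1}))" for k
  proof -
    have I: "strictly_one_side (v a) (v b) (v ` (- {a, b}))"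
      if "mink n (v a) = 0" "mink n (v b) = 0" "\<And>k. k \<noteq> a \<Longrightarrow> k \<noteq> b \<Longrightarrow> mink n (v k) > 0" for n a b
      using that unfolding strictly_one_side_def by blast
    have "mink (v k) n0 > 0" if "k \<noteq> 0" "k \<noteq> 1" for k
      using exhaust_6[of k] that s pos3 by (elim disjE) (simp_all add: t)
    then have sd0: "strictly_one_side (v 0) (v 1) (v ` (- {0, 1}))"
      by (intro I[of n0]) (simp_all add: mink_commute[of n0] t)
    have "mink (v k) n1 > 0" if "k \<noteq> 2" "k \<noteq> 3" for k
      using exhaust_6[of k] that s pos3 by (elim disjE) (simp_all add: t)
    then have sd2: "strictly_one_side (v 2) (v 3) (v ` (- {2, 3}))"
      by (intro I[of n1]) (simp_all add: mink_commute[of n1] t)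
    have "mink (v k) n2 > 0" if "k \<noteq> 4" "k \<noteq> 5" for k
      using exhaust_6[of k] that s pos3 by (elim disjE) (simp_all add: t)
    then have sd4: "strictly_one_side (v 4) (v 5) (v ` (- {4, 5}))"
      by (intro I[of n2]) (simp_all add: mink_commute[of n2] t)
    have "mink m1 (v k) > 0" if "k \<noteq> 1" "k \<noteq> 2" for k
      using exhaust_6[of k] that s c0 m1 by (elim disjE) (simp_all add: v p divide_neg_pos mult_pos_neg)
    then have sd1: "strictly_one_side (v 1) (v 2) (v ` (- {1, 2}))"
      using m1 by (intro I[of m1]) (simp_all add: v p)
    have "mink m3 (v k) > 0" if "k \<noteq> 3" "k \<noteq> 4" for k
      using exhaust_6[of k] that s c0 m3 by (elim disjE) (simp_all add: v p divide_neg_pos mult_pos_neg)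
    then have sd3: "strictly_one_side (v 3) (v 4) (v ` (- {3, 4}))"
      using m3 by (intro I[of m3]) (simp_all add: v p)
    have "mink m5 (v k) > 0" if "k \<noteq> 5" "k \<noteq> 0" for k
      using exhaust_6[of k] that s c0 m5 by (elim disjE) (simp_all add: v p divide_neg_pos mult_pos_neg)
    then have sd5: "strictly_one_side (v 5) (v 0) (v ` (- {5, 0}))"
      using m5 by (intro I[of m5]) (simp_all add: v p)
    show ?thesis using exhaust_6[of k]
      by (elim disjE) (use sd0 sd2 sd4 sd1 sd3 sd5 in \<open>simp_all add: cyclic_numerals\<close>)
  qed
  have "inj v"
  proof (rule injI)
    fix k l assume eq: "v k = v l"
    \<comment> \<open>A vertex is recovered from the side lines through it; the three black lines
      and two of the red ones suffice.\<close>
    have z: "(mink (v k) n0 = 0 \<longleftrightarrow> k \<in> {0, 1}) \<and> (mink (v k) n1 = 0 \<longleftrightarrow> k \<in> {2, 3}) \<and> (mink (v k) n2 = 0 \<longleftrightarrow> k \<in> {4, 5})" for k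
      using exhaust_6[of k] pos3 nz by (elim disjE) (simp_all add: t)
    have z': "(mink m1 (v k) = 0 \<longleftrightarrow> k \<in> {1, 2}) \<and> (mink m3 (v k) = 0 \<longleftrightarrow> k \<in> {3, 4})" for k
      using exhaust_6[of k] m1 m3 nz c0[of 0] c0[of 1] c0[of 2] by (elim disjE) (simp_all add: v p)
    have "(k \<in> {0, 1} \<longleftrightarrow> l \<in> {0, 1}) \<and> (k \<in> {2, 3} \<longleftrightarrow> l \<in> {2, 3}) \<and> (k \<in> {1, 2} \<longleftrightarrow> l \<in> {1, 2}) \<and> (k \<in> {3, 4} \<longleftrightarrow> l \<in> {3, 4})"
      using z[of k] z[of l] z'[of k] z'[of l] unfolding eq by blast
    then show "k = l" using exhaust_6[of k] exhaust_6[of l] by (elim disjE) simp_all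
  qed
  moreover have "has_side_lengths v (\<lambda>k. if k = 0 then hyp_dist (v 0) (v 1) else if k = 1 then hyp_dist (v 2) (v 3) else hyp_dist (v 4) (v 5)) r"
    using pos by (simp add: has_side_lengths_def hyp_dist_def mm) (simp add: c_def arcosh_cosh_real less_imp_le)
  ultimately show ?thesis
    using hyp ra side unfolding right_angled_hexagon_def by blast
qed

lemma black_lengths_eq:
  assumes pos: "\<And>k. r k > 0"
  shows "black_lengths r i = arcosh ((cosh (r i) + cosh (r (i + 1)) * cosh (r (i + 2))) / (sinh (r (i + 1)) * sinh (r (i + 2))))"
proof -
  obtain v b where vb: "right_angled_hexagon v" "has_side_lengths v b r"
    using right_angled_hexagon_exists[of r, OF pos] by blast
  have "black_lengths r = b"
    unfolding black_lengths_def
  proof (rule the_equality)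
    show "\<exists>v. right_angled_hexagon v \<and> has_side_lengths v b r" using vb by blast
    show "b' = b" if "\<exists>v. right_angled_hexagon v \<and> has_side_lengths v b' r" for b'
      using that black_length_law[OF vb pos] black_length_law[of _ b' r, OF _ _ pos] by (auto intro!: ext)
  qed
  then show ?thesis using black_length_law[OF vb pos] by simp
qed

section \<open>Powers of symmetric matrices\<close>

lemma quadratic_nonpos_imp_zero:
  fixes a b :: real
  assumes "\<And>t. t * a + t\<^sup>2 * b \<le> 0"
  shows "a = 0"
proof (rule ccontr)
  assume "a \<noteq> 0"
  define k where "k = \<bar>b\<bar> + 1"
  have k: "k > 0" "k + b > 0" by (simp_all add: k_def)
  define t where "t = a / k"
  have "t * a + t\<^sup>2 * b = a\<^sup>2 * (k + b) / k\<^sup>2"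
    using k by (simp add: t_def power2_eq_square field_simps)
  moreover have "\<dots> > 0" using \<open>a \<noteq> 0\<close> k by (intro divide_pos_pos mult_pos_pos) auto
  ultimately show False using assms[of t] by simp
qed

text \<open>Variational argument inside an invariant subspace: at a maximum \<open>v\<close> of the
  quadratic form on the unit sphere of \<open>S\<close>, the first variation in the directions of
  \<open>S\<close> orthogonal to \<open>v\<close> vanishes. Hence
  \<open>A *v v - c *\<^sub>R v\<close>, which lies in \<open>S\<close> and is orthogonal to
  \<open>v\<close>, is orthogonal to itself.\<close>

lemma symmetric_matrix_eigenvector:
  fixes A :: "real^'n^'n"
  assumes sym: "transpose A = A" and S: "subspace S" "S \<noteq> {0}" and inv: "\<And>x. x \<in> S \<Longrightarrow> A *v x \<in> S"
  obtains v c where "v \<in> S" "norm v = 1" "A *v v = c *\<^sub>R v"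
proof -
  have symA: "x \<bullet> (A *v y) = (A *v x) \<bullet> y" for x y
    using sym by (metis dot_lmul_matrix vector_transpose_matrix)
  define T where "T = S \<inter> sphere 0 1"
  have cT: "compact T" unfolding T_def using closed_subspace[OF S(1)] by (simp add: closed_Int_compact)
  obtain u where u: "u \<in> S" "u \<noteq> 0" using S subspace_0 by blast
  then have "(1 / norm u) *\<^sub>R u \<in> T" unfolding T_def using S(1) by (simp add: subspace_mul)
  then have ne: "T \<noteq> {}" by blast
  have "continuous_on T (\<lambda>x. x \<bullet> (A *v x))" by (intro continuous_intros matrix_vector_mult_linear_continuous_on)
  then obtain v where v: "v \<in> T" "\<And>x. x \<in> T \<Longrightarrow> x \<bullet> (A *v x) \<le> v \<bullet> (A *v v)"
    using continuous_attains_sup[OF cT ne] by blast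
  define c where "c = v \<bullet> (A *v v)"
  have vS: "v \<in> S" "norm v = 1" using v(1) by (auto simp: T_def)
  have vv: "v \<bullet> v = 1" using vS by (simp add: norm_eq_1)
  have ray: "x \<bullet> (A *v x) \<le> c * (x \<bullet> x)" if "x \<in> S" for x
  proof (cases "x = 0")
    case False
    have "(1 / norm x) *\<^sub>R x \<in> T" unfolding T_def using S(1) that False by (simp add: subspace_mul)
    from v(2)[OF this] have "(x \<bullet> (A *v x)) / (norm x)\<^sup>2 \<le> c"
      by (simp add: c_def matrix_vector_mult_scaleR power2_eq_square)
    then show ?thesis using False by (simp add: divide_le_eq power2_norm_eq_inner split: if_splits)
  qed simp
  have orth: "u \<bullet> (A *v v) = 0" if "u \<in> S" "u \<bullet> v = 0" for u
  proof -
    have "t * (2 * (u \<bullet> (A *v v))) + t\<^sup>2 * (u \<bullet> (A *v u) - c * (u \<bullet> u)) \<le> 0" for t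
    proof -
      have "v + t *\<^sub>R u \<in> S" using vS that S(1) by (simp add: subspace_add subspace_mul)
      from ray[OF this] show ?thesis
        using that(2) vv symA[of v u] by (simp add: inner_commute matrix_vector_right_distrib matrix_vector_mult_scaleR
            inner_add_left inner_add_right c_def power2_eq_square algebra_simps)
    qed
    then show ?thesis using quadratic_nonpos_imp_zero by fastforce
  qed
  define w where "w = A *v v - c *\<^sub>R v"
  have w: "w \<in> S" unfolding w_def using inv vS S(1) by (simp add: subspace_diff subspace_mul)
  have wv: "w \<bullet> v = 0" unfolding w_def inner_diff_left using vv by (simp add: c_def inner_commute)
  have "w \<bullet> w = w \<bullet> (A *v v) - c * (w \<bullet> v)" by (simp add: w_def inner_diff_right)
  then have "w \<bullet> w = 0" using orth[OF w wv] wv by simp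
  then show ?thesis using that[of v c] vS by (simp add: w_def)
qed

text \<open>By symmetry the vectors of \<open>S\<close> orthogonal to an eigenvector form an
  invariant subspace of smaller dimension; this is why the eigenvector lemma is relative to a
  subspace.\<close>

lemma symmetric_matrix_eigenbasis:
  fixes A :: "real^'n^'n"
  assumes sym: "transpose A = A" and "subspace S" "\<And>x. x \<in> S \<Longrightarrow> A *v x \<in> S"
  shows "\<exists>B\<subseteq>S. pairwise orthogonal B \<and> (\<forall>v\<in>B. norm v = 1 \<and> (\<exists>c. A *v v = c *\<^sub>R v)) \<and> span B = S"
  using assms(2,3)
proof (induction "dim S" arbitrary: S rule: less_induct)
  case less
  show ?case
  proof (cases "S = {0}")
    case True
    then show ?thesis by (intro exI[of _ "{}"]) auto
  next
    case False
    obtain v c where v: "v \<in> S" "norm v = 1" "A *v v = c *\<^sub>R v"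
      using symmetric_matrix_eigenvector[OF sym less.prems(1) False less.prems(2)] by metis
    have vv: "v \<bullet> v = 1" using v by (simp add: norm_eq_1)
    define S' where "S' = S \<inter> {x. v \<bullet> x = 0}"
    have S': "subspace S'" unfolding S'_def using less.prems(1) by (intro subspace_inter subspace_hyperplane)
    have "v \<notin> S'" using vv by (simp add: S'_def)
    then have "S' \<subset> S" using v(1) S'_def by blast
    then have "dim S' < dim S" using S' less.prems(1) by (metis dim_psubset span_eq_iff)
    moreover have "A *v x \<in> S'" if "x \<in> S'" for x
    proof -
      have "v \<bullet> (A *v x) = (A *v v) \<bullet> x" using sym by (metis dot_lmul_matrix vector_transpose_matrix)
      then show ?thesis using that less.prems(2) v(3) by (simp add: S'_def)
    qed
    ultimately obtain B where B: "B \<subseteq> S'" "pairwise orthogonal B"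
      "\<forall>v\<in>B. norm v = 1 \<and> (\<exists>c. A *v v = c *\<^sub>R v)" "span B = S'"
      using less.hyps[OF _ S'] by blast
    show ?thesis
    proof (intro exI[of _ "insert v B"] conjI)
      show "insert v B \<subseteq> S" using B(1) v(1) S'_def by blast
      show "pairwise orthogonal (insert v B)"
        using B(1,2) by (auto simp: pairwise_insert S'_def orthogonal_def inner_commute)
      show "\<forall>v\<in>insert v B. norm v = 1 \<and> (\<exists>c. A *v v = c *\<^sub>R v)" using B(3) v by blast
      show "span (insert v B) = S"
      proof
        show "span (insert v B) \<subseteq> S"
          using less.prems(1) v(1) B(1) by (intro span_minimal) (auto simp: S'_def)
        show "S \<subseteq> span (insert v B)"
        proof
          fix x assume x: "x \<in> S"
          have "x - (v \<bullet> x) *\<^sub>R v \<in> span B"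
            using x v(1) vv less.prems(1) by (simp add: B(4) S'_def subspace_diff subspace_mul inner_diff_right)
          then show "x \<in> span (insert v B)" by (meson span_breakdown_eq)
        qed
      qed
    qed
  qed
qed

lemma symmetric_matrix_diagonalizable:
  fixes A :: "real^'n^'n"
  assumes sym: "transpose A = A"
  obtains P d where "orthogonal_matrix P" "A = transpose P ** diag_matrix d ** P"
proof -
  obtain B where B: "pairwise orthogonal B" "\<forall>v\<in>B. norm v = 1 \<and> (\<exists>c. A *v v = c *\<^sub>R v)" "span B = UNIV"
    using symmetric_matrix_eigenbasis[OF sym subspace_UNIV] by auto
  have "0 \<notin> B" using B(2) by force
  then have ind: "independent B" using B(1) pairwise_orthogonal_independent by blast
  then have "finite B" using finiteI_independent by blast
  have "card B = CARD('n)" using basis_card_eq_dim[of B UNIV] B(3) ind by simp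
  then obtain p :: "'n \<Rightarrow> real^'n" where p: "bij_betw p UNIV B"
    using finite_same_card_bij[of "UNIV :: 'n set" B] \<open>finite B\<close> by auto
  then have pB: "p i \<in> B" for i by (auto simp: bij_betw_def)
  have "\<exists>c. A *v p i = c *\<^sub>R p i" for i using B(2) pB by blast
  then obtain d where d: "A *v p i = d i *\<^sub>R p i" for i by metis
  define P :: "real^'n^'n" where "P = (\<chi> i. p i)"
  have P: "orthogonal_matrix P"
    unfolding orthogonal_matrix_orthonormal_rows
  proof (intro conjI allI impI)
    show "norm (row i P) = 1" for i using B(2) pB by (simp add: row_def P_def)
    show "orthogonal (row i P) (row j P)" if "i \<noteq> j" for i j
    proof -
      have "p i \<noteq> p j" using p that by (auto simp: bij_betw_def inj_def)
      then show ?thesis using B(1) pB by (simp add: row_def P_def pairwise_def)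
    qed
  qed
  have "A ** transpose P = transpose P ** diag_matrix d"
  proof -
    have "(A ** transpose P) $ i $ j = (A *v p j) $ i" for i j
      by (simp add: matrix_matrix_mult_def matrix_vector_mult_def transpose_def P_def)
    moreover have "(transpose P ** diag_matrix d) $ i $ j = d j * p j $ i" for i j
      by (simp add: matrix_matrix_mult_def transpose_def P_def diag_matrix_def if_distrib mult.commute cong: if_cong)
    ultimately show ?thesis unfolding vec_eq_iff by (simp add: d)
  qed
  then have "A ** (transpose P ** P) = transpose P ** diag_matrix d ** P"
    by (simp add: matrix_mul_assoc)
  moreover have "transpose P ** P = mat 1" using P by (simp add: orthogonal_matrix_def)
  ultimately show ?thesis using that P by simp
qed

section \<open>Perturbation of spectra and matrix powers\<close>

lemma matrix_diff_distrib:
  fixes A :: "real^'n^'m"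
  shows "A ** (B - C) = A ** B - A ** C" "(D - E) ** A = D ** A - E ** A"
  by (simp_all add: matrix_matrix_mult_def vec_eq_iff algebra_simps sum_subtractf)

lemma diag_matrix_mult_vec: "(diag_matrix d *v x) $ i = d i * x $ i"
  by (simp add: diag_matrix_def matrix_vector_mult_def if_distrib if_distribR cong: if_cong)

lemma inner_transpose_mult: "x \<bullet> (transpose P *v y) = (P *v x) \<bullet> (y :: real^'n)"
  by (metis dot_lmul_matrix vector_transpose_matrix)

lemma inner_diagonalized:
  "x \<bullet> ((transpose P ** diag_matrix d ** P) *v y) = (\<Sum>i\<in>UNIV. d i * (P *v x) $ i * (P *v y) $ i)"
proof -
  have "x \<bullet> ((transpose P ** diag_matrix d ** P) *v y) = (P *v x) \<bullet> (diag_matrix d *v (P *v y))"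
    by (metis inner_transpose_mult matrix_vector_mul_assoc)
  then show ?thesis by (simp add: inner_vec_def diag_matrix_mult_vec ac_simps)
qed

lemma orthogonal_matrix_norm:
  fixes P :: "real^'n^'n"
  assumes "orthogonal_matrix P"
  shows "norm (P *v x) = norm x"
proof -
  have "transpose P *v (P *v x) = x"
    using assms by (simp only: matrix_vector_mul_assoc orthogonal_matrix_def matrix_vector_mul_lid)
  then have "(P *v x) \<bullet> (P *v x) = x \<bullet> x" using inner_transpose_mult[of x P "P *v x"] by simp
  then show ?thesis by (simp only: norm_eq)
qed

lemma norm_transpose: "norm (transpose X) = norm (X :: real^'n^'m)"
proof -
  have "(norm (transpose X))\<^sup>2 = (norm X)\<^sup>2"
    unfolding power2_norm_eq_inner inner_vec_def transpose_def by simp (rule sum.swap)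
  then show ?thesis by simp
qed

text \<open>The norm of \<open>real^'n^'n\<close> is the Frobenius norm: right multiplication acts
  on each row by an orthogonal matrix, and left multiplication is the transposed case.\<close>

lemma norm_orthogonal_mult:
  fixes X :: "real^'n^'n"
  assumes "orthogonal_matrix Q"
  shows "norm (X ** Q) = norm X" "norm (Q ** X) = norm X"
proof -
  have r: "norm (X ** Q) = norm X" if "orthogonal_matrix Q" for X Q :: "real^'n^'n"
  proof -
    have "(X ** Q) $ i = transpose Q *v (X $ i)" for i
      by (simp add: vec_eq_iff matrix_matrix_mult_def matrix_vector_mult_def transpose_def mult.commute)
    then have "norm ((X ** Q) $ i) = norm (X $ i)" for i
      using that by (simp only: orthogonal_matrix_norm orthogonal_matrix_transpose)
    then show ?thesis by (simp add: norm_vec_def)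
  qed
  then show "norm (X ** Q) = norm X" using assms by blast
  show "norm (Q ** X) = norm X"
    using r[of "transpose Q" "transpose X"] assms norm_transpose[of "Q ** X"] norm_transpose[of X]
    by (simp add: matrix_transpose_mul orthogonal_matrix_transpose)
qed

text \<open>In the two eigenbases the difference has the entries \<open>(d i - e j) u\<^sub>j\<^sub>i\<close> with \<open>u = Q P\<^sup>T\<close>,
  and the same holds after applying \<open>f\<close> to the eigenvalues.\<close>

lemma spectral_lipschitz:
  fixes P Q :: "real^'n^'n"
  assumes P: "orthogonal_matrix P" and Q: "orthogonal_matrix Q"
    and f: "\<And>i j. \<bar>f (d i) - f (e j)\<bar> \<le> L * \<bar>d i - e j\<bar>" and L: "L \<ge> 0"
  shows "norm (transpose P ** diag_matrix (\<lambda>i. f (d i)) ** P - transpose Q ** diag_matrix (\<lambda>i. f (e i)) ** Q)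
     \<le> L * norm (transpose P ** diag_matrix d ** P - transpose Q ** diag_matrix e ** Q)"
proof -
  have tP: "orthogonal_matrix (transpose P)" using P by (simp only: orthogonal_matrix_transpose)
  define U where "U = Q ** transpose P"
  have *: "norm (transpose P ** diag_matrix d ** P - transpose Q ** diag_matrix e ** Q)
     = norm (\<chi> j i. (d i - e j) * U $ j $ i)" for d e
  proof -
    let ?X = "transpose P ** diag_matrix d ** P - transpose Q ** diag_matrix e ** Q"
    have "norm ?X = norm (Q ** ?X ** transpose P)"
      by (simp only: norm_orthogonal_mult(1)[OF tP] norm_orthogonal_mult(2)[OF Q])
    also have "Q ** ?X ** transpose P =
       (Q ** transpose P) ** diag_matrix d ** (P ** transpose P) - (Q ** transpose Q) ** diag_matrix e ** (Q ** transpose P)"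
      by (simp add: matrix_diff_distrib matrix_mul_assoc)
    also have "\<dots> = U ** diag_matrix d - diag_matrix e ** U"
      using P Q by (simp add: orthogonal_matrix_def U_def)
    also have "\<dots> = (\<chi> j i. (d i - e j) * U $ j $ i)"
      by (simp add: vec_eq_iff matrix_matrix_mult_def diag_matrix_def if_distrib if_distribR algebra_simps cong: if_cong)
    finally show ?thesis .
  qed
  have "norm (\<chi> j i. (f (d i) - f (e j)) * U $ j $ i) \<le> norm (L *\<^sub>R (\<chi> j i. (d i - e j) * U $ j $ i))"
  proof (rule norm_le_componentwise_cart, rule norm_le_componentwise_cart)
    fix j i
    show "norm ((\<chi> j i. (f (d i) - f (e j)) * U $ j $ i) $ j $ i) \<le> norm ((L *\<^sub>R (\<chi> j i. (d i - e j) * U $ j $ i)) $ j $ i)"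
      using f[of i j] L by (simp add: abs_mult mult_right_mono flip: mult.assoc)
  qed
  then show ?thesis unfolding * using L by simp
qed

lemma powr_lipschitz:
  fixes m M s :: real
  assumes "m > 0"
  obtains L where "L \<ge> 0" "\<And>x y. x \<in> {m..M} \<Longrightarrow> y \<in> {m..M} \<Longrightarrow> \<bar>x powr s - y powr s\<bar> \<le> L * \<bar>x - y\<bar>"
proof -
  have "continuous_on {m..M} (\<lambda>x. s * x powr (s - 1))"
    using assms by (intro continuous_intros) auto
  then have "bounded ((\<lambda>x. s * x powr (s - 1)) ` {m..M})"
    by (intro compact_imp_bounded compact_continuous_image) auto
  then obtain L where L: "L > 0" "\<And>x. x \<in> {m..M} \<Longrightarrow> \<bar>s * x powr (s - 1)\<bar> \<le> L"
    by (auto simp: bounded_pos)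
  show ?thesis
  proof (rule that[of L])
    fix x y assume xy: "x \<in> {m..M}" "y \<in> {m..M}"
    have "((\<lambda>x. x powr s) has_field_derivative s * x powr (s - 1)) (at x within {m..M})" if "x \<in> {m..M}" for x
      using that assms by (auto intro!: derivative_eq_intros)
    then show "\<bar>x powr s - y powr s\<bar> \<le> L * \<bar>x - y\<bar>"
      using field_differentiable_bound[of "{m..M}" "\<lambda>x. x powr s" "\<lambda>x. s * x powr (s - 1)" L x y] L(2) xy by simp
  qed (use L in simp)
qed

text \<open>The symmetric matrices with spectrum between \<open>m\<close> and \<open>M\<close>,
  expressed by the quadratic form because this formulation passes easily to nearby matrices.\<close>

definition rayleigh_bounds :: "real \<Rightarrow> real \<Rightarrow> (real^'n^'n) set" where
  "rayleigh_bounds m M =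
     {A. transpose A = A \<and> (\<forall>x. m * (norm x)\<^sup>2 \<le> x \<bullet> (A *v x) \<and> x \<bullet> (A *v x) \<le> M * (norm x)\<^sup>2)}"

lemma rayleigh_bounds_diagonalizable:
  fixes A :: "real^'n^'n"
  assumes "A \<in> rayleigh_bounds m M"
  obtains P d where "orthogonal_matrix P" "A = transpose P ** diag_matrix d ** P" "\<And>i. d i \<in> {m..M}"
proof -
  obtain P d where Pd: "orthogonal_matrix P" "A = transpose P ** diag_matrix d ** P"
    using symmetric_matrix_diagonalizable assms by (auto simp: rayleigh_bounds_def)
  have "d i \<in> {m..M}" for i
  proof -
    \<comment> \<open>The \<open>i\<close>-th eigenvector, whose Rayleigh quotient is
      \<open>d i\<close>.\<close>
    let ?x = "transpose P *v axis i 1"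
    have Px: "P *v ?x = axis i 1"
      using Pd(1) by (simp only: matrix_vector_mul_assoc matrix_vector_mul_lid orthogonal_matrix_def)
    have "norm ?x = 1" using Pd(1) by (simp only: norm_axis_1 orthogonal_matrix_norm orthogonal_matrix_transpose)
    moreover have "?x \<bullet> (A *v ?x) = d i"
      unfolding Pd(2) inner_diagonalized Px by (simp add: axis_def if_distrib cong: if_cong)
    ultimately show ?thesis using assms by (auto simp: rayleigh_bounds_def dest: spec[of _ ?x])
  qed
  then show ?thesis using that Pd by blast
qed

text \<open>Independence of the diagonalisation, without matching eigenvalues or eigenspaces: two
  diagonalisations of one matrix are at distance 0, hence by \<open>spectral_lipschitz\<close> so
  are the matrices of powers.\<close>

lemma matrix_powr_eq:
  assumes P: "orthogonal_matrix P" and d: "\<And>i. d i > 0" and A: "A = transpose P ** diag_matrix d ** P"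
  shows "matrix_powr A s = transpose P ** diag_matrix (\<lambda>i. d i powr s) ** P"
  unfolding matrix_powr_def
proof (rule the_equality)
  fix B assume "\<exists>P d. orthogonal_matrix P \<and> (\<forall>i. d i > 0) \<and> A = transpose P ** diag_matrix d ** P \<and>
     B = transpose P ** diag_matrix (\<lambda>i. d i powr s) ** P"
  then obtain Q e where Q: "orthogonal_matrix Q" "\<And>i. e i > 0" "A = transpose Q ** diag_matrix e ** Q"
    "B = transpose Q ** diag_matrix (\<lambda>i. e i powr s) ** Q" by blast
  \<comment> \<open>The interval contains both spectra and stays away from 0, where
    \<open>powr\<close> need not be Lipschitz.\<close>
  define m M where "m = Min (range d \<union> range e)" and "M = Max (range d \<union> range e)"
  have "m > 0" using d Q(2) by (auto simp: m_def)
  then obtain L where L: "L \<ge> 0" "\<And>x y. x \<in> {m..M} \<Longrightarrow> y \<in> {m..M} \<Longrightarrow> \<bar>x powr s - y powr s\<bar> \<le> L * \<bar>x - y\<bar>"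
    using powr_lipschitz by blast
  have "d i \<in> {m..M}" "e i \<in> {m..M}" for i by (auto simp: m_def M_def)
  then have "norm (transpose Q ** diag_matrix (\<lambda>i. e i powr s) ** Q - transpose P ** diag_matrix (\<lambda>i. d i powr s) ** P)
     \<le> L * norm (transpose Q ** diag_matrix e ** Q - transpose P ** diag_matrix d ** P)"
    by (intro spectral_lipschitz P Q L)
  then show "B = transpose P ** diag_matrix (\<lambda>i. d i powr s) ** P"
    using Q(3,4) A by simp
qed (use assms in blast)

lemma matrix_powr_lipschitz:
  fixes m M s :: real
  assumes "m > 0"
  obtains L where "L \<ge> 0" "\<And>A B :: real^'n^'n. A \<in> rayleigh_bounds m M \<Longrightarrow> B \<in> rayleigh_bounds m M \<Longrightarrow>
     norm (matrix_powr A s - matrix_powr B s) \<le> L * norm (A - B)"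
proof -
  obtain L where L: "L \<ge> 0" "\<And>x y. x \<in> {m..M} \<Longrightarrow> y \<in> {m..M} \<Longrightarrow> \<bar>x powr s - y powr s\<bar> \<le> L * \<bar>x - y\<bar>"
    using powr_lipschitz[OF assms] by blast
  show ?thesis
  proof (rule that[OF L(1)])
    fix A B :: "real^'n^'n" assume "A \<in> rayleigh_bounds m M" "B \<in> rayleigh_bounds m M"
    then obtain P d Q e where P: "orthogonal_matrix P" "A = transpose P ** diag_matrix d ** P" "\<And>i. d i \<in> {m..M}"
      and Q: "orthogonal_matrix Q" "B = transpose Q ** diag_matrix e ** Q" "\<And>i. e i \<in> {m..M}"
      using rayleigh_bounds_diagonalizable by (metis (no_types, lifting))
    have d: "d i > 0" and e: "e i > 0" for i using P(3)[of i] Q(3)[of i] assms by auto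
    note matrix_powr_eq[OF P(1) d P(2), of s] matrix_powr_eq[OF Q(1) e Q(2), of s]
    then show "norm (matrix_powr A s - matrix_powr B s) \<le> L * norm (A - B)"
      unfolding P(2) Q(2) using spectral_lipschitz[OF P(1) Q(1), of "\<lambda>x. x powr s" d e L] L P(3) Q(3) by simp
  qed
qed

text \<open>In an eigenbasis \<open>A\<close> times its power has the eigenvalues
  \<open>d i powr (s + 1)\<close>, which are smallest at one end of the interval, depending on the
  sign of \<open>s + 1\<close>. The constant becomes the dissipation rate of the energy along the
  flow.\<close>

lemma matrix_powr_coercive:
  fixes m M s :: real
  assumes "m > 0"
  obtains c where "c > 0" "\<And>(A :: real^'n^'n) x. A \<in> rayleigh_bounds m M \<Longrightarrow>
     c * (norm x)\<^sup>2 \<le> x \<bullet> (A *v (matrix_powr A s *v x))"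
proof (rule that)
  define c where "c = min (m powr (s + 1)) (M powr (s + 1))"
  \<comment> \<open>For \<open>m > M\<close> no matrix satisfies the bounds; the value 1 keeps the
    constant positive, as \<open>M powr (s + 1)\<close> vanishes for \<open>M = 0\<close>.\<close>
  define c' where "c' = (if m \<le> M then c else 1)"
  show "c' > 0" using assms by (auto simp: c'_def c_def)
  fix A :: "real^'n^'n" and x assume "A \<in> rayleigh_bounds m M"
  then obtain P d where P: "orthogonal_matrix P" "A = transpose P ** diag_matrix d ** P" "\<And>i. d i \<in> {m..M}"
    by (metis rayleigh_bounds_diagonalizable)
  have d: "d i > 0" for i using P(3)[of i] assms by auto
  have mM: "m \<le> M" using P(3) by (meson atLeastAtMost_iff order_trans)
  have lb: "d i * d i powr s \<ge> c" for i
  proof -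
    have "d i * d i powr s = d i powr (s + 1)" using d[of i] by (simp add: powr_add mult.commute)
    moreover have "d i powr (s + 1) \<ge> m powr (s + 1)" if "s + 1 \<ge> 0"
      using that P(3)[of i] assms by (intro powr_mono2) auto
    moreover have "d i powr (s + 1) \<ge> M powr (s + 1)" if "s + 1 < 0"
      using that P(3)[of i] d[of i] by (intro powr_mono2') auto
    ultimately show ?thesis unfolding c_def by (smt (verit, best))
  qed
  have pw: "matrix_powr A s *v x = (transpose P ** diag_matrix (\<lambda>i. d i powr s) ** P) *v x"
    using matrix_powr_eq[OF P(1) d P(2)] by simp
  have "P *v (matrix_powr A s *v x) = diag_matrix (\<lambda>i. d i powr s) *v (P *v x)"
    unfolding pw using P(1) by (simp add: matrix_vector_mul_assoc matrix_mul_assoc orthogonal_matrix_def)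
  then have "x \<bullet> (A *v (matrix_powr A s *v x)) = (\<Sum>i\<in>UNIV. (d i * d i powr s) * ((P *v x) $ i)\<^sup>2)"
    unfolding P(2) inner_diagonalized using P(2)
    by (simp add: diag_matrix_mult_vec power2_eq_square ac_simps)
  also have "\<dots> \<ge> (\<Sum>i\<in>UNIV. c * ((P *v x) $ i)\<^sup>2)"
    by (intro sum_mono mult_right_mono lb) auto
  also have "(\<Sum>i\<in>UNIV. c * ((P *v x) $ i)\<^sup>2) = c * (norm (P *v x))\<^sup>2"
    unfolding power2_norm_eq_inner inner_vec_def by (simp add: power2_eq_square sum_distrib_left)
  finally show "c' * (norm x)\<^sup>2 \<le> x \<bullet> (A *v (matrix_powr A s *v x))"
    using P(1) mM by (simp add: orthogonal_matrix_norm c'_def)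
qed

lemma rayleigh_bounds_exist:
  fixes A :: "real^'n^'n"
  assumes "transpose A = A" "\<And>x. x \<noteq> 0 \<Longrightarrow> x \<bullet> (A *v x) > 0"
  obtains m M where "m > 0" "A \<in> rayleigh_bounds m M"
proof -
  have c: "continuous_on (sphere 0 1) (\<lambda>x. x \<bullet> (A *v x))"
    by (intro continuous_intros matrix_vector_mult_linear_continuous_on)
  have ne: "sphere (0 :: real^'n) 1 \<noteq> {}" by simp
  obtain u where u: "norm u = 1" "\<And>x. norm x = 1 \<Longrightarrow> u \<bullet> (A *v u) \<le> x \<bullet> (A *v x)"
    using continuous_attains_inf[OF compact_sphere ne c] by auto
  obtain v where v: "norm v = 1" "\<And>x. norm x = 1 \<Longrightarrow> x \<bullet> (A *v x) \<le> v \<bullet> (A *v v)"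
    using continuous_attains_sup[OF compact_sphere ne c] by auto
  have "u \<noteq> 0" using u(1) by auto
  then have "u \<bullet> (A *v u) > 0" by (rule assms(2))
  moreover have "A \<in> rayleigh_bounds (u \<bullet> (A *v u)) (v \<bullet> (A *v v))"
    unfolding rayleigh_bounds_def
  proof (safe intro!: assms(1))
    fix x
    show "u \<bullet> (A *v u) * (norm x)\<^sup>2 \<le> x \<bullet> (A *v x)" "x \<bullet> (A *v x) \<le> v \<bullet> (A *v v) * (norm x)\<^sup>2"
    proof -
      let ?y = "(1 / norm x) *\<^sub>R x"
      have "x = norm x *\<^sub>R ?y" by simp
      then have e: "x \<bullet> (A *v x) = (norm x)\<^sup>2 * (?y \<bullet> (A *v ?y))" if "x \<noteq> 0"
        using that by (simp add: matrix_vector_mult_scaleR power2_eq_square)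
      have y: "norm ?y = 1" if "x \<noteq> 0" using that by simp
      show "u \<bullet> (A *v u) * (norm x)\<^sup>2 \<le> x \<bullet> (A *v x)"
      proof (cases "x = 0")
        case False
        show ?thesis unfolding e[OF False] using mult_left_mono[OF u(2)[OF y[OF False]], of "(norm x)\<^sup>2"]
          by (simp only: mult.commute zero_le_power2)
      qed simp
      show "x \<bullet> (A *v x) \<le> v \<bullet> (A *v v) * (norm x)\<^sup>2"
      proof (cases "x = 0")
        case False
        show ?thesis unfolding e[OF False] using mult_left_mono[OF v(2)[OF y[OF False]], of "(norm x)\<^sup>2"]
          by (simp only: mult.commute zero_le_power2)
      qed simp
    qed
  qed
  ultimately show ?thesis using that by blast
qed

lemma matrix_powr_0_1:
  fixes A :: "real^'n^'n"
  assumes "transpose A = A" "\<And>x. x \<noteq> 0 \<Longrightarrow> x \<bullet> (A *v x) > 0"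
  shows "matrix_powr A 0 = mat 1" "matrix_powr A 1 = A"
proof -
  obtain m M where mM: "m > 0" "A \<in> rayleigh_bounds m M" using rayleigh_bounds_exist[OF assms] by metis
  obtain P d where P: "orthogonal_matrix P" "A = transpose P ** diag_matrix d ** P" "\<And>i. d i \<in> {m..M}"
    using rayleigh_bounds_diagonalizable[OF mM(2)] by metis
  have d: "d i > 0" for i using P(3)[of i] mM(1) by auto
  have 1: "diag_matrix (\<lambda>i. 1) = (mat 1 :: real^'n^'n)" by (simp add: diag_matrix_def mat_def)
  have dn: "d i \<noteq> 0" for i using d[of i] by simp
  show "matrix_powr A 0 = mat 1" using P(1) 1 d dn
    by (simp add: matrix_powr_eq[OF P(1) d P(2)] orthogonal_matrix_def)
  have "matrix_powr A 1 = transpose P ** diag_matrix (\<lambda>i. d i powr 1) ** P"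
    by (rule matrix_powr_eq[OF P(1) d P(2)])
  also have "(\<lambda>i. d i powr 1) = d" using d by (simp add: fun_eq_iff less_imp_le)
  finally show "matrix_powr A 1 = A" using P(2) by simp
qed

section \<open>Exponential stability of ordinary differential equations\<close>

text \<open>Multiplication by the integrating factor \<open>exp (- k * s)\<close> leaves a
  nonincreasing function. The rate may have any sign: the lemma serves uniqueness, exponential decay
  and, with \<open>k = 0\<close>, monotonicity.\<close>

lemma gronwall_differential:
  fixes f :: "real \<Rightarrow> real"
  assumes t: "0 \<le> t" and der: "\<And>s. s \<in> {0..t} \<Longrightarrow> (f has_real_derivative f' s) (at s within {0..t})"
    and le: "\<And>s. s \<in> {0..t} \<Longrightarrow> f' s \<le> k * f s"
  shows "f t \<le> f 0 * exp (k * t)"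
proof -
  define h where "h s = f s * exp (- k * s)" for s
  have h: "(h has_real_derivative (f' s - k * f s) * exp (- k * s)) (at s within {0..t})" if "s \<in> {0..t}" for s
    unfolding h_def by (rule derivative_eq_intros der that refl)+ (simp add: algebra_simps)
  have "h t \<le> h 0"
  proof (rule DERIV_nonpos_imp_decreasing_open[OF t])
    show "continuous_on {0..t} h"
      by (rule DERIV_continuous_on[OF h])
    show "\<exists>y. DERIV h s :> y \<and> y \<le> 0" if "0 < s" "s < t" for s
    proof -
      have "at s within {0..t} = at s" using that by (intro at_within_interior) auto
      then show ?thesis using h[of s] le[of s] that
        by (intro exI[of _ "(f' s - k * f s) * exp (- k * s)"]) (auto simp: mult_le_0_iff)
    qed
  qed
  then show ?thesis by (simp add: h_def exp_minus field_simps)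
qed

lemma integral_from_zero_has_vector_derivative:
  fixes g :: "real \<Rightarrow> 'a::banach"
  assumes "continuous_on {0..} g" "t \<ge> 0"
  shows "((\<lambda>u. integral {0..u} g) has_vector_derivative g t) (at t within {0..})"
proof -
  have "((\<lambda>u. integral {0..u} g) has_vector_derivative g t) (at t within {0..t + 1})"
    using assms by (intro integral_has_vector_derivative continuous_on_subset[OF assms(1)]) auto
  moreover have "at t within {0..} = at t within {0..t + 1}"
    by (rule at_within_nhd[where S = "{t - 1<..<t + 1}"]) auto
  ultimately show ?thesis by simp
qed

text \<open>Source of the contraction factor: integrating \<open>C * L * exp (2 * L * s)\<close>
  gives at most \<open>C / 2 * exp (2 * L * t)\<close>, so the 2 in the weight becomes the factor
  1/2 of the Picard map.\<close>

lemma exp_weighted_integral_bound: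
  fixes g :: "real \<Rightarrow> 'a::euclidean_space"
  assumes g: "continuous_on {0..} g" and L: "L > 0" and t: "t \<ge> 0"
    and bound: "\<And>s. s \<ge> 0 \<Longrightarrow> norm (g s) \<le> C * L * exp (2 * L * s)"
  shows "norm (exp (- 2 * L * t) *\<^sub>R integral {0..t} g) \<le> C / 2"
proof -
  have "0 \<le> C * L" using order_trans[OF norm_ge_zero bound[of 0]] by simp
  then have C: "C \<ge> 0" using L by (simp add: zero_le_mult_iff)
  have I: "((\<lambda>s. C * L * exp (2 * L * s)) has_integral C / 2 * exp (2 * L * t) - C / 2 * exp (2 * L * 0)) {0..t}"
    by (rule fundamental_theorem_of_calculus[OF t])
       (auto intro!: derivative_eq_intros simp: has_real_derivative_iff_has_vector_derivative[symmetric])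
  have "norm (integral {0..t} g) \<le> integral {0..t} (\<lambda>s. C * L * exp (2 * L * s))"
  proof (rule integral_norm_bound_integral)
    show "g integrable_on {0..t}"
      by (intro integrable_continuous_real continuous_on_subset[OF g]) auto
  qed (use has_integral_integrable[OF I] bound in auto)
  also have "\<dots> \<le> C / 2 * exp (2 * L * t)" unfolding integral_unique[OF I] using C by simp
  finally show ?thesis by (simp add: exp_minus field_simps)
qed

text \<open>Picard iteration is a contraction for the norm \<open>sup e\<^sup>-\<^sup>2\<^sup>L\<^sup>t |x t|\<close> on the whole half line.\<close>

lemma picard_lindeloef_global:
  fixes V :: "'a::euclidean_space \<Rightarrow> 'a"
  assumes lip: "\<And>x y. norm (V x - V y) \<le> L * norm (x - y)"
  obtains x where "x 0 = x0" "\<And>t. t \<ge> 0 \<Longrightarrow> (x has_vector_derivative V (x t)) (at t within {0..})"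
proof -
  define l where "l = \<bar>L\<bar> + 1"
  have l: "l > 0" by (simp add: l_def)
  have lip: "norm (V x - V y) \<le> l * norm (x - y)" for x y
    using lip[of x y] by (rule order_trans) (auto simp: l_def intro!: mult_right_mono)
  have contV: "continuous_on UNIV V"
  proof -
    have "l-lipschitz_on UNIV V" using lip l by (intro lipschitz_onI) (auto simp: dist_norm)
    then show ?thesis by (rule lipschitz_on_continuous_on)
  qed
  \<comment> \<open>The unknown is the rescaled function
    \<open>exp (- 2 * l * t) *\<^sub>R x t\<close>, which is bounded; the weighted norm thereby
    becomes the sup norm of bounded continuous functions.\<close>
  define g where "g u s = V (exp (2 * l * s) *\<^sub>R apply_bcontfun u s)" for u :: "real \<Rightarrow>\<^sub>C 'a" and s
  have contg: "continuous_on T (g u)" for u T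
    unfolding g_def by (rule continuous_on_compose2[OF contV]) (auto intro!: continuous_intros)
  \<comment> \<open>The function space lives on the whole line; \<open>max 0 t\<close> continues the
    iterate constantly to negative times.\<close>
  define G where "G u t = exp (- 2 * l * max 0 t) *\<^sub>R (x0 + integral {0..max 0 t} (g u))" for u t
  have G: "G u \<in> bcontfun" for u
  proof -
    have "continuous_on {0..} (\<lambda>t. integral {0..t} (g u))"
      using integral_from_zero_has_vector_derivative[OF contg]
      by (intro continuous_on_vector_derivative) auto
    then have "continuous_on UNIV (\<lambda>t. integral {0..max 0 t} (g u))"
      by (rule continuous_on_compose2) (auto intro!: continuous_intros)
    then have "continuous_on UNIV (G u)" unfolding G_def by (intro continuous_intros)
    moreover have "norm (G u t) \<le> norm x0 + (norm (V 0) + l * norm u) / l / 2" for t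
    proof -
      define \<tau> where "\<tau> = max 0 t"
      have "norm (g u s) \<le> (norm (V 0) + l * norm u) / l * l * exp (2 * l * s)" if "s \<ge> 0" for s
      proof -
        have e: "exp (2 * l * s) \<ge> 1" using l that by simp
        have "norm (g u s) \<le> norm (V 0) + l * norm (exp (2 * l * s) *\<^sub>R apply_bcontfun u s)"
          using lip[of "exp (2 * l * s) *\<^sub>R apply_bcontfun u s" 0] norm_triangle_sub[of "g u s" "V 0"]
          by (simp add: g_def)
        also have "\<dots> \<le> norm (V 0) * exp (2 * l * s) + l * (exp (2 * l * s) * norm u)"
          using l e norm_bounded[of u s] mult_left_mono[OF e, of "norm (V 0)"]
          by (intro add_mono) (simp_all add: mult_left_mono)
        also have "\<dots> = (norm (V 0) + l * norm u) * exp (2 * l * s)" by (simp add: algebra_simps)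
        finally show ?thesis using l by simp
      qed
      then have "norm (exp (- 2 * l * \<tau>) *\<^sub>R integral {0..\<tau>} (g u)) \<le> (norm (V 0) + l * norm u) / l / 2"
        by (intro exp_weighted_integral_bound contg l) (auto simp: \<tau>_def)
      moreover have "norm (exp (- 2 * l * \<tau>) *\<^sub>R x0) \<le> norm x0"
        using l by (simp add: \<tau>_def mult_left_le_one_le)
      ultimately show ?thesis unfolding G_def \<tau>_def[symmetric] scaleR_add_right
        by (metis (no_types, lifting) add_mono norm_triangle_ineq order_trans)
    qed
    then have "bounded (range (G u))" by (auto simp: bounded_iff)
    ultimately show ?thesis by (simp add: bcontfun_def)
  qed
  have contr: "dist (Bcontfun (G u)) (Bcontfun (G v)) \<le> 1 / 2 * dist u v" for u v
  proof (rule dist_bound)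
    fix t :: real
    define \<tau> where "\<tau> = max 0 t"
    have "norm (g u s - g v s) \<le> dist u v * l * exp (2 * l * s)" for s
    proof -
      have "norm (g u s - g v s) \<le> l * norm (exp (2 * l * s) *\<^sub>R (apply_bcontfun u s - apply_bcontfun v s))"
        using lip unfolding g_def scaleR_diff_right by blast
      also have "\<dots> \<le> l * (exp (2 * l * s) * dist u v)"
        using dist_bounded[of u s v] l by (simp add: dist_norm)
      finally show ?thesis by (simp add: ac_simps)
    qed
    then have "norm (exp (- 2 * l * \<tau>) *\<^sub>R integral {0..\<tau>} (\<lambda>s. g u s - g v s)) \<le> dist u v / 2"
      by (intro exp_weighted_integral_bound continuous_intros contg l) (auto simp: \<tau>_def)
    moreover have "integral {0..\<tau>} (\<lambda>s. g u s - g v s) = integral {0..\<tau>} (g u) - integral {0..\<tau>} (g v)"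
      by (intro integral_diff integrable_continuous_real contg)
    ultimately have "norm (G u t - G v t) \<le> dist u v / 2"
      unfolding G_def \<tau>_def[symmetric] by (simp add: algebra_simps)
    then show "dist (apply_bcontfun (Bcontfun (G u)) t) (apply_bcontfun (Bcontfun (G v)) t) \<le> 1 / 2 * dist u v"
      using G by (simp add: Bcontfun_inverse dist_norm)
  qed
  have "\<exists>!u. Bcontfun (G u) = u"
    by (rule banach_fix_type[of "1/2"]) (use contr in simp_all)
  then obtain u where "Bcontfun (G u) = u" by blast
  then have "apply_bcontfun u = G u" using Bcontfun_inverse[OF G, of u] by simp
  then have u: "apply_bcontfun u t = G u t" for t by (rule fun_cong)
  define x where "x t = x0 + integral {0..t} (g u)" for t
  have gx: "g u t = V (x t)" if "t \<ge> 0" for t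
  proof -
    have "exp (2 * l * t) *\<^sub>R apply_bcontfun u t = x t"
      using that by (subst u) (simp add: G_def x_def flip: exp_add)
    then show ?thesis by (simp only: g_def)
  qed
  show ?thesis
  proof (rule that[of x])
    fix t :: real assume "t \<ge> 0"
    have "((\<lambda>t. x0 + integral {0..t} (g u)) has_vector_derivative 0 + g u t) (at t within {0..})"
      by (intro has_vector_derivative_add has_vector_derivative_const integral_from_zero_has_vector_derivative contg \<open>t \<ge> 0\<close>)
    then show "(x has_vector_derivative V (x t)) (at t within {0..})"
      unfolding gx[OF \<open>t \<ge> 0\<close>] by (simp add: x_def[abs_def])
  qed (simp add: x_def)
qed

text \<open>Gronwall for the squared distance, whose derivative is at most \<open>2 * L\<close>
  times itself. The Lipschitz bound is available on \<open>S\<close> only, so both solutions must be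
  known to stay there.\<close>

lemma solutions_agree:
  fixes V :: "'a::euclidean_space \<Rightarrow> 'a"
  assumes I: "is_interval I" "0 \<in> I" "I \<subseteq> {0..}"
    and lip: "\<And>x y. x \<in> S \<Longrightarrow> y \<in> S \<Longrightarrow> norm (V x - V y) \<le> L * norm (x - y)"
    and x: "\<And>t. t \<in> I \<Longrightarrow> x t \<in> S" "\<And>t. t \<in> I \<Longrightarrow> (x has_vector_derivative V (x t)) (at t within I)"
    and y: "\<And>t. t \<in> I \<Longrightarrow> y t \<in> S" "\<And>t. t \<in> I \<Longrightarrow> (y has_vector_derivative V (y t)) (at t within I)"
    and init: "x 0 = y 0" and t: "t \<in> I"
  shows "x t = y t"
proof -
  have sub: "{0..t} \<subseteq> I" using I t by (meson atLeastAtMost_iff mem_is_interval_1_I subsetI)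
  define f where "f s = (x s - y s) \<bullet> (x s - y s)" for s
  have "f t \<le> f 0 * exp (2 * L * t)"
  proof (rule gronwall_differential)
    show "0 \<le> t" using I t by auto
    fix s assume s: "s \<in> {0..t}"
    then have sI: "s \<in> I" using sub by auto
    have "((\<lambda>s. x s - y s) has_vector_derivative V (x s) - V (y s)) (at s within {0..t})"
      by (intro has_vector_derivative_diff has_vector_derivative_within_subset[OF x(2)[OF sI] sub]
          has_vector_derivative_within_subset[OF y(2)[OF sI] sub])
    then have d: "((\<lambda>s. x s - y s) has_derivative (\<lambda>h. h *\<^sub>R (V (x s) - V (y s)))) (at s within {0..t})"
      by (simp add: has_vector_derivative_def)
    show "(f has_real_derivative 2 * ((x s - y s) \<bullet> (V (x s) - V (y s)))) (at s within {0..t})"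
      unfolding f_def has_field_derivative_def
      by (rule has_derivative_eq_rhs[OF has_derivative_inner[OF d d]]) (simp add: fun_eq_iff inner_commute)
    have "(x s - y s) \<bullet> (V (x s) - V (y s)) \<le> norm (x s - y s) * norm (V (x s) - V (y s))"
      by (rule norm_cauchy_schwarz)
    also have "\<dots> \<le> norm (x s - y s) * (L * norm (x s - y s))"
      by (intro mult_left_mono lip x y sI) auto
    also have "\<dots> = L * f s" by (simp add: f_def dot_square_norm power2_eq_square)
    finally show "2 * ((x s - y s) \<bullet> (V (x s) - V (y s))) \<le> 2 * L * f s" by simp
  qed
  then have "f t \<le> 0" using init by (simp add: f_def)
  moreover have "f t \<ge> 0" by (simp add: f_def)
  ultimately have "f t = 0" by simp
  then show ?thesis by (simp add: f_def)
qed

text \<open>First-exit argument: inside the ball the energy decays, whereas on the sphere of radius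
  \<open>r\<close> it is at least \<open>m * r\<^sup>2\<close>, above its initial value, so the
  sphere is never reached. The interval is arbitrary, so that competing solutions are trapped as
  well.\<close>

lemma lyapunov_trapping:
  fixes V :: "'a::euclidean_space \<Rightarrow> 'a" and E :: "'a \<Rightarrow> real"
  assumes r: "r > 0" and m: "m > 0" and c: "c > 0"
    and E: "\<And>x. x \<in> cball z r \<Longrightarrow> (E has_derivative E' x) (at x)"
    and dec: "\<And>x. x \<in> cball z r \<Longrightarrow> E' x (V x) \<le> - c * E x"
    and low: "\<And>x. x \<in> cball z r \<Longrightarrow> m * (norm (x - z))\<^sup>2 \<le> E x"
    and I: "is_interval I" "0 \<in> I" "I \<subseteq> {0..}"
    and x: "\<And>t. t \<in> I \<Longrightarrow> (x has_vector_derivative V (x t)) (at t within I)"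
    and init: "x 0 \<in> ball z r" "E (x 0) < m * r\<^sup>2" and t: "t \<in> I"
  shows "norm (x t - z) < r \<and> m * (norm (x t - z))\<^sup>2 \<le> E (x 0) * exp (- c * t)"
proof -
  have sub: "{0..t} \<subseteq> I" if "t \<in> I" for t using I that by (meson atLeastAtMost_iff mem_is_interval_1_I subsetI)
  have decay: "m * (norm (x t - z))\<^sup>2 \<le> E (x 0) * exp (- c * t)"
    if t: "t \<in> I" and ball: "\<And>s. s \<in> {0..t} \<Longrightarrow> x s \<in> cball z r" for t
  proof -
    have t0: "0 \<le> t" using I t by auto
    have "E (x t) \<le> E (x 0) * exp (- c * t)"
    proof (rule gronwall_differential[OF t0])
      fix s assume s: "s \<in> {0..t}"
      then have sI: "s \<in> I" using sub[OF t] by auto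
      have "(x has_derivative (\<lambda>h. h *\<^sub>R V (x s))) (at s within {0..t})"
        using has_vector_derivative_within_subset[OF x[OF sI] sub[OF t]] by (simp add: has_vector_derivative_def)
      then have A: "((\<lambda>s. E (x s)) has_derivative (\<lambda>h. E' (x s) (h *\<^sub>R V (x s)))) (at s within {0..t})"
        by (rule has_derivative_compose[where f = x and g = E and x = s, OF _ E[OF ball[OF s]]])
      have "E' (x s) (h *\<^sub>R V (x s)) = h * E' (x s) (V (x s))" for h
        using has_derivative_linear[OF E[OF ball[OF s]]] by (simp add: linear_cmul)
      then show "((\<lambda>s. E (x s)) has_real_derivative E' (x s) (V (x s))) (at s within {0..t})"
        unfolding has_field_derivative_def by (intro has_derivative_eq_rhs[OF A]) (simp add: fun_eq_iff)
      show "E' (x s) (V (x s)) \<le> - c * E (x s)" using dec ball[OF s] by blast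
    qed
    then show ?thesis using low[OF ball[of t]] t0 by simp
  qed
  have stay: "norm (x t - z) < r" if t: "t \<in> I" for t
  proof (rule ccontr)
    assume ge: "\<not> norm (x t - z) < r"
    have t0: "0 \<le> t" using I t by auto
    have cont: "continuous_on {0..t} (\<lambda>s. norm (x s - z))"
      using continuous_on_vector_derivative[OF x] sub[OF t]
      by (intro continuous_intros) (blast intro: continuous_on_subset)
    \<comment> \<open>The times spent outside the open ball form a compact set, so there is a first
      one, \<open>q\<close>.\<close>
    define T where "T = {s \<in> {0..t}. norm (x s - z) \<ge> r}"
    have "closed T"
      unfolding T_def using continuous_closed_preimage[OF cont closed_atLeastAtMost, of "{r..}"]
      by (simp add: vimage_def Int_def)
    moreover have "bounded T" by (rule bounded_subset[of "{0..t}"]) (auto simp: T_def)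
    ultimately have "compact T" by (simp add: compact_eq_bounded_closed)
    moreover have "t \<in> T" using ge t0 by (simp add: T_def)
    ultimately obtain q where q: "q \<in> T" "\<And>s. s \<in> T \<Longrightarrow> q \<le> s" using compact_attains_inf[of T] by blast
    have q0: "0 \<le> q" "q \<le> t" and qr: "norm (x q - z) \<ge> r" using q(1) by (auto simp: T_def)
    have qI: "q \<in> I" using sub[OF t] q0 by auto
    \<comment> \<open>Otherwise the intermediate value theorem gives a crossing of the sphere, hence
      an element of \<open>T\<close>, before \<open>q\<close>.\<close>
    have ball: "norm (x s - z) \<le> r" if s: "s \<in> {0..q}" for s
    proof (rule ccontr)
      assume gt: "\<not> norm (x s - z) \<le> r"
      have "\<exists>p\<ge>0. p \<le> s \<and> norm (x p - z) = r"
      proof (rule IVT'[where f = "\<lambda>s. norm (x s - z)"])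
        show "continuous_on {0..s} (\<lambda>s. norm (x s - z))"
          using s q0 by (intro continuous_on_subset[OF cont]) auto
      qed (use init gt s in \<open>auto simp: dist_norm norm_minus_commute\<close>)
      then obtain p where p: "0 \<le> p" "p \<le> s" "norm (x p - z) = r" by blast
      then have "p \<in> T" using s q0 by (auto simp: T_def)
      then have "q \<le> p" by (rule q(2))
      then have "p = s" using p s by auto
      then show False using p(3) gt by simp
    qed
    have "m * (norm (x q - z))\<^sup>2 \<le> E (x 0) * exp (- c * q)"
      by (rule decay[OF qI]) (use ball in \<open>auto simp: dist_norm norm_minus_commute\<close>)
    also have "\<dots> \<le> E (x 0)"
    proof -
      have "0 \<le> m * (norm (x 0 - z))\<^sup>2" using m by simp
      also have "\<dots> \<le> E (x 0)" using low[of "x 0"] init(1) ball_subset_cball by blast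
      finally have "E (x 0) \<ge> 0" .
      moreover have "exp (- c * q) \<le> 1" using c q0 by simp
      ultimately show ?thesis by (simp add: mult_left_le)
    qed
    also have "\<dots> < m * r\<^sup>2" by (rule init)
    also have "\<dots> \<le> m * (norm (x q - z))\<^sup>2" using m r qr by (simp add: power_mono)
    finally show False by simp
  qed
  have "m * (norm (x t - z))\<^sup>2 \<le> E (x 0) * exp (- c * t)"
  proof (rule decay[OF t])
    fix s assume "s \<in> {0..t}"
    then have "s \<in> I" using sub[OF t] by auto
    from stay[OF this] show "x s \<in> cball z r" by (simp add: dist_norm norm_minus_commute)
  qed
  then show ?thesis using stay t by blast
qed

text \<open>Precomposition with the nearest-point projection, which is nonexpanding, makes the field
  globally Lipschitz; trapping confines the resulting solution to the region where the projection is
  the identity. Applied to any other solution, trapping also brings it under the Lipschitz bound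
  that gives uniqueness.\<close>

lemma lyapunov_exponential_stability:
  fixes V :: "'a::euclidean_space \<Rightarrow> 'a" and E :: "'a \<Rightarrow> real"
  assumes r: "r > 0" and W: "cball z r \<subseteq> W" and m: "m > 0" and c: "c > 0"
    and lip: "\<And>x y. x \<in> cball z r \<Longrightarrow> y \<in> cball z r \<Longrightarrow> norm (V x - V y) \<le> L * norm (x - y)"
    and E: "\<And>x. x \<in> cball z r \<Longrightarrow> (E has_derivative E' x) (at x)"
    and dec: "\<And>x. x \<in> cball z r \<Longrightarrow> E' x (V x) \<le> - c * E x"
    and low: "\<And>x. x \<in> cball z r \<Longrightarrow> m * (norm (x - z))\<^sup>2 \<le> E x"
    and upp: "\<And>x. x \<in> cball z r \<Longrightarrow> E x \<le> M * (norm (x - z))\<^sup>2"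
  shows "\<exists>\<delta>>0. \<forall>x0. norm (x0 - z) < \<delta> \<longrightarrow>
    (\<exists>x. global_solution W V x0 x \<and> converges_exponentially x z)"
proof -
  \<comment> \<open>The radius below is chosen so that
    \<open>M' * \<delta>\<^sup>2 = m * r\<^sup>2\<close>: the upper energy bound at distance
    \<open>\<delta>\<close> meets the lower bound on the sphere. Using \<open>M'\<close> for
    \<open>M\<close> ensures \<open>\<delta> \<le> r\<close>.\<close>
  define M' where "M' = max M m"
  define \<delta> where "\<delta> = r * sqrt (m / M')"
  have M': "M' > 0" "m \<le> M'" "M \<le> M'" using m by (auto simp: M'_def)
  have \<delta>: "\<delta> > 0" "\<delta> \<le> r" using r m M' by (auto simp: \<delta>_def mult_left_le)
  have \<delta>2: "M' * \<delta>\<^sup>2 = m * r\<^sup>2" using m M' by (simp add: \<delta>_def power_mult_distrib)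
  show ?thesis
  proof (intro exI[of _ \<delta>] conjI allI impI \<delta>)
    fix x0 assume x0: "norm (x0 - z) < \<delta>"
    then have x0b: "x0 \<in> ball z r" using \<delta> by (simp add: dist_norm norm_minus_commute)
    have "E x0 \<le> M * (norm (x0 - z))\<^sup>2" using x0b upp by auto
    also have "\<dots> \<le> M' * (norm (x0 - z))\<^sup>2" using M' by (simp add: mult_right_mono)
    also have "\<dots> < M' * \<delta>\<^sup>2" using M' x0 by (simp add: power_strict_mono)
    finally have Ex0: "E x0 < m * r\<^sup>2" using \<delta>2 by simp
    define p where "p = closest_point (cball z r)"
    have p: "p y \<in> cball z r" for y unfolding p_def using r by (intro closest_point_in_set) auto
    have p_id: "p y = y" if "y \<in> cball z r" for y unfolding p_def using that by (rule closest_point_self)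
    have p_lip: "norm (p x - p y) \<le> norm (x - y)" for x y
      unfolding p_def dist_norm[symmetric] using r by (intro closest_point_lipschitz) auto
    have lip': "norm (V (p x) - V (p y)) \<le> \<bar>L\<bar> * norm (x - y)" for x y
    proof -
      have "norm (V (p x) - V (p y)) \<le> L * norm (p x - p y)" using lip p by blast
      also have "\<dots> \<le> \<bar>L\<bar> * norm (x - y)" by (intro mult_mono p_lip) auto
      finally show ?thesis .
    qed
    obtain x where x: "x 0 = x0" "\<And>t. t \<ge> 0 \<Longrightarrow> (x has_vector_derivative V (p (x t))) (at t within {0..})"
      using picard_lindeloef_global[where V = "\<lambda>y. V (p y)", OF lip'] by metis
    have trap: "norm (x t - z) < r \<and> m * (norm (x t - z))\<^sup>2 \<le> E x0 * exp (- c * t)" if "t \<ge> 0" for t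
      unfolding x(1)[symmetric]
      by (rule lyapunov_trapping[where V = "\<lambda>y. V (p y)" and I = "{0..}", OF r m c E])
        (use that x dec p_id low x0b Ex0 in \<open>auto simp: is_interval_ci\<close>)
    have xin: "x t \<in> cball z r" if "t \<ge> 0" for t
      using trap[OF that] by (simp add: dist_norm norm_minus_commute)
    have xder: "(x has_vector_derivative V (x t)) (at t within {0..})" if "t \<ge> 0" for t
      using x(2)[OF that] p_id[OF xin[OF that]] by simp
    have "global_solution W V x0 x"
      unfolding global_solution_def
    proof (intro conjI allI impI ballI)
      show "flow_solution W V x0 {0..} x"
        unfolding flow_solution_def using x(1) xder xin W by (auto simp: is_interval_ci)
      fix I y t assume y: "flow_solution W V x0 I y" and t: "t \<in> I"
      have I: "is_interval I" "0 \<in> I" "I \<subseteq> {0..}" using y by (auto simp: flow_solution_def)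
      have yder: "(y has_vector_derivative V (y t)) (at t within I)" if "t \<in> I" for t
        using y that by (auto simp: flow_solution_def)
      have y0: "y 0 = x0" using y by (auto simp: flow_solution_def)
      have "norm (y t - z) < r" if "t \<in> I" for t
        using lyapunov_trapping[where V = V, OF r m c E dec low I yder _ _ that] x0b Ex0 y0 by simp
      then have yin: "y t \<in> cball z r" if "t \<in> I" for t
        using that by (simp add: dist_norm norm_minus_commute less_imp_le)
      show "y t = x t"
      proof (rule solutions_agree[OF I lip yin yder _ _ _ t])
        fix t assume "t \<in> I"
        then have "t \<ge> 0" using I by auto
        then show "x t \<in> cball z r" "(x has_vector_derivative V (x t)) (at t within I)"
          using xin xder has_vector_derivative_within_subset I(3) by blast+
      qed (use y0 x in auto)
    qed
    moreover have "converges_exponentially x z"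
      unfolding converges_exponentially_def
    proof (intro exI conjI allI impI)
      \<comment> \<open>The energy bounds the square of the distance, so the rate is halved; the
        summand 1 keeps the constant positive when the initial energy is 0.\<close>
      let ?C = "sqrt (\<bar>E x0\<bar> / m) + 1"
      show "?C > 0" using m by (simp add: add_nonneg_pos)
      show "c / 2 > 0" using c by simp
      fix t :: real assume t: "t \<ge> 0"
      have "(norm (x t - z))\<^sup>2 \<le> E x0 / m * exp (- c * t)"
        using trap[OF t] m by (simp add: field_simps)
      also have "\<dots> \<le> \<bar>E x0\<bar> / m * (exp (- (c / 2) * t))\<^sup>2"
        using m by (intro mult_mono divide_right_mono) (auto simp: power2_eq_square simp flip: exp_add)
      finally have "norm (x t - z) \<le> sqrt (\<bar>E x0\<bar> / m * (exp (- (c / 2) * t))\<^sup>2)"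
        by (rule real_le_rsqrt)
      also have "\<dots> = sqrt (\<bar>E x0\<bar> / m) * exp (- (c / 2) * t)"
        by (simp only: real_sqrt_mult real_sqrt_abs) simp
      also have "\<dots> \<le> ?C * exp (- (c / 2) * t)" by (simp add: mult_right_mono)
      finally show "norm (x t - z) \<le> ?C * exp (- (c / 2) * t)" .
    qed
    ultimately show "\<exists>x. global_solution W V x0 x \<and> converges_exponentially x z" by blast
  qed
qed

section \<open>Locally Lipschitz functions\<close>

text \<open>A pointwise notion closed under arithmetic and composition. It yields continuity and
  local Lipschitz constants of the curvature and its Jacobian directly from their formulas, without
  computing second derivatives of the curvature.\<close>

definition lipschitz_near :: "'a::metric_space \<Rightarrow> ('a \<Rightarrow> 'b::metric_space) \<Rightarrow> bool" where
  "lipschitz_near z f \<longleftrightarrow> (\<exists>e>0. \<exists>L. L-lipschitz_on (ball z e) f)"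

lemma lipschitz_nearE:
  assumes "lipschitz_near z f"
  obtains e L where "e > 0" "L-lipschitz_on (ball z e) f"
  using assms by (auto simp: lipschitz_near_def)

lemma lipschitz_near2E:
  assumes "lipschitz_near z f" "lipschitz_near z g"
  obtains e L M where "e > 0" "L-lipschitz_on (ball z e) f" "M-lipschitz_on (ball z e) g"
proof -
  obtain e L where f: "e > 0" "L-lipschitz_on (ball z e) f" using assms(1) by (rule lipschitz_nearE)
  obtain e' M where g: "e' > 0" "M-lipschitz_on (ball z e') g" using assms(2) by (rule lipschitz_nearE)
  show ?thesis
    by (rule that[of "min e e'" L M]) (use f g in \<open>auto intro: lipschitz_on_subset\<close>)
qed

lemma lipschitz_near_isCont: "lipschitz_near z f \<Longrightarrow> isCont f z"
  using continuous_on_eq_continuous_at[of "ball z _" f] lipschitz_on_continuous_on[of _ "ball z _" f]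
  by (elim lipschitz_nearE) auto

text \<open>For functions whose explicit formula holds on an open set only, as for the curvature and
  the flow fields on the admissible space.\<close>

lemma lipschitz_near_cong:
  assumes "lipschitz_near z f" "open S" "z \<in> S" "\<And>x. x \<in> S \<Longrightarrow> f x = g x"
  shows "lipschitz_near z g"
proof -
  obtain e L where f: "e > 0" "L-lipschitz_on (ball z e) f" using assms(1) by (rule lipschitz_nearE)
  obtain e' where e': "e' > 0" "ball z e' \<subseteq> S" using assms(2,3) by (auto simp: open_contains_ball)
  have "L-lipschitz_on (ball z (min e e')) f" using f(2) by (rule lipschitz_on_subset) auto
  then have "L-lipschitz_on (ball z (min e e')) g"
    by (rule lipschitz_on_transform) (use e' assms(4) in auto)
  then show ?thesis using f(1) e'(1) unfolding lipschitz_near_def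
    by (intro exI[of _ "min e e'"]) auto
qed

lemma lipschitz_near_const [simp]: "lipschitz_near z (\<lambda>x. c)"
  unfolding lipschitz_near_def by (intro exI[of _ 1] exI[of _ 0] conjI lipschitz_onI) auto

lemma lipschitz_near_nth: "lipschitz_near z (\<lambda>x :: real^'n. x $ i)"
  unfolding lipschitz_near_def
  by (intro exI[of _ 1] conjI lipschitz_onI) (auto simp: dist_vec_nth_le)

lemma lipschitz_near_add:
  fixes f g :: "'a::metric_space \<Rightarrow> 'b::real_normed_vector"
  assumes "lipschitz_near z f" "lipschitz_near z g"
  shows "lipschitz_near z (\<lambda>x. f x + g x)"
  by (rule lipschitz_near2E[OF assms]) (auto simp: lipschitz_near_def dest: lipschitz_on_add)

lemma lipschitz_near_minus:
  fixes f :: "'a::metric_space \<Rightarrow> 'b::real_normed_vector"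
  assumes "lipschitz_near z f"
  shows "lipschitz_near z (\<lambda>x. - f x)"
  by (rule lipschitz_nearE[OF assms]) (auto simp: lipschitz_near_def dest: lipschitz_on_minus)

lemma lipschitz_near_diff:
  fixes f g :: "'a::metric_space \<Rightarrow> 'b::real_normed_vector"
  assumes "lipschitz_near z f" "lipschitz_near z g"
  shows "lipschitz_near z (\<lambda>x. f x - g x)"
  using lipschitz_near_add[OF assms(1) lipschitz_near_minus[OF assms(2)]] by simp

text \<open>Serves products of reals and matrices acting on vectors alike. The difference splits as
  in the product rule, with \<open>P\<close> and \<open>Q\<close> bounding the two factors on the
  ball.\<close>

lemma lipschitz_near_bilinear:
  assumes B: "bounded_bilinear B" and fg: "lipschitz_near z f" "lipschitz_near z g"
  shows "lipschitz_near z (\<lambda>x. B (f x) (g x))"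
proof -
  interpret bounded_bilinear B by (rule B)
  obtain e L M where e: "e > 0" and f: "L-lipschitz_on (ball z e) f" and g: "M-lipschitz_on (ball z e) g"
    by (rule lipschitz_near2E[OF fg])
  obtain K where K: "K > 0" "\<And>a b. norm (B a b) \<le> norm a * norm b * K" using pos_bounded by blast
  have LM: "L \<ge> 0" "M \<ge> 0" using f g by (auto simp: lipschitz_on_def)
  have bound: "norm (h x) \<le> norm (h z) + N * e"
    if "N-lipschitz_on (ball z e) h" "x \<in> ball z e" for h :: "_ \<Rightarrow> 'q::real_normed_vector" and N x
  proof -
    have "dist (h x) (h z) \<le> N * dist x z" using that e by (auto intro!: lipschitz_onD)
    also have "\<dots> \<le> N * e" using that by (intro mult_left_mono) (auto simp: dist_commute lipschitz_on_def)
    finally show ?thesis using norm_triangle_sub[of "h x" "h z"] by (simp add: dist_norm)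
  qed
  define P where "P = norm (f z) + L * e"
  define Q where "Q = norm (g z) + M * e"
  have PQ: "P \<ge> 0" "Q \<ge> 0" using LM e by (auto simp: P_def Q_def)
  have "((P * M + Q * L) * K)-lipschitz_on (ball z e) (\<lambda>x. B (f x) (g x))"
  proof (rule lipschitz_onI)
    fix x y assume xy: "x \<in> ball z e" "y \<in> ball z e"
    have "B (f x) (g x) - B (f y) (g y) = B (f x) (g x - g y) + B (f x - f y) (g y)"
      by (simp add: diff_left diff_right)
    then have "dist (B (f x) (g x)) (B (f y) (g y)) \<le> norm (B (f x) (g x - g y)) + norm (B (f x - f y) (g y))"
      by (simp add: dist_norm norm_triangle_ineq)
    also have "\<dots> \<le> norm (f x) * dist (g x) (g y) * K + dist (f x) (f y) * norm (g y) * K"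
      using K(2) by (intro add_mono) (simp_all add: dist_norm)
    also have "\<dots> \<le> P * (M * dist x y) * K + (L * dist x y) * Q * K"
      using bound[OF f xy(1)] bound[OF g xy(2)] lipschitz_onD[OF f xy] lipschitz_onD[OF g xy] K(1) PQ LM
      by (intro add_mono mult_mono mult_right_mono) (auto simp: P_def[symmetric] Q_def[symmetric])
    finally show "dist (B (f x) (g x)) (B (f y) (g y)) \<le> (P * M + Q * L) * K * dist x y"
      by (simp add: algebra_simps)
  qed (use PQ LM K in simp)
  then show ?thesis using e unfolding lipschitz_near_def by blast
qed

lemmas lipschitz_near_mult = lipschitz_near_bilinear[OF bounded_bilinear_mult]

lemma lipschitz_near_sum:
  fixes f :: "'i \<Rightarrow> 'a::metric_space \<Rightarrow> 'b::real_normed_vector"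
  assumes "\<And>i. i \<in> A \<Longrightarrow> lipschitz_near z (f i)"
  shows "lipschitz_near z (\<lambda>x. \<Sum>i\<in>A. f i x)"
  using assms by (induction A rule: infinite_finite_induct) (auto intro!: lipschitz_near_add)

lemma lipschitz_near_compose:
  assumes f: "lipschitz_near z f" and \<phi>: "lipschitz_near (f z) \<phi>"
  shows "lipschitz_near z (\<lambda>x. \<phi> (f x))"
proof -
  obtain e L where e: "e > 0" and L: "L-lipschitz_on (ball z e) f" using f by (rule lipschitz_nearE)
  obtain d M where d: "d > 0" and M: "M-lipschitz_on (ball (f z) d) \<phi>" using \<phi> by (rule lipschitz_nearE)
  have "\<exists>c>0. \<forall>x. dist x z < c \<longrightarrow> dist (f x) (f z) < d"
    using lipschitz_near_isCont[OF f] d unfolding continuous_at_eps_delta by blast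
  then obtain c where c: "c > 0" "\<And>x. dist x z < c \<Longrightarrow> dist (f x) (f z) < d" by blast
  have "L-lipschitz_on (ball z (min c e)) f" using L by (rule lipschitz_on_subset) auto
  moreover have "M-lipschitz_on (f ` ball z (min c e)) \<phi>"
    using M by (rule lipschitz_on_subset) (use c in \<open>auto simp: dist_commute\<close>)
  ultimately have "(M * L)-lipschitz_on (ball z (min c e)) (\<lambda>x. \<phi> (f x))"
    by (rule lipschitz_on_compose2)
  then show ?thesis using c(1) e unfolding lipschitz_near_def
    by (intro exI[of _ "min c e"]) auto
qed

lemma lipschitz_near_C1:
  fixes \<phi> :: "real \<Rightarrow> real"
  assumes S: "open S" "a \<in> S" and der: "\<And>x. x \<in> S \<Longrightarrow> (\<phi> has_real_derivative \<phi>' x) (at x)"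
    and cont: "continuous_on S \<phi>'"
  shows "lipschitz_near a \<phi>"
proof -
  obtain e where e: "e > 0" "cball a e \<subseteq> S"
    using S unfolding open_contains_cball by blast
  have "bounded (\<phi>' ` cball a e)"
    by (rule compact_imp_bounded[OF compact_continuous_image[OF continuous_on_subset[OF cont e(2)] compact_cball]])
  then obtain L where L: "L > 0" "\<And>x. x \<in> cball a e \<Longrightarrow> \<bar>\<phi>' x\<bar> \<le> L"
    unfolding bounded_pos by auto
  have "L-lipschitz_on (ball a e) \<phi>"
  proof (rule lipschitz_onI)
    fix x y assume xy: "x \<in> ball a e" "y \<in> ball a e"
    have "norm (\<phi> x - \<phi> y) \<le> L * norm (x - y)"
    proof (rule field_differentiable_bound)
      show "convex (ball a e)" by simp
      show "(\<phi> has_real_derivative \<phi>' u) (at u within ball a e)" if "u \<in> ball a e" for u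
        using e(2) that by (intro has_field_derivative_at_within[OF der]) auto
    qed (use L xy in auto)
    then show "dist (\<phi> x) (\<phi> y) \<le> L * dist x y" by (simp add: dist_norm)
  qed (use L in simp)
  then show ?thesis using e unfolding lipschitz_near_def by blast
qed

lemma lipschitz_near_sin:
  assumes "lipschitz_near z f"
  shows "lipschitz_near z (\<lambda>x. sin (f x :: real))"
proof (rule lipschitz_near_compose[OF assms])
  show "lipschitz_near (f z) sin"
  proof (rule lipschitz_near_C1[of UNIV _ sin cos])
    show "continuous_on UNIV (cos :: real \<Rightarrow> real)" by (simp add: continuous_at_imp_continuous_on)
  qed simp_all
qed

lemma lipschitz_near_cos:
  assumes "lipschitz_near z f"
  shows "lipschitz_near z (\<lambda>x. cos (f x :: real))"
proof (rule lipschitz_near_compose[OF assms])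
  show "lipschitz_near (f z) cos"
  proof (rule lipschitz_near_C1[of UNIV _ cos "\<lambda>x. - sin x"])
    show "continuous_on UNIV (\<lambda>x :: real. - sin x)" by (simp add: continuous_at_imp_continuous_on)
  qed simp_all
qed

lemma lipschitz_near_inverse:
  fixes f :: "'a::metric_space \<Rightarrow> real"
  assumes "lipschitz_near z f" "f z \<noteq> 0"
  shows "lipschitz_near z (\<lambda>x. inverse (f x))"
proof (rule lipschitz_near_compose[OF assms(1)])
  show "lipschitz_near (f z) inverse"
  proof (rule lipschitz_near_C1[of "- {0}" _ inverse "\<lambda>x. - (inverse x ^ Suc (Suc 0))"])
    show "continuous_on (- {0}) (\<lambda>x :: real. - (inverse x ^ Suc (Suc 0)))"
      by (intro continuous_intros) simp
    show "(inverse has_real_derivative - (inverse x ^ Suc (Suc 0))) (at x)" if "x \<in> - {0}" for x :: real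
      using that by (intro DERIV_inverse) simp
  qed (use assms(2) in \<open>auto simp: open_Compl\<close>)
qed

lemma lipschitz_near_divide:
  fixes f :: "'a::metric_space \<Rightarrow> real"
  assumes "lipschitz_near z f" "lipschitz_near z g" "g z \<noteq> 0"
  shows "lipschitz_near z (\<lambda>x. f x / g x)"
  using lipschitz_near_mult[OF assms(1) lipschitz_near_inverse[OF assms(2,3)]] by (simp add: divide_inverse)

lemma lipschitz_near_sqrt:
  assumes "lipschitz_near z f" "f z > 0"
  shows "lipschitz_near z (\<lambda>x. sqrt (f x))"
proof (rule lipschitz_near_compose[OF assms(1)])
  show "lipschitz_near (f z) sqrt"
  proof (rule lipschitz_near_C1[of "{0<..}" _ sqrt "\<lambda>x. inverse (sqrt x) / 2"])
    show "continuous_on {0<..} (\<lambda>x. inverse (sqrt x) / 2)"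
      by (intro continuous_intros) auto
    show "(sqrt has_real_derivative inverse (sqrt x) / 2) (at x)" if "x \<in> {0<..}" for x
      using that by (intro DERIV_real_sqrt) simp
  qed (use assms(2) in simp_all)
qed

lemma lipschitz_near_power:
  fixes f :: "'a::metric_space \<Rightarrow> real"
  assumes "lipschitz_near z f"
  shows "lipschitz_near z (\<lambda>x. f x ^ n)"
  by (induction n) (auto intro!: lipschitz_near_mult assms)

lemma lipschitz_near_vec:
  fixes f :: "'a::metric_space \<Rightarrow> 'b::real_normed_vector^'n"
  assumes "\<And>i. lipschitz_near z (\<lambda>x. f x $ i)"
  shows "lipschitz_near z f"
proof -
  have "\<exists>e L. e > 0 \<and> L-lipschitz_on (ball z e) (\<lambda>x. f x $ i)" for i
    using assms[of i] by (auto simp: lipschitz_near_def)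
  then obtain e L where eL: "\<And>i. e i > 0" "\<And>i. (L i)-lipschitz_on (ball z (e i)) (\<lambda>x. f x $ i)"
    by metis
  define d where "d = Min (range e)"
  have d: "d > 0" "d \<le> e i" for i using eL(1) by (auto simp: d_def)
  have "(\<Sum>i\<in>UNIV. L i)-lipschitz_on (ball z d) f"
  proof (rule lipschitz_onI)
    fix x y assume xy: "x \<in> ball z d" "y \<in> ball z d"
    have "dist (f x) (f y) \<le> (\<Sum>i\<in>UNIV. norm ((f x - f y) $ i))"
      unfolding dist_norm norm_vec_def by (rule L2_set_le_sum) simp
    also have "\<dots> \<le> (\<Sum>i\<in>UNIV. L i * dist x y)"
    proof (rule sum_mono)
      fix i
      have "x \<in> ball z (e i)" "y \<in> ball z (e i)" using xy d(2)[of i] by auto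
      from lipschitz_onD[OF eL(2) this] show "norm ((f x - f y) $ i) \<le> L i * dist x y"
        by (simp add: dist_norm)
    qed
    finally show "dist (f x) (f y) \<le> (\<Sum>i\<in>UNIV. L i) * dist x y" by (simp add: sum_distrib_right)
  next
    show "0 \<le> (\<Sum>i\<in>UNIV. L i)" using eL(2) by (intro sum_nonneg) (auto simp: lipschitz_on_def)
  qed
  then show ?thesis using d(1) unfolding lipschitz_near_def by blast
qed

lemma lipschitz_near_cball:
  fixes f :: "'a::real_normed_vector \<Rightarrow> 'b::real_normed_vector"
  assumes "lipschitz_near z f"
  obtains r L where "r > 0" "\<And>x y. x \<in> cball z r \<Longrightarrow> y \<in> cball z r \<Longrightarrow> norm (f x - f y) \<le> L * norm (x - y)"
proof -
  obtain e L where e: "e > 0" and L: "L-lipschitz_on (ball z e) f" using assms by (rule lipschitz_nearE)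
  show ?thesis
    by (rule that[of "e / 2" L]) (use e lipschitz_onD[OF L] in \<open>auto simp: dist_norm\<close>)
qed

section \<open>The derivative of the arcs of a face\<close>

text \<open>Lagrange's reduction to squares with denominators cleared: multiplied by the first two
  leading minors, the form is a combination of three squares whose coefficients are positive because
  the minors are.\<close>

lemma sylvester_3:
  fixes a b c d e f x y z :: real
  assumes "a > 0" "a * d - b\<^sup>2 > 0"
    and det: "a * (d * f - e\<^sup>2) - b * (b * f - e * c) + c * (b * e - d * c) > 0"
    and nz: "x \<noteq> 0 \<or> y \<noteq> 0 \<or> z \<noteq> 0"
  shows "a * x\<^sup>2 + d * y\<^sup>2 + f * z\<^sup>2 + 2 * b * x * y + 2 * c * x * z + 2 * e * y * z > 0"
proof -
  define m where "m = a * d - b\<^sup>2"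
  define n where "n = a * e - b * c"
  define Q where "Q = a * x\<^sup>2 + d * y\<^sup>2 + f * z\<^sup>2 + 2 * b * x * y + 2 * c * x * z + 2 * e * y * z"
  define D where "D = a * (d * f - e\<^sup>2) - b * (b * f - e * c) + c * (b * e - d * c)"
  have m: "m > 0" and D: "D > 0" using assms by (simp_all add: m_def D_def)
  have eq: "a * m * Q = m * (a * x + b * y + c * z)\<^sup>2 + (m * y + n * z)\<^sup>2 + a * D * z\<^sup>2"
    unfolding m_def n_def Q_def D_def by algebra
  have "a * m * Q > 0"
  proof (cases "z = 0")
    case False
    then have "a * D * z\<^sup>2 > 0" using assms(1) D by simp
    moreover have "m * (a * x + b * y + c * z)\<^sup>2 \<ge> 0" using m by simp
    ultimately show ?thesis unfolding eq by (simp add: add_nonneg_pos)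
  next
    case z: True
    show ?thesis
    proof (cases "y = 0")
      case False
      then show ?thesis unfolding eq using z m by (simp add: add_nonneg_pos)
    next
      case True
      then show ?thesis unfolding eq using z nz m assms(1) by simp
    qed
  qed
  moreover have "a * m > 0" using assms(1) m by simp
  ultimately show ?thesis unfolding Q_def[symmetric] by (rule zero_less_mult_pos)
qed

text \<open>The form is \<open>h \<bullet> G J h\<close> with \<open>G\<close> having diagonal 1 and entries \<open>- g i j\<close>, and \<open>J\<close> having
  diagonal 0 and entries \<open>- q i j\<close>. The Cauchy-Binet expansion of its leading minors has only positive terms.\<close>

lemma product_form_pos_def:
  fixes g q :: "3 \<Rightarrow> 3 \<Rightarrow> real" and x y z :: real
  assumes g: "\<And>i j. i \<noteq> j \<Longrightarrow> g i j > 0" "g 0 1 * g 1 0 > 1" "g 0 2 * g 2 0 > 1" "g 1 2 * g 2 1 > 1"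
    and q: "\<And>i j. i \<noteq> j \<Longrightarrow> q i j > 0"
    and sym: "- q 0 1 + g 0 2 * q 2 1 = - q 1 0 + g 1 2 * q 2 0"
      "- q 0 2 + g 0 1 * q 1 2 = - q 2 0 + g 2 1 * q 1 0"
      "- q 1 2 + g 1 0 * q 0 2 = - q 2 1 + g 2 0 * q 0 1"
    and nz: "x \<noteq> 0 \<or> y \<noteq> 0 \<or> z \<noteq> 0"
  shows "x * ((g 0 1 * q 1 0 + g 0 2 * q 2 0) * x + (- q 0 1 + g 0 2 * q 2 1) * y + (- q 0 2 + g 0 1 * q 1 2) * z)
    + y * ((- q 1 0 + g 1 2 * q 2 0) * x + (g 1 0 * q 0 1 + g 1 2 * q 2 1) * y + (- q 1 2 + g 1 0 * q 0 2) * z)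
    + z * ((- q 2 0 + g 2 1 * q 1 0) * x + (- q 2 1 + g 2 0 * q 0 1) * y + (g 2 0 * q 0 2 + g 2 1 * q 1 2) * z) > 0"
proof -
  note pos = g(1)[of 0 1] g(1)[of 0 2] g(1)[of 1 0] g(1)[of 1 2] g(1)[of 2 0] g(1)[of 2 1]
    q[of 0 1] q[of 0 2] q[of 1 0] q[of 1 2] q[of 2 0] q[of 2 1]
  define a where "a = g 0 1 * q 1 0 + g 0 2 * q 2 0"
  define d where "d = g 1 0 * q 0 1 + g 1 2 * q 2 1"
  define f where "f = g 2 0 * q 0 2 + g 2 1 * q 1 2"
  define b where "b = - q 0 1 + g 0 2 * q 2 1"
  define c where "c = - q 0 2 + g 0 1 * q 1 2"
  define e where "e = - q 1 2 + g 1 0 * q 0 2"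
  have a: "a > 0" unfolding a_def using pos by (simp add: add_pos_pos)
  have "a * d - b\<^sup>2 = q 1 0 * q 2 1 * (g 0 1 * g 1 2 + g 0 2) + q 0 1 * q 2 0 * (g 1 2 + g 0 2 * g 1 0)
      + q 0 1 * q 1 0 * (g 0 1 * g 1 0 - 1)"
  proof -
    \<comment> \<open>One factor is replaced by the transposed entry, so that the difference becomes
      a minor of the product \<open>G J\<close>.\<close>
    have "b\<^sup>2 = (- q 0 1 + g 0 2 * q 2 1) * (- q 1 0 + g 1 2 * q 2 0)"
      unfolding b_def power2_eq_square using sym(1) by simp
    then show ?thesis unfolding a_def d_def by (simp add: algebra_simps)
  qed
  also have "\<dots> > 0" using pos g(2) by (intro add_pos_pos mult_pos_pos) simp_all
  finally have minor: "a * d - b\<^sup>2 > 0" .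
  \<comment> \<open>The determinant of the product is the product of determinants: the two factors
    on the right are \<open>- det J\<close> and \<open>- det G\<close>.\<close>
  have "a * (d * f - e\<^sup>2) - b * (b * f - e * c) + c * (b * e - d * c)
    = (q 0 1 * q 1 2 * q 2 0 + q 0 2 * q 1 0 * q 2 1) *
      (g 0 1 * g 1 2 * g 2 0 + g 0 2 * g 1 0 * g 2 1 + (g 0 1 * g 1 0 - 1) + g 0 2 * g 2 0 + g 1 2 * g 2 1)"
  proof -
    define b' c' e' where "b' = - q 1 0 + g 1 2 * q 2 0" and "c' = - q 2 0 + g 2 1 * q 1 0" and "e' = - q 2 1 + g 2 0 * q 0 1"
    have "a * (d * f - e\<^sup>2) - b * (b * f - e * c) + c * (b * e - d * c)
      = a * (d * f - e * e') - b * (b' * f - e * c') + c * (b' * e' - d * c')"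
      using sym unfolding b_def c_def e_def b'_def c'_def e'_def power2_eq_square by simp
    also have "\<dots> = (q 0 1 * q 1 2 * q 2 0 + q 0 2 * q 1 0 * q 2 1) *
      (g 0 1 * g 1 2 * g 2 0 + g 0 2 * g 1 0 * g 2 1 + (g 0 1 * g 1 0 - 1) + g 0 2 * g 2 0 + g 1 2 * g 2 1)"
      unfolding a_def b_def c_def d_def e_def f_def b'_def c'_def e'_def by algebra
    finally show ?thesis .
  qed
  also have "\<dots> > 0" using pos g(2-4) by (intro add_pos_pos mult_pos_pos) simp_all
  finally have det: "a * (d * f - e\<^sup>2) - b * (b * f - e * c) + c * (b * e - d * c) > 0" .
  have "a * x\<^sup>2 + d * y\<^sup>2 + f * z\<^sup>2 + 2 * b * x * y + 2 * c * x * z + 2 * e * y * z > 0"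
    by (rule sylvester_3[OF a minor det nz])
  also have "a * x\<^sup>2 + d * y\<^sup>2 + f * z\<^sup>2 + 2 * b * x * y + 2 * c * x * z + 2 * e * y * z
    = x * (a * x + b * y + c * z) + y * (b * x + d * y + e * z) + z * (c * x + e * y + f * z)"
    by algebra
  finally show ?thesis
    using sym unfolding a_def b_def c_def d_def e_def f_def by simp
qed

text \<open>The cosine law in terms of the hyperbolic cosines of the red lengths; the first argument
  belongs to the red edge opposite to the arc.\<close>

definition hexagon_side :: "real \<Rightarrow> real \<Rightarrow> real \<Rightarrow> real" where
  "hexagon_side x y z = arcosh ((x + y * z) / (sqrt (y\<^sup>2 - 1) * sqrt (z\<^sup>2 - 1)))"

text \<open>Differentiating arcosh puts
  \<open>(x + y * z)\<^sup>2 - (y\<^sup>2 - 1) * (z\<^sup>2 - 1)\<close> under a root. It equals an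
  expression symmetric in the three variables, so the three arcs of a face share one positive
  scalar, which can be split off the Jacobian.\<close>

lemma hexagon_side_has_derivative:
  assumes x: "(x has_derivative x') (at p)" and y: "(y has_derivative y') (at p)" and z: "(z has_derivative z') (at p)"
    and gt: "x p > 1" "y p > 1" "z p > 1"
  shows "((\<lambda>p. hexagon_side (x p) (y p) (z p)) has_derivative
    (\<lambda>h. (x' h - (z p + x p * y p) / ((y p)\<^sup>2 - 1) * y' h - (y p + x p * z p) / ((z p)\<^sup>2 - 1) * z' h)
        / sqrt ((x p)\<^sup>2 + (y p)\<^sup>2 + (z p)\<^sup>2 + 2 * x p * y p * z p - 1))) (at p)"
proof -
  define Y Z where "Y = sqrt ((y p)\<^sup>2 - 1)" and "Z = sqrt ((z p)\<^sup>2 - 1)"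
  have y1: "(y p)\<^sup>2 > 1" and z1: "(z p)\<^sup>2 > 1" using gt by (simp_all add: one_less_power)
  have Y: "Y > 0" "Y\<^sup>2 = (y p)\<^sup>2 - 1" and Z: "Z > 0" "Z\<^sup>2 = (z p)\<^sup>2 - 1"
    using y1 z1 by (simp_all add: Y_def Z_def)
  define D2 where "D2 = (x p)\<^sup>2 + (y p)\<^sup>2 + (z p)\<^sup>2 + 2 * x p * y p * z p - 1"
  define D where "D = sqrt D2"
  define w where "w = (x p + y p * z p) / (Y * Z)"
  have num: "x p + y p * z p > 0" using gt by (simp add: add_pos_pos)
  have D2: "D2 = (x p + y p * z p)\<^sup>2 - (Y * Z)\<^sup>2"
    unfolding D2_def power_mult_distrib Y Z by algebra
  have D2p: "D2 > 0"
  proof -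
    have "x p * y p * z p > 0" using gt by simp
    then show ?thesis using y1 zero_le_power2[of "x p"] zero_le_power2[of "z p"] unfolding D2_def by linarith
  qed
  have D: "D > 0" using D2p by (simp add: D_def)
  have w1: "w\<^sup>2 - 1 = D2 / (Y * Z)\<^sup>2"
    unfolding D2 w_def using Y Z by (simp add: power_divide diff_divide_distrib)
  have sw: "sqrt (w\<^sup>2 - 1) = D / (Y * Z)"
    unfolding w1 D_def using Y Z by (simp add: real_sqrt_divide)
  have "w\<^sup>2 > 1" using w1 D2p Y Z by (smt (verit) divide_pos_pos zero_less_power mult_pos_pos)
  moreover have "w > 0" using num Y Z by (simp add: w_def)
  ultimately have w: "w > 1" by (metis less_imp_le one_power2 power2_less_imp_less)
  have dY: "((\<lambda>p. sqrt ((y p)\<^sup>2 - 1)) has_derivative (\<lambda>h. y p / Y * y' h)) (at p)"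
    using y1 by (auto intro!: derivative_eq_intros y simp: Y_def field_simps)
  have dZ: "((\<lambda>p. sqrt ((z p)\<^sup>2 - 1)) has_derivative (\<lambda>h. z p / Z * z' h)) (at p)"
    using z1 by (auto intro!: derivative_eq_intros z simp: Z_def field_simps)
  have dw: "((\<lambda>p. (x p + y p * z p) / (sqrt ((y p)\<^sup>2 - 1) * sqrt ((z p)\<^sup>2 - 1))) has_derivative
      (\<lambda>h. (x' h - (z p + x p * y p) / Y\<^sup>2 * y' h - (y p + x p * z p) / Z\<^sup>2 * z' h) / (Y * Z))) (at p)"
  proof (rule has_derivative_eq_rhs[OF has_derivative_divide[OF has_derivative_add[OF x has_derivative_mult[OF y z]]
        has_derivative_mult[OF dY dZ]]])
    show "sqrt ((y p)\<^sup>2 - 1) * sqrt ((z p)\<^sup>2 - 1) \<noteq> 0" using Y Z by (simp add: Y_def Z_def)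
    show "(\<lambda>h. - (x p + y p * z p) *
       (inverse (sqrt ((y p)\<^sup>2 - 1) * sqrt ((z p)\<^sup>2 - 1)) *
        (sqrt ((y p)\<^sup>2 - 1) * (z p / Z * z' h) + y p / Y * y' h * sqrt ((z p)\<^sup>2 - 1)) *
        inverse (sqrt ((y p)\<^sup>2 - 1) * sqrt ((z p)\<^sup>2 - 1))) +
       (x' h + (y p * z' h + y' h * z p)) / (sqrt ((y p)\<^sup>2 - 1) * sqrt ((z p)\<^sup>2 - 1)))
      = (\<lambda>h. (x' h - (z p + x p * y p) / Y\<^sup>2 * y' h - (y p + x p * z p) / Z\<^sup>2 * z' h) / (Y * Z))"
    proof
      fix h
      have G: "(u + v * - A / a + w * - B / b) / c = (u - B / b * w - A / a * v) / c" for u v w A B a b c :: real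
        by (simp add: mult.commute)
      have "- (x p + y p * z p) * (inverse (Y * Z) * (Y * (z p / Z * z' h) + y p / Y * y' h * Z) * inverse (Y * Z)) +
         (x' h + (y p * z' h + y' h * z p)) / (Y * Z)
         = (x' h + (y p * z' h + y' h * z p) - (x p + y p * z p) * (z p * z' h / Z\<^sup>2 + y p * y' h / Y\<^sup>2)) / (Y * Z)"
        using Y(1) Z(1) by (simp add: field_simps power2_eq_square)
      also have "x' h + (y p * z' h + y' h * z p) - (x p + y p * z p) * (z p * z' h / Z\<^sup>2 + y p * y' h / Y\<^sup>2)
         = x' h + z' h * (y p * Z\<^sup>2 - (x p + y p * z p) * z p) / Z\<^sup>2 + y' h * (z p * Y\<^sup>2 - (x p + y p * z p) * y p) / Y\<^sup>2"
        using Y(1) Z(1) by (simp add: field_simps)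
      also have "y p * Z\<^sup>2 - (x p + y p * z p) * z p = - (y p + x p * z p)"
        unfolding Z(2) by algebra
      also have "z p * Y\<^sup>2 - (x p + y p * z p) * y p = - (z p + x p * y p)"
        unfolding Y(2) by algebra
      finally have E: "- (x p + y p * z p) * (inverse (Y * Z) * (Y * (z p / Z * z' h) + y p / Y * y' h * Z) * inverse (Y * Z)) +
         (x' h + (y p * z' h + y' h * z p)) / (Y * Z)
         = (x' h + z' h * - (y p + x p * z p) / Z\<^sup>2 + y' h * - (z p + x p * y p) / Y\<^sup>2) / (Y * Z)" .
      show "- (x p + y p * z p) *
         (inverse (sqrt ((y p)\<^sup>2 - 1) * sqrt ((z p)\<^sup>2 - 1)) *
          (sqrt ((y p)\<^sup>2 - 1) * (z p / Z * z' h) + y p / Y * y' h * sqrt ((z p)\<^sup>2 - 1)) *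
          inverse (sqrt ((y p)\<^sup>2 - 1) * sqrt ((z p)\<^sup>2 - 1))) +
         (x' h + (y p * z' h + y' h * z p)) / (sqrt ((y p)\<^sup>2 - 1) * sqrt ((z p)\<^sup>2 - 1))
         = (x' h - (z p + x p * y p) / Y\<^sup>2 * y' h - (y p + x p * z p) / Z\<^sup>2 * z' h) / (Y * Z)"
        unfolding Y_def[symmetric] Z_def[symmetric] by (rule trans[OF E G])
    qed
  qed
  have "(arcosh has_real_derivative 1 / sqrt (w\<^sup>2 - 1)) (at w)" by (rule arcosh_real_has_field_derivative[OF w])
  then have "((\<lambda>p. hexagon_side (x p) (y p) (z p)) has_derivative
     (\<lambda>h. (x' h - (z p + x p * y p) / Y\<^sup>2 * y' h - (y p + x p * z p) / Z\<^sup>2 * z' h) / (Y * Z) * (1 / sqrt (w\<^sup>2 - 1)))) (at p)"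
    unfolding hexagon_side_def by (intro DERIV_compose_FDERIV[OF _ dw]) (simp add: w_def Y_def Z_def)
  then show ?thesis
    unfolding sw D_def[symmetric] D2_def[symmetric] Y(2) Z(2) using Y(1) Z(1) by simp
qed

lemma sum_3': "sum f (UNIV :: 3 set) = f 0 + f 1 + f 2"
  by (simp add: sum_3 cyclic_numerals add_ac)

definition conf_cosh :: "real \<Rightarrow> real \<Rightarrow> real \<Rightarrow> real" where
  "conf_cosh \<eta> a b = (cos a * cos b + \<eta>) / (sin a * sin b)"

lemma conf_cosh_commute: "conf_cosh \<eta> a b = conf_cosh \<eta> b a"
  by (simp add: conf_cosh_def mult.commute)

lemma conf_cosh_has_derivative:
  assumes p: "(p has_derivative p') (at v)" and q: "(q has_derivative q') (at v)"
    and nz: "sin (p v) \<noteq> 0" "sin (q v) \<noteq> 0"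
  shows "((\<lambda>v. conf_cosh \<eta> (p v) (q v)) has_derivative
    (\<lambda>h. - ((cos (q v) + \<eta> * cos (p v)) / ((sin (p v))\<^sup>2 * sin (q v))) * p' h
         - (cos (p v) + \<eta> * cos (q v)) / ((sin (q v))\<^sup>2 * sin (p v)) * q' h)) (at v)"
proof -
  define S T C D where "S = sin (p v)" and "T = sin (q v)" and "C = cos (p v)" and "D = cos (q v)"
  have sq: "S\<^sup>2 = 1 - C\<^sup>2" "T\<^sup>2 = 1 - D\<^sup>2"
    by (simp_all add: S_def T_def C_def D_def sin_squared_eq)
  have nz': "S \<noteq> 0" "T \<noteq> 0" using nz by (simp_all add: S_def T_def)
  have num: "((\<lambda>v. cos (p v) * cos (q v) + \<eta>) has_derivative (\<lambda>h. - (S * p' h) * D - C * (T * q' h))) (at v)"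
    by (auto intro!: derivative_eq_intros p q simp: S_def T_def C_def D_def algebra_simps)
  have den: "((\<lambda>v. sin (p v) * sin (q v)) has_derivative (\<lambda>h. C * p' h * T + S * (D * q' h))) (at v)"
    by (auto intro!: derivative_eq_intros p q simp: S_def T_def C_def D_def algebra_simps)
  show ?thesis
    unfolding conf_cosh_def
  proof (rule has_derivative_eq_rhs[OF has_derivative_divide[OF num den]])
    show "sin (p v) * sin (q v) \<noteq> 0" using nz by simp
    show "(\<lambda>h. - (cos (p v) * cos (q v) + \<eta>) * (inverse (sin (p v) * sin (q v)) *
         (C * p' h * T + S * (D * q' h)) * inverse (sin (p v) * sin (q v))) +
         (- (S * p' h) * D - C * (T * q' h)) / (sin (p v) * sin (q v))) =
      (\<lambda>h. - ((cos (q v) + \<eta> * cos (p v)) / ((sin (p v))\<^sup>2 * sin (q v))) * p' h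
         - (cos (p v) + \<eta> * cos (q v)) / ((sin (q v))\<^sup>2 * sin (p v)) * q' h)"
      unfolding S_def[symmetric] T_def[symmetric] C_def[symmetric] D_def[symmetric]
    proof
      fix h
      have "- (C * D + \<eta>) * (inverse (S * T) * (C * p' h * T + S * (D * q' h)) * inverse (S * T)) +
         (- (S * p' h) * D - C * (T * q' h)) / (S * T)
         = - ((D * (S\<^sup>2 + C\<^sup>2) + \<eta> * C) / (S\<^sup>2 * T)) * p' h - (C * (T\<^sup>2 + D\<^sup>2) + \<eta> * D) / (T\<^sup>2 * S) * q' h"
        using nz' by (simp add: divide_simps) algebra
      then show "- (C * D + \<eta>) * (inverse (S * T) * (C * p' h * T + S * (D * q' h)) * inverse (S * T)) +
         (- (S * p' h) * D - C * (T * q' h)) / (S * T)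
         = - ((D + \<eta> * C) / (S\<^sup>2 * T)) * p' h - (C + \<eta> * D) / (T\<^sup>2 * S) * q' h"
        unfolding sq by simp
    qed
  qed
qed

text \<open>Closed form of an off-diagonal entry of the product of the two derivative matrices. A
  factor \<open>Sj\<^sup>2\<close> cancels, and what remains is invariant under exchanging
  \<open>Ci\<close>, \<open>x\<close> with \<open>Cj\<close>, \<open>y\<close>: this is the symmetry
  of the face Jacobian.\<close>

lemma conf_cosh_entry_symmetric:
  fixes Ci Cj Ck Si Sj Sk x y z :: real
  assumes S: "Si\<^sup>2 = 1 - Ci\<^sup>2" "Sj\<^sup>2 = 1 - Cj\<^sup>2" "Si \<noteq> 0" "Sj \<noteq> 0" "Sk \<noteq> 0"
    and c: "ci = (Cj * Ck + x) / (Sj * Sk)" "cj = (Ci * Ck + y) / (Si * Sk)" "ck = (Ci * Cj + z) / (Si * Sj)"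
    and ck: "ck\<^sup>2 - 1 \<noteq> 0"
  shows "- ((Ck + x * Cj) / (Sj\<^sup>2 * Sk)) + (cj + ci * ck) / (ck\<^sup>2 - 1) * ((Ci + z * Cj) / (Sj\<^sup>2 * Si))
    = (Ck * (1 - z\<^sup>2) + x * (Cj + z * Ci) + y * (Ci + z * Cj)) / (Sk * (Ci\<^sup>2 + Cj\<^sup>2 + z\<^sup>2 + 2 * z * Ci * Cj - 1))"
proof -
  define N where "N = Ci\<^sup>2 + Cj\<^sup>2 + z\<^sup>2 + 2 * z * Ci * Cj - 1"
  define T where "T = Ci * Ck + y * Sj\<^sup>2 + z * Cj * Ck + x * Ci * Cj + x * z"
  have ckN: "ck\<^sup>2 - 1 = N / (Si\<^sup>2 * Sj\<^sup>2)"
  proof -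
    have "ck\<^sup>2 - 1 = ((Ci * Cj + z)\<^sup>2 - Si\<^sup>2 * Sj\<^sup>2) / (Si\<^sup>2 * Sj\<^sup>2)"
      using S(3,4) by (simp add: c power_divide power_mult_distrib diff_divide_distrib)
    also have "(Ci * Cj + z)\<^sup>2 - Si\<^sup>2 * Sj\<^sup>2 = N" unfolding S(1,2) N_def by algebra
    finally show ?thesis .
  qed
  have N: "N \<noteq> 0" using ck unfolding ckN by auto
  have cT: "cj + ci * ck = T / (Si * Sj\<^sup>2 * Sk)"
  proof -
    have "cj + ci * ck = ((Ci * Ck + y) * Sj\<^sup>2 + (Cj * Ck + x) * (Ci * Cj + z)) / (Si * Sj\<^sup>2 * Sk)"
      using S(3-5) by (simp add: c field_simps power2_eq_square)
    also have "(Ci * Ck + y) * Sj\<^sup>2 + (Cj * Ck + x) * (Ci * Cj + z) = T"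
      unfolding T_def S(2) by algebra
    finally show ?thesis .
  qed
  have "- ((Ck + x * Cj) / (Sj\<^sup>2 * Sk)) + (cj + ci * ck) / (ck\<^sup>2 - 1) * ((Ci + z * Cj) / (Sj\<^sup>2 * Si))
     = (T * (Ci + z * Cj) - (Ck + x * Cj) * N) / (Sj\<^sup>2 * (Sk * N))"
    unfolding ckN cT using S(3-5) N by (simp add: field_simps power2_eq_square)
  also have "T * (Ci + z * Cj) - (Ck + x * Cj) * N = Sj\<^sup>2 * (Ck * (1 - z\<^sup>2) + x * (Cj + z * Ci) + y * (Ci + z * Cj))"
    unfolding T_def N_def S(2) by algebra
  also have "Sj\<^sup>2 * (Ck * (1 - z\<^sup>2) + x * (Cj + z * Ci) + y * (Ci + z * Cj)) / (Sj\<^sup>2 * (Sk * N))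
      = (Ck * (1 - z\<^sup>2) + x * (Cj + z * Ci) + y * (Ci + z * Cj)) / (Sk * N)"
    using S(4) by simp
  finally show ?thesis unfolding N_def .
qed

text \<open>Admissibility of the edge amounts to \<open>\<eta> > - cos (a + b)\<close>; inserted
  into the numerator it leaves more than \<open>sin a * sin (a + b)\<close>, which is positive. Thus
  edge lengths decrease in each angle.\<close>

lemma conf_cosh_derivative_positive:
  assumes "0 < a" "a < pi / 2" "0 < b" "b < pi / 2" and gt: "conf_cosh \<eta> a b > 1"
  shows "(cos b + \<eta> * cos a) / ((sin a)\<^sup>2 * sin b) > 0"
proof -
  have sc: "sin a > 0" "sin b > 0" "cos a > 0" "cos b > 0"
    using assms by (auto intro: sin_gt_zero cos_gt_zero)
  have "\<eta> > sin a * sin b - cos a * cos b"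
    using gt sc by (simp add: conf_cosh_def less_divide_eq)
  then have "\<eta> * cos a > (sin a * sin b - cos a * cos b) * cos a" using sc by simp
  then have "cos b * (1 - (cos a)\<^sup>2) + sin a * sin b * cos a < cos b + \<eta> * cos a"
    by (simp add: algebra_simps power2_eq_square)
  moreover have "cos b * (1 - (cos a)\<^sup>2) + sin a * sin b * cos a > 0"
    using sc by (simp add: add_pos_pos flip: sin_squared_eq)
  ultimately have "cos b + \<eta> * cos a > 0" by linarith
  then show ?thesis using sc by simp
qed

text \<open>In \<open>3\<close> the third index besides \<open>i \<noteq> j\<close> is \<open>- i - j\<close>.\<close>

definition face_cosh :: "(3 \<Rightarrow> real) \<Rightarrow> (3 \<Rightarrow> real) \<Rightarrow> 3 \<Rightarrow> real" where
  "face_cosh \<eta> a k = conf_cosh (\<eta> k) (a (k + 1)) (a (k + 2))"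

text \<open>Minus the partial derivative of the \<open>k\<close>-th hyperbolic cosine in the angle
  \<open>a j\<close>, for \<open>j \<noteq> k\<close>.\<close>

definition face_q :: "(3 \<Rightarrow> real) \<Rightarrow> (3 \<Rightarrow> real) \<Rightarrow> 3 \<Rightarrow> 3 \<Rightarrow> real" where
  "face_q \<eta> a k j = (cos (a (- k - j)) + \<eta> k * cos (a j)) / ((sin (a j))\<^sup>2 * sin (a (- k - j)))"

text \<open>For \<open>i \<noteq> j\<close>, minus the partial derivative of the \<open>i\<close>-th
  arc in the hyperbolic cosine of the \<open>j\<close>-th edge, up to the scalar common to all arcs
  of the face.\<close>

definition face_g :: "(3 \<Rightarrow> real) \<Rightarrow> (3 \<Rightarrow> real) \<Rightarrow> 3 \<Rightarrow> 3 \<Rightarrow> real" where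
  "face_g \<eta> a i j = (face_cosh \<eta> a (- i - j) + face_cosh \<eta> a i * face_cosh \<eta> a j) / ((face_cosh \<eta> a j)\<^sup>2 - 1)"

text \<open>The radicand shared by the three arcs; it is minus the Gram determinant of the unit
  normals of the black lines.\<close>

definition face_disc :: "(3 \<Rightarrow> real) \<Rightarrow> (3 \<Rightarrow> real) \<Rightarrow> real" where
  "face_disc \<eta> a = (face_cosh \<eta> a 0)\<^sup>2 + (face_cosh \<eta> a 1)\<^sup>2 + (face_cosh \<eta> a 2)\<^sup>2
     + 2 * face_cosh \<eta> a 0 * face_cosh \<eta> a 1 * face_cosh \<eta> a 2 - 1"

definition face_cosh_deriv :: "(3 \<Rightarrow> real) \<Rightarrow> (3 \<Rightarrow> real) \<Rightarrow> 3 \<Rightarrow> (3 \<Rightarrow> real) \<Rightarrow> real" where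
  "face_cosh_deriv \<eta> a k h = - face_q \<eta> a k (k + 1) * h (k + 1) - face_q \<eta> a k (k + 2) * h (k + 2)"

definition face_arc :: "(3 \<Rightarrow> real) \<Rightarrow> (3 \<Rightarrow> real) \<Rightarrow> 3 \<Rightarrow> real" where
  "face_arc \<eta> a i = hexagon_side (face_cosh \<eta> a i) (face_cosh \<eta> a (i + 1)) (face_cosh \<eta> a (i + 2))"

definition face_arc_deriv :: "(3 \<Rightarrow> real) \<Rightarrow> (3 \<Rightarrow> real) \<Rightarrow> 3 \<Rightarrow> (3 \<Rightarrow> real) \<Rightarrow> real" where
  "face_arc_deriv \<eta> a i h = (face_cosh_deriv \<eta> a i h - face_g \<eta> a i (i + 1) * face_cosh_deriv \<eta> a (i + 1) h
     - face_g \<eta> a i (i + 2) * face_cosh_deriv \<eta> a (i + 2) h) / sqrt (face_disc \<eta> a)"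

definition face_admissible :: "(3 \<Rightarrow> real) \<Rightarrow> (3 \<Rightarrow> real) \<Rightarrow> bool" where
  "face_admissible \<eta> a \<longleftrightarrow> (\<forall>k. 0 < a k \<and> a k < pi / 2 \<and> face_cosh \<eta> a k > 1)"

lemma face_disc_pos:
  assumes "face_admissible \<eta> a"
  shows "face_disc \<eta> a > 0"
proof -
  have c: "face_cosh \<eta> a k > 1" for k using assms by (simp add: face_admissible_def)
  then have "face_cosh \<eta> a k > 0" for k by (rule less_trans[OF zero_less_one])
  then have "face_cosh \<eta> a 0 * face_cosh \<eta> a 1 * face_cosh \<eta> a 2 > 0" by simp
  moreover have "(face_cosh \<eta> a 0)\<^sup>2 > 1" using c by (simp add: one_less_power)
  ultimately show ?thesis unfolding face_disc_def
    using zero_le_power2[of "face_cosh \<eta> a 1"] zero_le_power2[of "face_cosh \<eta> a 2"] by linarith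
qed

lemma face_arc_has_derivative:
  assumes a: "\<And>k. ((\<lambda>p. a p k) has_derivative (\<lambda>h. a' h k)) (at p)" and adm: "face_admissible \<eta> (a p)"
  shows "((\<lambda>p. face_arc \<eta> (a p) i) has_derivative (\<lambda>h. face_arc_deriv \<eta> (a p) i (a' h))) (at p)"
proof -
  have adm': "0 < a p k" "a p k < pi / 2" "face_cosh \<eta> (a p) k > 1" for k
    using adm by (auto simp: face_admissible_def)
  have s: "sin (a p k) \<noteq> 0" for k using sin_gt_zero[of "a p k"] adm'(1,2)[of k] by auto
  have third: "- k - (k + 1) = k + 2" "- k - (k + 2) = k + 1" for k :: 3
    using exhaust_3'[of k] by (auto simp: cyclic_numerals)
  have c: "((\<lambda>p. face_cosh \<eta> (a p) k) has_derivative (\<lambda>h. face_cosh_deriv \<eta> (a p) k (a' h))) (at p)" for k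
    unfolding face_cosh_def face_cosh_deriv_def face_q_def third
    by (rule has_derivative_eq_rhs[OF conf_cosh_has_derivative[OF a a s s]]) simp
  have disc: "(face_cosh \<eta> (a p) i)\<^sup>2 + (face_cosh \<eta> (a p) (i + 1))\<^sup>2 + (face_cosh \<eta> (a p) (i + 2))\<^sup>2 +
      2 * face_cosh \<eta> (a p) i * face_cosh \<eta> (a p) (i + 1) * face_cosh \<eta> (a p) (i + 2) - 1 = face_disc \<eta> (a p)"
    using exhaust_3'[of i] by (auto simp: face_disc_def cyclic_numerals)
  have "((\<lambda>p. face_arc \<eta> (a p) i) has_derivative (\<lambda>h. (face_cosh_deriv \<eta> (a p) i (a' h) -
      (face_cosh \<eta> (a p) (i + 2) + face_cosh \<eta> (a p) i * face_cosh \<eta> (a p) (i + 1)) / ((face_cosh \<eta> (a p) (i + 1))\<^sup>2 - 1) * face_cosh_deriv \<eta> (a p) (i + 1) (a' h) -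
      (face_cosh \<eta> (a p) (i + 1) + face_cosh \<eta> (a p) i * face_cosh \<eta> (a p) (i + 2)) / ((face_cosh \<eta> (a p) (i + 2))\<^sup>2 - 1) * face_cosh_deriv \<eta> (a p) (i + 2) (a' h))
      / sqrt (face_disc \<eta> (a p)))) (at p)"
    unfolding face_arc_def disc[symmetric]
    by (rule hexagon_side_has_derivative[OF c c c adm'(3) adm'(3) adm'(3)])
  then show ?thesis unfolding face_arc_deriv_def face_g_def third .
qed

text \<open>Both sums are the bilinear form of \<open>G J\<close> divided by the common root, so the
  claims reduce to the closed form of its off-diagonal entries and to
  \<open>product_form_pos_def\<close>.\<close>

lemma face_arc_deriv_form:
  assumes adm: "face_admissible \<eta> a"
  shows face_form_symmetric: "(\<Sum>i\<in>UNIV. x i * face_arc_deriv \<eta> a i y) = (\<Sum>i\<in>UNIV. y i * face_arc_deriv \<eta> a i x)"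
    and face_form_pos_def: "x i \<noteq> 0 \<Longrightarrow> (\<Sum>i\<in>UNIV. x i * face_arc_deriv \<eta> a i x) > 0"
proof -
  define g q c where "g = face_g \<eta> a" and "q = face_q \<eta> a" and "c = face_cosh \<eta> a"
  define s C where "s k = sin (a k)" and "C k = cos (a k)" for k
  define D where "D = sqrt (face_disc \<eta> a)"
  have D: "D > 0" using face_disc_pos[OF adm] by (simp add: D_def)
  have a: "0 < a k" "a k < pi / 2" and c1: "c k > 1" for k using adm by (auto simp: face_admissible_def c_def)
  have s: "s k > 0" for k using a[of k] by (auto simp: s_def intro: sin_gt_zero)
  have sn: "s k \<noteq> 0" for k using s[of k] by simp
  have s2: "(s k)\<^sup>2 = 1 - (C k)\<^sup>2" for k by (simp add: s_def C_def sin_squared_eq)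
  have c2: "(c k)\<^sup>2 - 1 > 0" for k using c1[of k] by (simp add: one_less_power)
  have c2n: "(c k)\<^sup>2 - 1 \<noteq> 0" for k using c2[of k] by simp
  have c0: "c k > 0" for k using c1[of k] by simp
  have ceq: "c 0 = (C 1 * C 2 + \<eta> 0) / (s 1 * s 2)" "c 1 = (C 2 * C 0 + \<eta> 1) / (s 2 * s 0)" "c 2 = (C 0 * C 1 + \<eta> 2) / (s 0 * s 1)"
    by (simp_all add: c_def face_cosh_def conf_cosh_def s_def C_def cyclic_numerals)
  have qeq: "q k j = (C (- k - j) + \<eta> k * C j) / ((s j)\<^sup>2 * s (- k - j))" for k j
    by (simp add: q_def face_q_def s_def C_def)
  have geq: "g i j = (c (- i - j) + c i * c j) / ((c j)\<^sup>2 - 1)" for i j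
    by (simp add: g_def face_g_def c_def)
  have gpos: "g i j > 0" for i j
    unfolding geq using c0 c2[of j] by (simp add: add_pos_pos)
  \<comment> \<open>The two quotients have the same numerator \<open>w + c i * c j\<close>; its
    square exceeds \<open>(c i * c j)\<^sup>2\<close> and hence the product of the
    denominators.\<close>
  have gg: "(w + c i * c j) / ((c j)\<^sup>2 - 1) * ((w + c j * c i) / ((c i)\<^sup>2 - 1)) > 1" if "w > 1" for w i j
  proof -
    have "((c j)\<^sup>2 - 1) * ((c i)\<^sup>2 - 1) < (c i * c j)\<^sup>2"
    proof -
      have "(c j)\<^sup>2 > 1" "(c i)\<^sup>2 > 1" using c2[of i] c2[of j] by simp_all
      then show ?thesis by (simp add: algebra_simps power_mult_distrib)
    qed
    also have "\<dots> < (w + c i * c j)\<^sup>2" using that c0[of i] c0[of j] by (intro power_strict_mono) auto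
    finally have "((c j)\<^sup>2 - 1) * ((c i)\<^sup>2 - 1) < (w + c i * c j) * (w + c j * c i)"
      by (simp add: power2_eq_square mult.commute)
    then show ?thesis using c2[of i] c2[of j] by (simp add: less_divide_eq mult_pos_pos)
  qed
  have g01: "g 0 1 * g 1 0 > 1" unfolding geq using gg[OF c1[of 2], of 0 1] by (simp add: cyclic_numerals)
  have g02: "g 0 2 * g 2 0 > 1" unfolding geq using gg[OF c1[of 1], of 0 2] by (simp add: cyclic_numerals)
  have g12: "g 1 2 * g 2 1 > 1" unfolding geq using gg[OF c1[of 0], of 1 2] by (simp add: cyclic_numerals)
  have qpos: "q k j > 0" if "k \<noteq> j" for k j
  proof -
    have "conf_cosh (\<eta> k) (a j) (a (- k - j)) = c k"
      using exhaust_3'[of k] exhaust_3'[of j] that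
      by (auto simp: c_def face_cosh_def cyclic_numerals conf_cosh_commute)
    then show ?thesis unfolding q_def face_q_def
      using conf_cosh_derivative_positive[OF a a] c1[of k] by metis
  qed
  have cc: "c (- i - j) = (C i * C j + \<eta> (- i - j)) / (s i * s j)" if "i \<noteq> j" for i j
    using exhaust_3'[of i] exhaust_3'[of j] that
    by (elim disjE) (simp_all add: cyclic_numerals ceq mult.commute)
  \<comment> \<open>The right-hand side does not change when \<open>i\<close> and \<open>j\<close>
    are exchanged, which yields the three symmetry relations.\<close>
  have entry: "- q i j + g i k * q k j =
      (C k * (1 - (\<eta> k)\<^sup>2) + \<eta> i * (C j + \<eta> k * C i) + \<eta> j * (C i + \<eta> k * C j)) /
      (s k * ((C i)\<^sup>2 + (C j)\<^sup>2 + (\<eta> k)\<^sup>2 + 2 * \<eta> k * C i * C j - 1))"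
    if "i \<noteq> j" and k: "k = - i - j" for i j k
  proof -
    have third: "- i - k = j" "- k - j = i" "- j - k = i" "i \<noteq> k" "j \<noteq> k"
      using exhaust_3'[of i] exhaust_3'[of j] that(1) unfolding k
      by (elim disjE, simp_all add: cyclic_numerals)+
    have ck: "c k = (C i * C j + \<eta> k) / (s i * s j)" using cc[OF that(1)] k by simp
    have ci: "c i = (C j * C k + \<eta> i) / (s j * s k)" using cc[OF third(5)] third(3) by simp
    have cj: "c j = (C i * C k + \<eta> j) / (s i * s k)" using cc[OF third(4)] third(1) by simp
    show ?thesis
      unfolding qeq geq third k[symmetric] using conf_cosh_entry_symmetric[OF s2 s2 sn sn sn ci cj ck c2n] .
  qed
  have third: "- 0 - (1::3) = 2" "- 0 - (2::3) = 1" "- 1 - (2::3) = 0" "- 1 - (0::3) = 2" "- 2 - (0::3) = 1" "- 2 - (1::3) = 0"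
    by (simp_all add: cyclic_numerals)
  have sym: "- q 0 1 + g 0 2 * q 2 1 = - q 1 0 + g 1 2 * q 2 0"
      "- q 0 2 + g 0 1 * q 1 2 = - q 2 0 + g 2 1 * q 1 0"
      "- q 1 2 + g 1 0 * q 0 2 = - q 2 1 + g 2 0 * q 0 1"
    using entry[of 0 1 2] entry[of 1 0 2] entry[of 0 2 1] entry[of 2 0 1] entry[of 1 2 0] entry[of 2 1 0] third
    by (simp_all add: ac_simps)
  note pd = product_form_pos_def[OF gpos g01 g02 g12 qpos sym]
  have form: "(\<Sum>i\<in>UNIV. x i * face_arc_deriv \<eta> a i y) =
    (x 0 * ((g 0 1 * q 1 0 + g 0 2 * q 2 0) * y 0 + (- q 0 1 + g 0 2 * q 2 1) * y 1 + (- q 0 2 + g 0 1 * q 1 2) * y 2)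
    + x 1 * ((- q 1 0 + g 1 2 * q 2 0) * y 0 + (g 1 0 * q 0 1 + g 1 2 * q 2 1) * y 1 + (- q 1 2 + g 1 0 * q 0 2) * y 2)
    + x 2 * ((- q 2 0 + g 2 1 * q 1 0) * y 0 + (- q 2 1 + g 2 0 * q 0 1) * y 1 + (g 2 0 * q 0 2 + g 2 1 * q 1 2) * y 2)) / D" for x y
    unfolding sum_3' face_arc_deriv_def face_cosh_deriv_def g_def[symmetric] q_def[symmetric] D_def[symmetric]
    by (simp add: cyclic_numerals algebra_simps add_divide_distrib diff_divide_distrib)
  show "(\<Sum>i\<in>UNIV. x i * face_arc_deriv \<eta> a i y) = (\<Sum>i\<in>UNIV. y i * face_arc_deriv \<eta> a i x)"
    unfolding form sym by (simp add: algebra_simps)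
  show "x i \<noteq> 0 \<Longrightarrow> (\<Sum>i\<in>UNIV. x i * face_arc_deriv \<eta> a i x) > 0"
    unfolding form using exhaust_3'[of i] D by (intro divide_pos_pos pd) auto
qed

section \<open>The curvature map\<close>

lemmas lipschitz_near_intros = lipschitz_near_const lipschitz_near_add lipschitz_near_diff lipschitz_near_minus
  lipschitz_near_mult lipschitz_near_divide lipschitz_near_sqrt lipschitz_near_power lipschitz_near_sin lipschitz_near_cos

text \<open>With \<open>y\<close> a hyperbolic cosine, \<open>y / sqrt (y\<^sup>2 - 1)\<close> is
  the hyperbolic cotangent of an adjacent edge length. It keeps the argument of arcosh above 1,
  where arcosh is smooth, and it blows up as that length tends to 0.\<close>

lemma hexagon_side_argument:
  fixes x y z :: real
  assumes "x > 1" "y > 1" "z > 1"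
  shows "1 < y / sqrt (y\<^sup>2 - 1)" "y / sqrt (y\<^sup>2 - 1) \<le> (x + y * z) / (sqrt (y\<^sup>2 - 1) * sqrt (z\<^sup>2 - 1))"
proof -
  have *: "0 < sqrt (t\<^sup>2 - 1)" "sqrt (t\<^sup>2 - 1) < t" if "t > 1" for t :: real
  proof -
    show "0 < sqrt (t\<^sup>2 - 1)" using that by (simp add: one_less_power)
    have "sqrt (t\<^sup>2 - 1) < sqrt (t\<^sup>2)" by (rule real_sqrt_less_mono) simp
    then show "sqrt (t\<^sup>2 - 1) < t" using that by simp
  qed
  show "1 < y / sqrt (y\<^sup>2 - 1)" using *[OF assms(2)] by simp
  have "y * sqrt (z\<^sup>2 - 1) \<le> x + y * z"
    using *(2)[OF assms(3)] assms mult_left_mono[of "sqrt (z\<^sup>2 - 1)" z y] by linarith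
  then show "y / sqrt (y\<^sup>2 - 1) \<le> (x + y * z) / (sqrt (y\<^sup>2 - 1) * sqrt (z\<^sup>2 - 1))"
    using *[OF assms(2)] *[OF assms(3)] by (simp add: divide_simps mult.commute)
qed

lemma lipschitz_near_arcosh:
  assumes "lipschitz_near z f" "f z > 1"
  shows "lipschitz_near z (\<lambda>x. arcosh (f x :: real))"
proof (rule lipschitz_near_compose[OF assms(1)])
  show "lipschitz_near (f z) arcosh"
  proof (rule lipschitz_near_C1[of "{1<..}" _ arcosh "\<lambda>x. 1 / sqrt (x\<^sup>2 - 1)"])
    show "continuous_on {1<..} (\<lambda>x :: real. 1 / sqrt (x\<^sup>2 - 1))"
      by (intro continuous_intros) (auto simp: power2_eq_1_iff)
    show "(arcosh has_real_derivative 1 / sqrt (x\<^sup>2 - 1)) (at x)" if "x \<in> {1<..}" for x :: real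
      using that by (intro arcosh_real_has_field_derivative) simp
  qed (use assms(2) in auto)
qed

lemma lipschitz_near_hexagon_side:
  fixes x y z :: "'a::metric_space \<Rightarrow> real"
  assumes "lipschitz_near p x" "lipschitz_near p y" "lipschitz_near p z" "x p > 1" "y p > 1" "z p > 1"
  shows "lipschitz_near p (\<lambda>p. hexagon_side (x p) (y p) (z p))"
proof -
  have "(y p)\<^sup>2 > 1" "(z p)\<^sup>2 > 1" using assms by (simp_all add: one_less_power)
  moreover have "1 < (x p + y p * z p) / (sqrt ((y p)\<^sup>2 - 1) * sqrt ((z p)\<^sup>2 - 1))"
    using hexagon_side_argument[OF assms(4-6)] by linarith
  ultimately show ?thesis
    unfolding hexagon_side_def by (intro lipschitz_near_arcosh lipschitz_near_intros assms) auto
qed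

lemma face_arc_deriv_add:
  "face_arc_deriv \<eta> a i (\<lambda>k. u k + v k) = face_arc_deriv \<eta> a i u + face_arc_deriv \<eta> a i v"
  by (simp add: face_arc_deriv_def face_cosh_deriv_def algebra_simps add_divide_distrib diff_divide_distrib)

lemma face_arc_deriv_scale: "face_arc_deriv \<eta> a i (\<lambda>k. c * u k) = c * face_arc_deriv \<eta> a i u"
  by (simp add: face_arc_deriv_def face_cosh_deriv_def algebra_simps)

lemma face_arc_deriv_sum:
  "face_arc_deriv \<eta> a i (\<lambda>k. \<Sum>b\<in>B. u b k) = (\<Sum>b\<in>B. face_arc_deriv \<eta> a i (u b))"
proof (induction B rule: infinite_finite_induct)
  case (insert b B)
  then show ?case by (simp add: face_arc_deriv_add)
qed (simp_all add: face_arc_deriv_def face_cosh_deriv_def)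

lemma face_arc_pos_bound:
  assumes adm: "face_admissible \<eta> a"
  shows "0 \<le> face_arc \<eta> a i"
    "face_cosh \<eta> a (i + 1) / sqrt ((face_cosh \<eta> a (i + 1))\<^sup>2 - 1) \<le> cosh (face_arc \<eta> a i)"
proof -
  have c: "face_cosh \<eta> a k > 1" for k using adm by (simp add: face_admissible_def)
  note arg = hexagon_side_argument[OF c[of i] c[of "i + 1"] c[of "i + 2"]]
  then have "1 \<le> (face_cosh \<eta> a i + face_cosh \<eta> a (i + 1) * face_cosh \<eta> a (i + 2)) /
     (sqrt ((face_cosh \<eta> a (i + 1))\<^sup>2 - 1) * sqrt ((face_cosh \<eta> a (i + 2))\<^sup>2 - 1))" by linarith
  then show "0 \<le> face_arc \<eta> a i"
    "face_cosh \<eta> a (i + 1) / sqrt ((face_cosh \<eta> a (i + 1))\<^sup>2 - 1) \<le> cosh (face_arc \<eta> a i)"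
    using arg(2) by (simp_all add: face_arc_def hexagon_side_def cosh_arcosh_real)
qed

text \<open>For \<open>y = cosh l\<close> the hypothesis bounds coth l by \<open>c\<close>; as
  coth^2 - 1 is the reciprocal of sinh^2, this keeps sinh l away from 0.\<close>

lemma cosh_from_coth_bound:
  fixes y c :: real
  assumes "y > 1" "y / sqrt (y\<^sup>2 - 1) \<le> c" "c > 1"
  shows "sqrt (1 + 1 / (c\<^sup>2 - 1)) \<le> y"
proof -
  have y: "y\<^sup>2 - 1 > 0" and c: "c\<^sup>2 - 1 > 0" using assms by (simp_all add: one_less_power)
  have "y \<le> c * sqrt (y\<^sup>2 - 1)" using assms(2) y by (simp add: divide_le_eq)
  then have "y\<^sup>2 \<le> (c * sqrt (y\<^sup>2 - 1))\<^sup>2" using assms(1) by (intro power_mono) auto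
  also have "\<dots> = c\<^sup>2 * (y\<^sup>2 - 1)" using y by (simp add: power_mult_distrib)
  finally have "c\<^sup>2 \<le> y\<^sup>2 * (c\<^sup>2 - 1)" by (simp add: algebra_simps)
  then have "1 + 1 / (c\<^sup>2 - 1) \<le> y\<^sup>2" using c by (simp add: field_simps)
  then show ?thesis using assms(1) by (simp add: real_le_lsqrt)
qed

section \<open>Edges, faces and boundary components\<close>

lemma edge_class_reverse: "edge_class \<sigma> (reverse x) = edge_class \<sigma> x"
proof -
  have "reverse (reverse x) = x" by (cases x) simp
  then show ?thesis by (auto simp: edge_class_def)
qed

lemma edges_eq_opp_edges: "edges \<sigma> = {opp_edge \<sigma> f k | f k. True}"
proof
  show "{opp_edge \<sigma> f k | f k. True} \<subseteq> edges \<sigma>"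
    unfolding edges_def opp_edge_def ored_edges_def by auto
  show "edges \<sigma> \<subseteq> {opp_edge \<sigma> f k | f k. True}"
  proof
    fix e assume "e \<in> edges \<sigma>"
    then obtain f i j where e: "e = edge_class \<sigma> (f, i, j)" "i \<noteq> j" by (auto simp: edges_def ored_edges_def)
    \<comment> \<open>The three indices add up to 0 in the type \<open>3\<close>, so this is the
      index different from \<open>i\<close> and \<open>j\<close>.\<close>
    define k where "k = - i - j"
    have "(i = k + 1 \<and> j = k + 2) \<or> (j = k + 1 \<and> i = k + 2)"
      unfolding k_def using e(2) exhaust_3'[of i] exhaust_3'[of j]
      by (elim disjE) (simp_all add: cyclic_numerals)
    then have "e = opp_edge \<sigma> f k"
      unfolding e opp_edge_def using edge_class_reverse[of \<sigma> "(f, i, j)"] by auto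
    then show "e \<in> {opp_edge \<sigma> f k | f k. True}" by blast
  qed
qed

locale weighted_triangulation =
  fixes \<sigma> :: "'f::finite ored \<Rightarrow> 'f ored" and bd :: "'f black \<Rightarrow> 'b::finite" and \<eta> :: "'f edge \<Rightarrow> real"
  assumes triangulation: "ideal_triangulation \<sigma> bd"
begin

abbreviation "W \<equiv> admissible \<sigma> bd \<eta>"
abbreviation "K \<equiv> conformal_curvature \<sigma> bd \<eta>"

definition weights :: "'f \<Rightarrow> 3 \<Rightarrow> real" where
  "weights f k = \<eta> (opp_edge \<sigma> f k)"

definition restr :: "real^'b \<Rightarrow> 'f \<Rightarrow> 3 \<Rightarrow> real" where
  "restr \<alpha> f k = \<alpha> $ bd (f, k)"

text \<open>The gluing matches endpoints on adjacent arcs, which have the same label. So all four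
  representatives of an edge join the same unordered pair of components, and the choice made in
  \<open>cosh_length\<close> is harmless because \<open>conf_cosh\<close> is symmetric.\<close>

lemma edge_endpoints:
  assumes "y \<in> edge_class \<sigma> (f, i, j)" "i \<noteq> j" "y = (g, k, m)"
  shows "(bd (g, k) = bd (f, i) \<and> bd (g, m) = bd (f, j)) \<or> (bd (g, k) = bd (f, j) \<and> bd (g, m) = bd (f, i))"
proof -
  have adj: "bd (f, i) = bd (g, k)" if "\<sigma> (f, i, j) = (g, k, m)" "i \<noteq> j" for f i j g k m
  proof -
    have "((f, i), (g, k)) \<in> arc_adjacent \<sigma>" using that unfolding arc_adjacent_def by blast
    then have "((f, i), (g, k)) \<in> (arc_adjacent \<sigma>)\<^sup>*" by (rule r_into_rtrancl)
    then show ?thesis using triangulation unfolding ideal_triangulation_def by simp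
  qed
  have rev: "\<sigma> (f, j, i) = reverse (\<sigma> (f, i, j))" if "i \<noteq> j" for f i j
  proof -
    have "red_gluing \<sigma>" using triangulation by (simp add: ideal_triangulation_def)
    moreover have "(f, i, j) \<in> ored_edges" using that by (simp add: ored_edges_def)
    ultimately have "\<sigma> (reverse (f, i, j)) = reverse (\<sigma> (f, i, j))" unfolding red_gluing_def by blast
    then show ?thesis by simp
  qed
  obtain g' k' m' where s: "\<sigma> (f, i, j) = (g', k', m')" by (rule prod_cases3)
  then have s': "\<sigma> (f, j, i) = (g', m', k')" using rev[OF assms(2)] by simp
  have b: "bd (f, i) = bd (g', k')" "bd (f, j) = bd (g', m')"
    using adj[OF s assms(2)] adj[OF s'] assms(2) by auto
  have "y = (f, i, j) \<or> y = (f, j, i) \<or> y = (g', k', m') \<or> y = (g', m', k')"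
    using assms(1) by (auto simp: edge_class_def s s')
  then show ?thesis using assms(3) b by auto
qed

lemma cosh_length_opp_edge: "cosh_length bd \<eta> \<alpha> (opp_edge \<sigma> f k) = face_cosh (weights f) (restr \<alpha> f) k"
proof -
  let ?e = "opp_edge \<sigma> f k"
  obtain g i j where s: "(SOME x. x \<in> ?e) = (g, i, j)" by (rule prod_cases3)
  have "(f, k + 1, k + 2) \<in> ?e" by (simp add: opp_edge_def edge_class_def)
  then have "(SOME x. x \<in> ?e) \<in> ?e" by (rule someI[where P = "\<lambda>x. x \<in> ?e"])
  then have "(g, i, j) \<in> ?e" by (simp only: s)
  then have "(bd (g, i) = bd (f, k + 1) \<and> bd (g, j) = bd (f, k + 2)) \<or> (bd (g, i) = bd (f, k + 2) \<and> bd (g, j) = bd (f, k + 1))"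
    unfolding opp_edge_def by (rule edge_endpoints) simp_all
  moreover have "cosh_length bd \<eta> \<alpha> ?e = conf_cosh (\<eta> ?e) (\<alpha> $ bd (g, i)) (\<alpha> $ bd (g, j))"
    by (simp only: cosh_length_def s Let_def prod.case conf_cosh_def)
  moreover have "conf_cosh (\<eta> ?e) (\<alpha> $ bd (f, k + 1)) (\<alpha> $ bd (f, k + 2)) = face_cosh (weights f) (restr \<alpha> f) k"
    by (simp only: face_cosh_def weights_def restr_def)
  ultimately show ?thesis by (metis conf_cosh_commute)
qed

lemma surj_bd: obtains f k where "bd (f, k) = b"
proof -
  have "surj bd" using triangulation by (simp add: ideal_triangulation_def)
  then obtain a where "b = bd a" by (rule surjE)
  then show ?thesis using that by (cases a) auto
qed

lemma angle_box_iff: "\<alpha> \<in> angle_box \<longleftrightarrow> (\<forall>f k. 0 < restr \<alpha> f k \<and> restr \<alpha> f k < pi / 2)"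
proof
  assume r: "\<forall>f k. 0 < restr \<alpha> f k \<and> restr \<alpha> f k < pi / 2"
  have "0 < \<alpha> $ b \<and> \<alpha> $ b < pi / 2" for b
  proof -
    obtain f k where "bd (f, k) = b" by (rule surj_bd)
    then show ?thesis using r by (auto simp: restr_def)
  qed
  then show "\<alpha> \<in> angle_box" by (simp add: angle_box_def)
qed (simp add: angle_box_def restr_def)

lemma W_iff: "\<alpha> \<in> W \<longleftrightarrow> (\<forall>f. face_admissible (weights f) (restr \<alpha> f))"
proof -
  have "(\<forall>e\<in>edges \<sigma>. P e) \<longleftrightarrow> (\<forall>f k. P (opp_edge \<sigma> f k))" for P
    unfolding edges_eq_opp_edges by blast
  then have "\<alpha> \<in> W \<longleftrightarrow> \<alpha> \<in> angle_box \<and> (\<forall>f k. face_cosh (weights f) (restr \<alpha> f) k > 1)"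
    by (simp only: admissible_def mem_Collect_eq cosh_length_opp_edge)
  then show ?thesis by (simp only: angle_box_iff face_admissible_def) iprover
qed

lemma face_admissible_iff:
  "face_admissible w a \<longleftrightarrow> (\<forall>k. 0 < a k \<and> a k < pi / 2 \<and> - w k < cos (a (k + 1) + a (k + 2)))"
proof -
  have "face_cosh w a k > 1 \<longleftrightarrow> - w k < cos (a (k + 1) + a (k + 2))"
    if "\<And>k. 0 < a k" "\<And>k. a k < pi / 2" for k
  proof -
    have "sin (a k) > 0" for k using that[of k] by (auto intro: sin_gt_zero)
    then have "0 < sin (a (k + 1)) * sin (a (k + 2))" by simp
    then show ?thesis by (simp add: face_cosh_def conf_cosh_def less_divide_eq cos_add)
      (simp add: algebra_simps less_diff_eq)
  qed
  then show ?thesis unfolding face_admissible_def by (intro iffI allI) auto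
qed

lemma W_eq: "W = (\<Inter>f. \<Inter>k. {\<alpha>. 0 < restr \<alpha> f k} \<inter> {\<alpha>. restr \<alpha> f k < pi / 2} \<inter>
    {\<alpha>. - weights f k < cos (restr \<alpha> f (k + 1) + restr \<alpha> f (k + 2))})"
  unfolding set_eq_iff W_iff face_admissible_iff by auto

lemma open_W: "open W"
  unfolding W_eq restr_def
  by (intro open_INT finite ballI open_Int open_Collect_less continuous_intros)

text \<open>The sums of two angles lie between 0 and pi, where cosine decreases but is not concave.
  A convex combination is therefore compared with the larger of the two sums, at which the
  constraint still holds.\<close>

lemma convex_W: "convex W"
proof (rule convexI)
  fix \<alpha> \<beta> and u v :: real
  assume ab: "\<alpha> \<in> W" "\<beta> \<in> W" and uv: "0 \<le> u" "0 \<le> v" "u + v = 1"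
  have r: "restr (u *\<^sub>R \<alpha> + v *\<^sub>R \<beta>) f k = u * restr \<alpha> f k + v * restr \<beta> f k" for f k
    by (simp add: restr_def)
  have conv: "u * x + v * y < z" if "x < z" "y < z" for x y z :: real
    using convex_bound_lt[OF that uv] .
  have "face_admissible (weights f) (restr (u *\<^sub>R \<alpha> + v *\<^sub>R \<beta>) f)" for f
    unfolding face_admissible_iff
  proof
    fix k
    have A: "0 < restr \<alpha> f k" "restr \<alpha> f k < pi / 2" "- weights f k < cos (restr \<alpha> f (k + 1) + restr \<alpha> f (k + 2))" for k
      using ab(1) by (auto simp: W_iff face_admissible_iff)
    have B: "0 < restr \<beta> f k" "restr \<beta> f k < pi / 2" "- weights f k < cos (restr \<beta> f (k + 1) + restr \<beta> f (k + 2))" for k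
      using ab(2) by (auto simp: W_iff face_admissible_iff)
    define p where "p = restr \<alpha> f (k + 1) + restr \<alpha> f (k + 2)"
    define q where "q = restr \<beta> f (k + 1) + restr \<beta> f (k + 2)"
    have p: "0 \<le> p" "p \<le> pi" and q: "0 \<le> q" "q \<le> pi"
      unfolding p_def q_def using A(1,2)[of "k + 1"] A(1,2)[of "k + 2"] B(1,2)[of "k + 1"] B(1,2)[of "k + 2"] by linarith+
    have "u * p + v * q \<le> max p q" using convex_bound_le[of p "max p q" q u v] uv by simp
    moreover have "0 \<le> u * p + v * q" using p q uv by simp
    ultimately have "cos (max p q) \<le> cos (u * p + v * q)"
      using p q by (intro cos_monotone_0_pi_le) auto
    moreover have "- weights f k < cos (max p q)" using A(3)[of k] B(3)[of k] by (simp add: p_def q_def max_def)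
    ultimately have "- weights f k < cos (u * p + v * q)" by linarith
    moreover have "u * p + v * q = restr (u *\<^sub>R \<alpha> + v *\<^sub>R \<beta>) f (k + 1) + restr (u *\<^sub>R \<alpha> + v *\<^sub>R \<beta>) f (k + 2)"
      by (simp add: r p_def q_def algebra_simps)
    moreover have "- (u * restr \<alpha> f k + v * restr \<beta> f k) < 0"
      using conv[of "- restr \<alpha> f k" 0 "- restr \<beta> f k"] A(1)[of k] B(1)[of k] by simp
    ultimately show "0 < restr (u *\<^sub>R \<alpha> + v *\<^sub>R \<beta>) f k \<and> restr (u *\<^sub>R \<alpha> + v *\<^sub>R \<beta>) f k < pi / 2 \<and>
      - weights f k < cos (restr (u *\<^sub>R \<alpha> + v *\<^sub>R \<beta>) f (k + 1) + restr (u *\<^sub>R \<alpha> + v *\<^sub>R \<beta>) f (k + 2))"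
      using conv[OF A(2)[of k] B(2)[of k]] by (simp add: r)
  qed
  then show "u *\<^sub>R \<alpha> + v *\<^sub>R \<beta> \<in> W" by (simp add: W_iff)
qed

lemma curvature_eq:
  assumes "\<alpha> \<in> W"
  shows "K \<alpha> = (\<chi> b. \<Sum>(f, i) | bd (f, i) = b. face_arc (weights f) (restr \<alpha> f) i)"
proof -
  have "arc_length \<sigma> (conformal_metric bd \<eta> \<alpha>) (f, i) = face_arc (weights f) (restr \<alpha> f) i" for f i
  proof -
    let ?c = "face_cosh (weights f) (restr \<alpha> f)"
    have c: "?c k > 1" for k using assms by (auto simp: W_iff face_admissible_def)
    have "arc_length \<sigma> (conformal_metric bd \<eta> \<alpha>) (f, i) = black_lengths (\<lambda>k. arcosh (?c k)) i"
      by (simp add: arc_length_def conformal_metric_def cosh_length_opp_edge)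
    also have "\<dots> = face_arc (weights f) (restr \<alpha> f) i"
    proof (subst black_lengths_eq)
      show "arcosh (?c k) > 0" for k
        using c[of k] arcosh_real_strict_mono[of 1 "?c k"] by simp
      show "arcosh ((cosh (arcosh (?c i)) + cosh (arcosh (?c (i + 1))) * cosh (arcosh (?c (i + 2)))) /
         (sinh (arcosh (?c (i + 1))) * sinh (arcosh (?c (i + 2))))) = face_arc (weights f) (restr \<alpha> f) i"
        unfolding face_arc_def hexagon_side_def using c
        by (simp add: cosh_arcosh_real sinh_arcosh_real less_imp_le)
    qed
    finally show ?thesis .
  qed
  then show ?thesis
    by (simp add: conformal_curvature_def curvature_def vec_eq_iff) (auto intro!: sum.cong)
qed

text \<open>A face may meet one boundary component at several of its corners, so column
  \<open>b'\<close> applies the face derivative to the indicator of all corners on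
  \<open>b'\<close>.\<close>

definition curvature_matrix :: "real^'b \<Rightarrow> real^'b^'b" where
  "curvature_matrix \<alpha> = (\<chi> b b'. \<Sum>(f, i) | bd (f, i) = b.
     face_arc_deriv (weights f) (restr \<alpha> f) i (\<lambda>k. if bd (f, k) = b' then 1 else 0))"

lemma curvature_matrix_mult:
  "(curvature_matrix \<alpha> *v h) $ b = (\<Sum>(f, i) | bd (f, i) = b. face_arc_deriv (weights f) (restr \<alpha> f) i (restr h f))"
proof -
  let ?d = "\<lambda>b' f k. if bd (f, k) = b' then 1 else 0 :: real"
  have "(curvature_matrix \<alpha> *v h) $ b =
    (\<Sum>b'\<in>UNIV. \<Sum>(f, i) | bd (f, i) = b. h $ b' * face_arc_deriv (weights f) (restr \<alpha> f) i (?d b' f))"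
    by (simp add: curvature_matrix_def matrix_vector_mult_def sum_distrib_left mult.commute case_prod_beta)
  also have "\<dots> = (\<Sum>(f, i) | bd (f, i) = b. \<Sum>b'\<in>UNIV. h $ b' * face_arc_deriv (weights f) (restr \<alpha> f) i (?d b' f))"
    unfolding case_prod_beta by (rule sum.swap)
  also have "\<dots> = (\<Sum>(f, i) | bd (f, i) = b. face_arc_deriv (weights f) (restr \<alpha> f) i (restr h f))"
  proof (intro sum.cong refl, clarify)
    fix f i
    have "restr h f = (\<lambda>k. \<Sum>b'\<in>UNIV. h $ b' * ?d b' f k)"
      by (simp add: restr_def fun_eq_iff if_distrib cong: if_cong)
    then show "(\<Sum>b'\<in>UNIV. h $ b' * face_arc_deriv (weights f) (restr \<alpha> f) i (?d b' f)) =
       face_arc_deriv (weights f) (restr \<alpha> f) i (restr h f)"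
      by (simp only: face_arc_deriv_sum face_arc_deriv_scale)
  qed
  finally show ?thesis .
qed

text \<open>The sum over components and their arcs is regrouped by faces: the form is the sum of the
  face forms pulled back along \<open>restr\<close>, so symmetry and semidefiniteness can be checked
  face by face.\<close>

lemma inner_curvature_matrix:
  "g \<bullet> (curvature_matrix \<alpha> *v h) =
    (\<Sum>f\<in>UNIV. \<Sum>i\<in>UNIV. restr g f i * face_arc_deriv (weights f) (restr \<alpha> f) i (restr h f))"
proof -
  let ?F = "\<lambda>a. case a of (f, i) \<Rightarrow> face_arc_deriv (weights f) (restr \<alpha> f) i (restr h f)"
  have "g \<bullet> (curvature_matrix \<alpha> *v h) = (\<Sum>b\<in>UNIV. \<Sum>a | a \<in> UNIV \<and> bd a = b. g $ bd a * ?F a)"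
    unfolding inner_vec_def curvature_matrix_mult
    by (auto intro!: sum.cong simp: sum_distrib_left case_prod_beta)
  also have "\<dots> = (\<Sum>a\<in>UNIV. g $ bd a * ?F a)" by (rule sum.group) auto
  also have "\<dots> = (\<Sum>(f, i)\<in>UNIV \<times> UNIV. restr g f i * face_arc_deriv (weights f) (restr \<alpha> f) i (restr h f))"
    by (auto intro!: sum.cong simp: restr_def)
  finally show ?thesis by (simp only: sum.cartesian_product)
qed

lemma curvature_matrix_symmetric:
  assumes "\<alpha> \<in> W"
  shows "transpose (curvature_matrix \<alpha>) = curvature_matrix \<alpha>"
proof -
  have "g \<bullet> (curvature_matrix \<alpha> *v h) = h \<bullet> (curvature_matrix \<alpha> *v g)" for g h
    unfolding inner_curvature_matrix using assms
    by (intro sum.cong refl face_form_symmetric) (simp add: W_iff)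
  from this[of "axis i 1" "axis j 1" for i j] show ?thesis
    by (simp add: vec_eq_iff transpose_def inner_axis' matrix_vector_mul_component inner_axis)
qed

text \<open>Every component carries an arc of some face, so a nonzero vector is seen by at least one
  face; that face contributes strictly and the others are nonnegative.\<close>

lemma curvature_matrix_pos_def:
  assumes "\<alpha> \<in> W" "h \<noteq> 0"
  shows "h \<bullet> (curvature_matrix \<alpha> *v h) > 0"
proof -
  obtain b where "h $ b \<noteq> 0" using assms(2) by (auto simp: vec_eq_iff)
  moreover obtain f k where "bd (f, k) = b" by (rule surj_bd)
  ultimately have fk: "restr h f k \<noteq> 0" by (simp add: restr_def)
  let ?S = "\<lambda>f. \<Sum>i\<in>UNIV. restr h f i * face_arc_deriv (weights f) (restr \<alpha> f) i (restr h f)"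
  have adm: "face_admissible (weights f) (restr \<alpha> f)" for f using assms(1) by (simp add: W_iff)
  have "?S g \<ge> 0" for g
  proof (cases "\<exists>k. restr h g k \<noteq> 0")
    case True
    then show ?thesis using face_form_pos_def[OF adm] by (meson less_imp_le)
  qed simp
  moreover have "?S f > 0" by (rule face_form_pos_def[where x = "restr h f" and i = k, OF adm fk])
  ultimately show ?thesis unfolding inner_curvature_matrix
    by (intro sum_pos2[of UNIV f]) auto
qed

lemma curvature_has_derivative:
  assumes "\<alpha> \<in> W"
  shows "(K has_derivative (\<lambda>h. curvature_matrix \<alpha> *v h)) (at \<alpha>)"
proof -
  let ?K = "\<lambda>\<alpha>. \<chi> b. \<Sum>(f, i) | bd (f, i) = b. face_arc (weights f) (restr \<alpha> f) i"
  have r: "((\<lambda>\<alpha>. restr \<alpha> f k) has_derivative (\<lambda>h. restr h f k)) (at \<alpha>)" for f k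
    unfolding restr_def by (rule bounded_linear_imp_has_derivative) (rule bounded_linear_vec_nth)
  have "(?K has_derivative (\<lambda>h. curvature_matrix \<alpha> *v h)) (at \<alpha>)"
  proof (subst has_derivative_componentwise_within, intro ballI)
    fix v :: "real^'b" assume "v \<in> Basis"
    then obtain b where v: "v = axis b 1" by (auto simp: Basis_vec_def)
    have "((\<lambda>\<alpha>. \<Sum>(f, i) | bd (f, i) = b. face_arc (weights f) (restr \<alpha> f) i) has_derivative
       (\<lambda>h. \<Sum>(f, i) | bd (f, i) = b. face_arc_deriv (weights f) (restr \<alpha> f) i (restr h f))) (at \<alpha>)"
      unfolding case_prod_beta using assms
      by (intro has_derivative_sum face_arc_has_derivative r) (simp add: W_iff)
    then show "((\<lambda>x. ?K x \<bullet> v) has_derivative (\<lambda>h. (curvature_matrix \<alpha> *v h) \<bullet> v)) (at \<alpha>)"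
      by (simp add: v inner_axis curvature_matrix_mult)
  qed
  then show ?thesis
    by (rule has_derivative_transform_within_open[OF _ open_W assms]) (simp add: curvature_eq)
qed

lemma jacobian_curvature:
  assumes "\<alpha> \<in> W"
  shows "jacobian K (at \<alpha>) = curvature_matrix \<alpha>"
  using frechet_derivative_at[OF curvature_has_derivative[OF assms]]
  by (simp add: jacobian_def) (metis matrix_of_matrix_vector_mul)

lemma lipschitz_near_face:
  assumes "\<alpha> \<in> W"
  shows "lipschitz_near \<alpha> (\<lambda>\<alpha>. face_cosh (weights f) (restr \<alpha> f) k)"
    and "lipschitz_near \<alpha> (\<lambda>\<alpha>. face_arc (weights f) (restr \<alpha> f) i)"
    and "lipschitz_near \<alpha> (\<lambda>\<alpha>. face_arc_deriv (weights f) (restr \<alpha> f) i u)"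
proof -
  have adm: "face_admissible (weights f) (restr \<alpha> f)" using assms by (simp add: W_iff)
  have c: "face_cosh (weights f) (restr \<alpha> f) k > 1" for k using adm by (simp add: face_admissible_def)
  have c2: "(face_cosh (weights f) (restr \<alpha> f) k)\<^sup>2 - 1 \<noteq> 0" for k
    using one_less_power[OF c, of 2 k] by simp
  have r: "lipschitz_near \<alpha> (\<lambda>\<alpha>. restr \<alpha> f k)" for k unfolding restr_def by (rule lipschitz_near_nth)
  have s: "sin (restr \<alpha> f k) \<noteq> 0" for k
  proof -
    have "0 < restr \<alpha> f k" "restr \<alpha> f k < pi / 2" using adm by (auto simp: face_admissible_def)
    then show ?thesis using sin_gt_zero[of "restr \<alpha> f k"] by auto
  qed
  show cosh: "lipschitz_near \<alpha> (\<lambda>\<alpha>. face_cosh (weights f) (restr \<alpha> f) k)" for k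
    unfolding face_cosh_def conf_cosh_def by (intro lipschitz_near_intros r) (simp add: s)
  show "lipschitz_near \<alpha> (\<lambda>\<alpha>. face_arc (weights f) (restr \<alpha> f) i)"
    unfolding face_arc_def by (intro lipschitz_near_hexagon_side cosh c)
  have q: "lipschitz_near \<alpha> (\<lambda>\<alpha>. face_q (weights f) (restr \<alpha> f) k j)" for k j
    unfolding face_q_def by (intro lipschitz_near_intros r) (simp add: s)
  have g: "lipschitz_near \<alpha> (\<lambda>\<alpha>. face_g (weights f) (restr \<alpha> f) k j)" for k j
    unfolding face_g_def by (intro lipschitz_near_intros cosh) (rule c2)
  have D: "lipschitz_near \<alpha> (\<lambda>\<alpha>. face_disc (weights f) (restr \<alpha> f))"
    unfolding face_disc_def by (intro lipschitz_near_intros cosh)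
  have dc: "lipschitz_near \<alpha> (\<lambda>\<alpha>. face_cosh_deriv (weights f) (restr \<alpha> f) k u)" for k
    unfolding face_cosh_deriv_def by (intro lipschitz_near_intros q)
  show "lipschitz_near \<alpha> (\<lambda>\<alpha>. face_arc_deriv (weights f) (restr \<alpha> f) i u)"
    unfolding face_arc_deriv_def using face_disc_pos[OF adm]
    by (intro lipschitz_near_intros q g D dc) simp_all
qed

lemma lipschitz_near_curvature:
  assumes "\<alpha> \<in> W"
  shows "lipschitz_near \<alpha> K" "lipschitz_near \<alpha> curvature_matrix"
proof -
  have "lipschitz_near \<alpha> (\<lambda>\<alpha>. \<chi> b. \<Sum>(f, i) | bd (f, i) = b. face_arc (weights f) (restr \<alpha> f) i)"
    by (rule lipschitz_near_vec) (simp add: case_prod_beta lipschitz_near_sum lipschitz_near_face[OF assms])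
  then show "lipschitz_near \<alpha> K"
    by (rule lipschitz_near_cong[OF _ open_W assms]) (simp add: curvature_eq)
  show "lipschitz_near \<alpha> curvature_matrix"
    unfolding curvature_matrix_def
    by (intro lipschitz_near_vec) (simp add: case_prod_beta lipschitz_near_sum lipschitz_near_face[OF assms])
qed

text \<open>A bound on the curvature keeps all edge lengths away from 0, as \<open>cosh \<theta> \<ge> coth l\<close> for the arcs adjacent to an edge.\<close>

lemma closure_bounded_curvature:
  assumes T: "T \<subseteq> W" and bound: "\<And>\<alpha>. \<alpha> \<in> T \<Longrightarrow> norm (K \<alpha>) \<le> M"
  shows "closure T \<inter> angle_box \<subseteq> W"
proof -
  \<comment> \<open>The summand 1 gives \<open>c > 1\<close> even if \<open>M = 0\<close>, so that
    \<open>c\<^sup>2 - 1\<close> may be divided by.\<close>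
  define c where "c = cosh M + 1"
  have c: "c > 1" unfolding c_def by (simp add: cosh_real_pos)
  define y0 where "y0 = sqrt (1 + 1 / (c\<^sup>2 - 1))"
  have "c\<^sup>2 > 1" using c by (simp add: one_less_power)
  then have y0: "y0 > 1" by (simp add: y0_def)
  have lower: "y0 \<le> face_cosh (weights f) (restr \<alpha> f) k" if "\<alpha> \<in> T" for \<alpha> f k
  proof -
    have aW: "\<alpha> \<in> W" using that T by blast
    then have adm: "face_admissible (weights f) (restr \<alpha> f)" for f by (simp add: W_iff)
    \<comment> \<open>The arc whose successor is \<open>k\<close>, so that
      \<open>face_arc_pos_bound\<close> compares it with the edge \<open>k\<close>.\<close>
    define i where "i = k + 2"
    have ik: "i + 1 = k" using exhaust_3'[of k] by (auto simp: i_def cyclic_numerals)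
    have set_eq: "{(f, i). bd (f, i) = b} = {a. bd a = b}" for b by auto
    have "face_arc (weights f) (restr \<alpha> f) i \<le> K \<alpha> $ bd (f, i)"
      unfolding curvature_eq[OF aW] vec_lambda_beta set_eq
      using member_le_sum[of "(f, i)" "{a. bd a = bd (f, i)}" "\<lambda>a. case a of (f, i) \<Rightarrow> face_arc (weights f) (restr \<alpha> f) i"]
        face_arc_pos_bound(1)[OF adm] by (auto simp: case_prod_beta)
    also have "\<dots> \<le> M"
      using bound[OF that] component_le_norm_cart[of "K \<alpha>" "bd (f, i)"] by linarith
    finally have le: "face_arc (weights f) (restr \<alpha> f) i \<le> M" .
    have ge: "0 \<le> face_arc (weights f) (restr \<alpha> f) i" by (rule face_arc_pos_bound(1)[OF adm])
    have "cosh (face_arc (weights f) (restr \<alpha> f) i) \<le> cosh M"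
      using le ge order_trans[OF ge le] by (simp add: cosh_real_nonneg_le_iff)
    then have "face_cosh (weights f) (restr \<alpha> f) k / sqrt ((face_cosh (weights f) (restr \<alpha> f) k)\<^sup>2 - 1) \<le> c"
      using face_arc_pos_bound(2)[OF adm, of f i] unfolding ik c_def by linarith
    then show ?thesis unfolding y0_def using adm c
      by (intro cosh_from_coth_bound) (auto simp: face_admissible_def)
  qed
  \<comment> \<open>The bound \<open>y0 > 1\<close> is the same for all points of \<open>T\<close>
    and passes to limits inside the box, where no sine vanishes; a mere lower bound 1 would allow
    equality in the limit.\<close>
  have "y0 \<le> face_cosh (weights f) (restr z f) k" if z: "z \<in> closure T" "z \<in> angle_box" for z f k
  proof -
    obtain x where x: "\<And>n. x n \<in> T" "x \<longlonglongrightarrow> z" using z(1) by (auto simp: closure_sequential)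
    have r: "(\<lambda>n. restr (x n) f k) \<longlonglongrightarrow> restr z f k" for k
      unfolding restr_def by (intro tendsto_vec_nth x)
    have box: "0 < restr z f k" "restr z f k < pi / 2" for k using z(2) by (auto simp: angle_box_iff)
    have "sin (restr z f k) > 0" for k using box[of k] by (intro sin_gt_zero) linarith+
    then have "sin (restr z f k) \<noteq> 0" for k by (metis less_irrefl)
    then have "(\<lambda>n. face_cosh (weights f) (restr (x n) f) k) \<longlonglongrightarrow> face_cosh (weights f) (restr z f) k"
      unfolding face_cosh_def conf_cosh_def by (intro tendsto_intros r) simp
    then show ?thesis by (rule LIMSEQ_le_const) (use lower x(1) in blast)
  qed
  then have "1 < face_cosh (weights f) (restr z f) k" if "z \<in> closure T" "z \<in> angle_box" for z f k
    using that y0 less_le_trans by blast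
  then show ?thesis by (auto simp: W_iff face_admissible_def angle_box_iff)
qed

end

section \<open>The flows\<close>

lemma norm_matrix_vector_mult_le: "norm (A *v x) \<le> norm A * norm (x :: real^'n)" for A :: "real^'n^'m"
proof -
  have "norm (A *v x) \<le> L2_set (\<lambda>i. norm (A $ i) * norm x) UNIV"
    unfolding norm_vec_def[of "A *v x"]
    by (rule L2_set_mono) (auto simp: matrix_vector_mul_component Cauchy_Schwarz_ineq2)
  then show ?thesis by (simp add: L2_set_left_distrib norm_vec_def[of A])
qed

lemma bounded_bilinear_matrix_vector_mult: "bounded_bilinear ((*v) :: real^'n^'m \<Rightarrow> real^'n \<Rightarrow> real^'m)"
proof
  show "\<exists>K. \<forall>(A :: real^'n^'m) x. norm (A *v x) \<le> norm A * norm x * K"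
    by (rule exI[of _ 1]) (simp add: norm_matrix_vector_mult_le)
qed (simp_all add: matrix_vector_mult_add_rdistrib matrix_vector_right_distrib
      matrix_vector_mult_scaleR scaleR_matrix_vector_assoc)

lemma minus_matrix_vector_mult: "(- A) *v x = - (A *v x)" for A :: "real^'n^'m"
  by (simp add: matrix_vector_mult_def vec_eq_iff sum_negf)

lemma matrix_vector_mult_minus: "A *v (- x) = - (A *v x)" for A :: "real^'n^'m"
  by (simp add: matrix_vector_mult_def vec_eq_iff sum_negf)

lemma rayleigh_bounds_perturb:
  fixes A B :: "real^'n^'n"
  assumes A: "A \<in> rayleigh_bounds m M" and B: "transpose B = B" and AB: "norm (B - A) \<le> e"
  shows "B \<in> rayleigh_bounds (m - e) (M + e)"
proof -
  have "(m - e) * (norm x)\<^sup>2 \<le> x \<bullet> (B *v x) \<and> x \<bullet> (B *v x) \<le> (M + e) * (norm x)\<^sup>2" for x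
  proof -
    have "\<bar>x \<bullet> ((B - A) *v x)\<bar> \<le> norm x * (norm (B - A) * norm x)"
      using Cauchy_Schwarz_ineq2[of x "(B - A) *v x"] norm_matrix_vector_mult_le[of "B - A" x]
      by (meson mult_left_mono norm_ge_zero order_trans)
    also have "\<dots> = norm (B - A) * (norm x)\<^sup>2" by (simp add: power2_eq_square)
    also have "\<dots> \<le> e * (norm x)\<^sup>2" using AB by (rule mult_right_mono) simp
    finally have "\<bar>x \<bullet> (B *v x) - x \<bullet> (A *v x)\<bar> \<le> e * (norm x)\<^sup>2"
      by (simp add: matrix_vector_mult_diff_rdistrib inner_diff_right)
    moreover have "m * (norm x)\<^sup>2 \<le> x \<bullet> (A *v x)" "x \<bullet> (A *v x) \<le> M * (norm x)\<^sup>2"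
      using A by (auto simp: rayleigh_bounds_def)
    ultimately show ?thesis unfolding left_diff_distrib distrib_right by linarith
  qed
  then show ?thesis using B by (simp add: rayleigh_bounds_def)
qed

text \<open>Poincare lemma: integrate the field along the segments from a base point. By symmetry of
  the Jacobian, the gradient of the integrand in \<open>x\<close> is the derivative in
  \<open>t\<close> of \<open>t *\<^sub>R F (c x t)\<close>, and that integrates to
  \<open>F x\<close>.\<close>

lemma symmetric_jacobian_potential:
  fixes F :: "real^'n \<Rightarrow> real^'n" and A :: "real^'n \<Rightarrow> real^'n^'n"
  assumes W: "open W" "convex W"
    and F: "\<And>x. x \<in> W \<Longrightarrow> (F has_derivative (\<lambda>h. A x *v h)) (at x)"
    and sym: "\<And>x. x \<in> W \<Longrightarrow> transpose (A x) = A x" and cont: "continuous_on W A"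
  shows "\<exists>\<Phi>. \<forall>x\<in>W. GDERIV \<Phi> x :> F x"
proof (cases "W = {}")
  case False
  then obtain p where p: "p \<in> W" by blast
  define c where "c x t = p + t *\<^sub>R (x - p)" for x and t :: real
  have c: "c x t \<in> W" if "x \<in> W" "t \<in> {0..1}" for x t
  proof -
    have "c x t = (1 - t) *\<^sub>R p + t *\<^sub>R x" by (simp add: c_def algebra_simps)
    then show ?thesis using convexD[OF W(2) p that(1), of "1 - t" t] that(2) by simp
  qed
  \<comment> \<open>The derivative of \<open>t *\<^sub>R F (c x t)\<close> in \<open>t\<close>;
    below it also turns out to be the gradient of the integrand in \<open>x\<close>.\<close>
  define G where "G x t = F (c x t) + t *\<^sub>R (A (c x t) *v (x - p))" for x t
  have contF: "continuous_on W F"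
    using F by (intro has_derivative_continuous_on) (rule has_derivative_at_withinI)
  have contG: "continuous_on (W \<times> {0..1}) (\<lambda>(x, t). G x t)"
    unfolding G_def c_def case_prod_beta
    by (intro continuous_intros bounded_bilinear.continuous_on[OF bounded_bilinear_matrix_vector_mult]
        continuous_on_compose2[OF contF] continuous_on_compose2[OF cont])
      (use c in \<open>auto simp: c_def\<close>)
  have symA: "(A x *v h) \<bullet> v = h \<bullet> (A x *v v)" if "x \<in> W" for x h v
    using inner_transpose_mult[of h "A x" v] sym[OF that] by simp
  define \<Phi> where "\<Phi> x = integral (cbox 0 1) (\<lambda>t. F (c x t) \<bullet> (x - p))" for x
  have "GDERIV \<Phi> x :> F x" if x: "x \<in> W" for x
  proof -
    have contGx: "continuous_on {0..1} (G x)"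
    proof -
      have "continuous_on {0..1} (\<lambda>t. (x, t :: real))"
        by (intro continuous_on_Pair continuous_on_const continuous_on_id)
      from continuous_on_compose2[OF contG this] show ?thesis using x by auto
    qed
    have der: "(\<Phi> has_derivative integral (cbox 0 1) (\<lambda>t. blinfun_inner_right (G x t))) (at x within W)"
      unfolding \<Phi>_def
    proof (rule leibniz_rule[where fx = "\<lambda>x t. blinfun_inner_right (G x t)"])
      fix y t assume y: "y \<in> W" and t: "t \<in> cbox (0::real) 1"
      have t': "t \<in> {0..1}" using t by simp
      have dc: "((\<lambda>y. c y t) has_derivative (\<lambda>h. t *\<^sub>R h)) (at y within W)"
        unfolding c_def by (auto intro!: derivative_eq_intros)
      have dF: "((\<lambda>y. F (c y t)) has_derivative (\<lambda>h. A (c y t) *v (t *\<^sub>R h))) (at y within W)"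
        by (rule has_derivative_compose[OF dc F[OF c[OF y t']]])
      have dp: "((\<lambda>y. y - p) has_derivative (\<lambda>h. h)) (at y within W)"
        by (auto intro!: derivative_eq_intros)
      show "((\<lambda>y. F (c y t) \<bullet> (y - p)) has_derivative blinfun_apply (blinfun_inner_right (G y t))) (at y within W)"
      proof (rule has_derivative_eq_rhs[OF has_derivative_inner[OF dF dp]], rule ext)
        fix h
        have "(A (c y t) *v h) \<bullet> (y - p) = (A (c y t) *v (y - p)) \<bullet> h"
          using symA[OF c[OF y t'], of h "y - p"] by (simp only: inner_commute)
        then show "F (c y t) \<bullet> h + (A (c y t) *v (t *\<^sub>R h)) \<bullet> (y - p) = blinfun_apply (blinfun_inner_right (G y t)) h"
          unfolding G_def blinfun_inner_right.rep_eq inner_add_left matrix_vector_mult_scaleR by simp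
      qed
    next
      fix y assume y: "y \<in> W"
      have "continuous_on {0..1} (\<lambda>t. F (c y t) \<bullet> (y - p))"
        unfolding c_def by (intro continuous_intros continuous_on_compose2[OF contF]) (use c[OF y] in \<open>auto simp: c_def\<close>)
      then show "(\<lambda>t. F (c y t) \<bullet> (y - p)) integrable_on cbox 0 1"
        by (simp add: integrable_continuous_real)
    next
      have "continuous_on (W \<times> {0..1}) (\<lambda>z. blinfun_inner_right ((\<lambda>(x, t). G x t) z))"
        by (rule bounded_linear.continuous_on[OF bounded_linear_blinfun_inner_right contG])
      then show "continuous_on (W \<times> cbox 0 1) (\<lambda>(x, t). blinfun_inner_right (G x t))"
        by (simp add: case_prod_beta')
    qed (use x W in auto)
    have "integral (cbox 0 1) (\<lambda>t. blinfun_inner_right (G x t)) = blinfun_inner_right (integral (cbox 0 1) (G x))"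
      using integral_linear[OF _ bounded_linear_blinfun_inner_right, of "G x" "cbox 0 1"] contGx
      by (simp add: integrable_continuous_real o_def)
    also have "integral (cbox 0 1) (G x) = F x"
    proof -
      have "(G x has_integral 1 *\<^sub>R F (c x 1) - 0 *\<^sub>R F (c x 0)) {0..1}"
      proof (rule fundamental_theorem_of_calculus)
        fix t :: real assume t: "t \<in> {0..1}"
        have dc: "((\<lambda>t. c x t) has_derivative (\<lambda>h. h *\<^sub>R (x - p))) (at t within {0..1})"
          unfolding c_def by (auto intro!: derivative_eq_intros)
        have dF: "((\<lambda>t. F (c x t)) has_derivative (\<lambda>h. A (c x t) *v (h *\<^sub>R (x - p)))) (at t within {0..1})"
          by (rule has_derivative_compose[OF dc F[OF c[OF x t]]])
        have dt: "((\<lambda>t :: real. t) has_derivative (\<lambda>h. h)) (at t within {0..1})" by (rule has_derivative_ident)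
        show "((\<lambda>t. t *\<^sub>R F (c x t)) has_vector_derivative G x t) (at t within {0..1})"
          unfolding has_vector_derivative_def
          by (rule has_derivative_eq_rhs[OF has_derivative_scaleR[OF dt dF]])
            (simp add: fun_eq_iff G_def matrix_vector_mult_scaleR algebra_simps)
      qed simp
      then show ?thesis by (simp add: c_def integral_unique)
    qed
    finally have "(\<Phi> has_derivative blinfun_apply (blinfun_inner_right (F x))) (at x within W)"
      using der by simp
    then show ?thesis using at_within_open[OF x W(1)]
      unfolding gderiv_def by (simp add: inner_commute[of _ "F x"])
  qed
  then show ?thesis by blast
qed simp

lemma flow_solution_cong:
  assumes "\<And>x. x \<in> W \<Longrightarrow> V x = V' x"
  shows "flow_solution W V = flow_solution W V'"
  using assms unfolding flow_solution_def fun_eq_iff by (metis (no_types, lifting))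

context weighted_triangulation
begin

section \<open>The fractional flows on the admissible space\<close>

lemma frac_calabi_field_eq:
  assumes "\<alpha> \<in> W"
  shows "frac_calabi_field s K Kbar \<alpha> = - (matrix_powr (curvature_matrix \<alpha>) s *v (K \<alpha> - Kbar))"
  using assms by (simp add: frac_calabi_field_def frac_laplacian_def jacobian_curvature minus_matrix_vector_mult)

lemma ricci_calabi_frac:
  assumes "\<alpha> \<in> W"
  shows "ricci_field K Kbar \<alpha> = frac_calabi_field 0 K Kbar \<alpha>"
    and "calabi_field K Kbar \<alpha> = frac_calabi_field 1 K Kbar \<alpha>"
  using matrix_powr_0_1[OF curvature_matrix_symmetric[OF assms] curvature_matrix_pos_def[OF assms]]
  by (simp_all add: frac_calabi_field_eq[OF assms] ricci_field_def calabi_field_def laplacian_def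
      jacobian_curvature[OF assms] minus_matrix_vector_mult)

text \<open>The fields are shown to coincide on the admissible space only, so the solution
  predicates are identified and not the fields.\<close>

lemma flow_fields_frac:
  assumes "V \<in> {ricci_field K Kbar, calabi_field K Kbar, frac_calabi_field s K Kbar}"
  obtains s' where "flow_solution W V = flow_solution W (frac_calabi_field s' K Kbar)"
  using assms
proof (elim insertE emptyE)
  assume "V = ricci_field K Kbar"
  then show thesis by (intro that[of 0] flow_solution_cong) (simp add: ricci_calabi_frac)
next
  assume "V = calabi_field K Kbar"
  then show thesis by (intro that[of 1] flow_solution_cong) (simp add: ricci_calabi_frac)
qed (use that in blast)

lemma curvature_matrix_rayleigh:
  assumes "\<alpha> \<in> W"
  obtains m M where "m > 0" "curvature_matrix \<alpha> \<in> rayleigh_bounds m M"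
  using rayleigh_bounds_exist[OF curvature_matrix_symmetric[OF assms] curvature_matrix_pos_def[OF assms]] .

lemma energy_has_derivative:
  assumes "\<alpha> \<in> W"
  shows "((\<lambda>\<alpha>. (K \<alpha> - Kbar) \<bullet> (K \<alpha> - Kbar)) has_derivative
    (\<lambda>h. 2 * ((K \<alpha> - Kbar) \<bullet> (curvature_matrix \<alpha> *v h)))) (at \<alpha>)"
proof -
  have "((\<lambda>\<alpha>. K \<alpha> - Kbar) has_derivative (\<lambda>h. curvature_matrix \<alpha> *v h)) (at \<alpha>)"
    using has_derivative_diff[OF curvature_has_derivative[OF assms] has_derivative_const[of Kbar]] by simp
  from has_derivative_inner[OF this this] show ?thesis
    by (rule has_derivative_eq_rhs) (simp add: fun_eq_iff inner_commute)
qed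

text \<open>Along the flow the energy changes at minus twice the quadratic form of \<open>A\<close>
  times its power \<open>s\<close>, that is of the power \<open>s + 1\<close>, which is positive
  whatever the exponent. This is why one energy serves all three flows.\<close>

lemma energy_decreasing:
  assumes "\<alpha> \<in> W"
  shows "2 * ((K \<alpha> - Kbar) \<bullet> (curvature_matrix \<alpha> *v frac_calabi_field s K Kbar \<alpha>)) \<le> 0"
proof -
  obtain m M where m: "m > 0" "curvature_matrix \<alpha> \<in> rayleigh_bounds m M"
    using assms by (rule curvature_matrix_rayleigh)
  obtain c where c: "c > 0" "\<And>(A :: real^'b^'b) x. A \<in> rayleigh_bounds m M \<Longrightarrow> c * (norm x)\<^sup>2 \<le> x \<bullet> (A *v (matrix_powr A s *v x))"
    using matrix_powr_coercive[OF m(1)] by blast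
  have "0 \<le> c * (norm (K \<alpha> - Kbar))\<^sup>2" using c(1) by simp
  also note c(2)[OF m(2)]
  finally show ?thesis
    by (simp add: frac_calabi_field_eq[OF assms] matrix_vector_mult_minus)
qed

lemma flow_avoids_frontier:
  assumes flow: "flow_solution W (frac_calabi_field s K Kbar) \<alpha>0 I \<alpha>"
  shows "closure (\<alpha> ` I) \<inter> (top_of_set angle_box frontier_of W) = {}"
proof -
  let ?V = "frac_calabi_field s K Kbar"
  let ?E = "\<lambda>\<alpha>. (K \<alpha> - Kbar) \<bullet> (K \<alpha> - Kbar)"
  have I: "is_interval I" "0 \<in> I" "I \<subseteq> {0..}" and sol: "\<And>t. t \<in> I \<Longrightarrow> \<alpha> t \<in> W"
    "\<And>t. t \<in> I \<Longrightarrow> (\<alpha> has_vector_derivative ?V (\<alpha> t)) (at t within I)"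
    using flow by (auto simp: flow_solution_def)
  have energy: "?E (\<alpha> t) \<le> ?E (\<alpha> 0)" if t: "t \<in> I" for t
  proof -
    have sub: "{0..t} \<subseteq> I" using I t by (meson atLeastAtMost_iff mem_is_interval_1_I subsetI)
    have "?E (\<alpha> t) \<le> ?E (\<alpha> 0) * exp (0 * t)"
    proof (rule gronwall_differential)
      show "0 \<le> t" using I t by auto
      fix s' assume s: "s' \<in> {0..t}"
      then have sI: "s' \<in> I" using sub by auto
      have d: "(\<alpha> has_derivative (\<lambda>h. h *\<^sub>R ?V (\<alpha> s'))) (at s' within {0..t})"
        using has_vector_derivative_within_subset[OF sol(2)[OF sI] sub] by (simp add: has_vector_derivative_def)
      show "((\<lambda>t. ?E (\<alpha> t)) has_real_derivative 2 * ((K (\<alpha> s') - Kbar) \<bullet> (curvature_matrix (\<alpha> s') *v ?V (\<alpha> s')))) (at s' within {0..t})"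
        unfolding has_field_derivative_def
        by (rule has_derivative_eq_rhs[OF has_derivative_compose[where f = \<alpha> and x = s', OF d energy_has_derivative[OF sol(1)[OF sI]]]])
          (simp add: fun_eq_iff matrix_vector_mult_scaleR)
      show "2 * ((K (\<alpha> s') - Kbar) \<bullet> (curvature_matrix (\<alpha> s') *v ?V (\<alpha> s'))) \<le> 0 * ?E (\<alpha> s')"
        using energy_decreasing[OF sol(1)[OF sI]] by simp
    qed
    then show ?thesis by simp
  qed
  have bound: "norm (K \<beta>) \<le> norm Kbar + norm (K (\<alpha> 0) - Kbar)" if "\<beta> \<in> \<alpha> ` I" for \<beta>
  proof -
    have "norm (K \<beta> - Kbar) \<le> norm (K (\<alpha> 0) - Kbar)"
      using energy that by (auto simp: norm_le)
    then show ?thesis using norm_triangle_sub[of "K \<beta>" Kbar] by linarith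
  qed
  have "closure (\<alpha> ` I) \<inter> angle_box \<subseteq> W"
    by (rule closure_bounded_curvature[OF _ bound]) (use sol(1) in auto)
  \<comment> \<open>The admissible space is open, so none of its points lies on the relative
    frontier.\<close>
  moreover have "top_of_set angle_box frontier_of W \<subseteq> angle_box - W"
  proof -
    have "W \<subseteq> angle_box" by (auto simp: admissible_def)
    then have "openin (top_of_set angle_box) W" using open_W by (auto simp: openin_open)
    then have "top_of_set angle_box interior_of W = W" by (rule interior_of_openin)
    then show ?thesis
      using frontier_of_subset_topspace[of "top_of_set angle_box" W] by (auto simp: frontier_of_def)
  qed
  ultimately show ?thesis by blast
qed

text \<open>The constants come from the lower Rayleigh bound \<open>m\<close> at the equilibrium:
  each of the two approximations nearby, of the Jacobian and of the curvature, may consume half of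
  it.\<close>

lemma exponential_stability:
  assumes z: "z \<in> W"
  shows "\<exists>\<delta>>0. \<forall>\<alpha>0. norm (\<alpha>0 - z) < \<delta> \<longrightarrow>
    (\<exists>\<alpha>. global_solution W (frac_calabi_field s K (K z)) \<alpha>0 \<alpha> \<and> converges_exponentially \<alpha> z)"
proof -
  let ?A = curvature_matrix and ?V = "frac_calabi_field s K (K z)"
  obtain m M where m: "m > 0" "?A z \<in> rayleigh_bounds m M" using z by (rule curvature_matrix_rayleigh)
  obtain r1 LA where r1: "r1 > 0" and LA: "\<And>x y. x \<in> cball z r1 \<Longrightarrow> y \<in> cball z r1 \<Longrightarrow> norm (?A x - ?A y) \<le> LA * norm (x - y)"
    using lipschitz_near_cball[OF lipschitz_near_curvature(2)[OF z]] by metis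
  obtain r2 LK where r2: "r2 > 0" and LK: "\<And>x y. x \<in> cball z r2 \<Longrightarrow> y \<in> cball z r2 \<Longrightarrow> norm (K x - K y) \<le> LK * norm (x - y)"
    using lipschitz_near_cball[OF lipschitz_near_curvature(1)[OF z]] by metis
  obtain r3 where r3: "r3 > 0" "cball z r3 \<subseteq> W" using open_W z by (auto simp: open_contains_cball)
  define m' M' where "m' = m - m / 2" and "M' = M + m / 2"
  have m': "m' > 0" using m(1) by (simp add: m'_def)
  define l where "l = \<bar>LA\<bar> + 1"
  have l: "l > 0" "LA \<le> l" by (auto simp: l_def)
  \<comment> \<open>Within this radius the Jacobian moves by at most \<open>m / 2\<close>, so its
    Rayleigh bounds are \<open>m'\<close> and \<open>M'\<close>; \<open>l\<close> is a positive
    substitute for \<open>LA\<close>.\<close>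
  define r4 where "r4 = min (min r1 r3) (m / 2 / l)"
  have r4: "r4 > 0" "r4 \<le> r1" "r4 \<le> r3" "r4 \<le> m / 2 / l" using r1 r3 m(1) l by (auto simp: r4_def)
  have ray: "?A x \<in> rayleigh_bounds m' M'" if x: "x \<in> cball z r4" for x
    unfolding m'_def M'_def
  proof (rule rayleigh_bounds_perturb[OF m(2)])
    have xz: "norm (x - z) \<le> r4" using x by (simp add: dist_norm norm_minus_commute)
    show "transpose (?A x) = ?A x" using x r3 r4 by (intro curvature_matrix_symmetric) auto
    have "norm (?A x - ?A z) \<le> LA * norm (x - z)" using x r1 r4 by (intro LA) auto
    also have "\<dots> \<le> l * (m / 2 / l)"
      using xz r4 l by (intro mult_mono) auto
    also have "\<dots> = m / 2" using l by simp
    finally show "norm (?A x - ?A z) \<le> m / 2" .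
  qed
  obtain LB where LB: "LB \<ge> 0" "\<And>A B :: real^'b^'b. A \<in> rayleigh_bounds m' M' \<Longrightarrow> B \<in> rayleigh_bounds m' M' \<Longrightarrow>
     norm (matrix_powr A s - matrix_powr B s) \<le> LB * norm (A - B)"
    using matrix_powr_lipschitz[OF m'] by blast
  have "lipschitz_near z (\<lambda>x. matrix_powr (?A x) s)"
  proof -
    have "(LB * \<bar>LA\<bar>)-lipschitz_on (ball z r4) (\<lambda>x. matrix_powr (?A x) s)"
    proof (rule lipschitz_onI)
      fix x y assume xy: "x \<in> ball z r4" "y \<in> ball z r4"
      have "norm (matrix_powr (?A x) s - matrix_powr (?A y) s) \<le> LB * norm (?A x - ?A y)"
        using xy by (intro LB ray) auto
      also have "\<dots> \<le> LB * (\<bar>LA\<bar> * norm (x - y))"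
      proof (rule mult_left_mono[OF _ LB(1)])
        have "norm (?A x - ?A y) \<le> LA * norm (x - y)" using xy r4 by (intro LA) auto
        also have "\<dots> \<le> \<bar>LA\<bar> * norm (x - y)" by (intro mult_right_mono) auto
        finally show "norm (?A x - ?A y) \<le> \<bar>LA\<bar> * norm (x - y)" .
      qed
      finally show "dist (matrix_powr (?A x) s) (matrix_powr (?A y) s) \<le> LB * \<bar>LA\<bar> * dist x y"
        by (simp add: dist_norm)
    qed (use LB in simp)
    then show ?thesis using r4(1) unfolding lipschitz_near_def by blast
  qed
  then have "lipschitz_near z (\<lambda>x. - (matrix_powr (?A x) s *v (K x - K z)))"
    by (intro lipschitz_near_minus lipschitz_near_bilinear[OF bounded_bilinear_matrix_vector_mult]
        lipschitz_near_diff lipschitz_near_const lipschitz_near_curvature(1)[OF z])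
  then have "lipschitz_near z ?V"
    by (rule lipschitz_near_cong[OF _ open_W z]) (simp add: frac_calabi_field_eq)
  then obtain r5 LV where r5: "r5 > 0" and LV: "\<And>x y. x \<in> cball z r5 \<Longrightarrow> y \<in> cball z r5 \<Longrightarrow> norm (?V x - ?V y) \<le> LV * norm (x - y)"
    using lipschitz_near_cball by metis
  obtain r6 where r6: "r6 > 0" and lin: "\<And>x. norm (x - z) < r6 \<Longrightarrow> norm (K x - K z - ?A z *v (x - z)) \<le> m / 2 * norm (x - z)"
    using curvature_has_derivative[OF z] m(1) unfolding has_derivative_at_alt by (meson half_gt_zero)
  obtain c where c: "c > 0" "\<And>(A :: real^'b^'b) x. A \<in> rayleigh_bounds m' M' \<Longrightarrow> c * (norm x)\<^sup>2 \<le> x \<bullet> (A *v (matrix_powr A s *v x))"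
    using matrix_powr_coercive[OF m'] by blast
  \<comment> \<open>\<open>r6\<close> is halved because the linearisation estimate needs a distance
    strictly below \<open>r6\<close>, whereas the ball is closed.\<close>
  define r where "r = min (min (r6 / 2) r2) (min r4 r5)"
  have r: "r > 0" "r < r6" "r \<le> r2" "r \<le> r4" "r \<le> r5" using r2 r4(1) r5 r6 by (auto simp: r_def)
  have inW: "x \<in> W" if "x \<in> cball z r" for x using that r r4 r3(2) by auto
  have near: "norm (x - z) \<le> r" if "x \<in> cball z r" for x using that by (simp add: dist_norm norm_minus_commute)
  show ?thesis
  proof (rule lyapunov_exponential_stability[where E = "\<lambda>x. (K x - K z) \<bullet> (K x - K z)" and
        E' = "\<lambda>x h. 2 * ((K x - K z) \<bullet> (?A x *v h))" and r = r and c = "2 * c" and m = "(m / 2)\<^sup>2" and M = "LK\<^sup>2" and L = LV])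
    show "r > 0" by (rule r)
    show "cball z r \<subseteq> W" using inW by blast
    show "(m / 2)\<^sup>2 > 0" "2 * c > 0" using m(1) c(1) by auto
    show "norm (?V x - ?V y) \<le> LV * norm (x - y)" if "x \<in> cball z r" "y \<in> cball z r" for x y
      using that r by (intro LV) auto
    fix x assume x: "x \<in> cball z r"
    show "((\<lambda>x. (K x - K z) \<bullet> (K x - K z)) has_derivative (\<lambda>h. 2 * ((K x - K z) \<bullet> (?A x *v h)))) (at x)"
      by (rule energy_has_derivative[OF inW[OF x]])
    have "?A x \<in> rayleigh_bounds m' M'" using x r by (intro ray) auto
    from c(2)[OF this, of "K x - K z"]
    show "2 * ((K x - K z) \<bullet> (?A x *v ?V x)) \<le> - (2 * c) * ((K x - K z) \<bullet> (K x - K z))"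
      by (simp add: frac_calabi_field_eq[OF inW[OF x]] matrix_vector_mult_minus power2_norm_eq_inner)
    show "(K x - K z) \<bullet> (K x - K z) \<le> LK\<^sup>2 * (norm (x - z))\<^sup>2"
    proof -
      have "norm (K x - K z) \<le> LK * norm (x - z)" using x r by (intro LK) auto
      then have "(norm (K x - K z))\<^sup>2 \<le> (LK * norm (x - z))\<^sup>2" by (rule power_mono) simp
      then show ?thesis by (simp add: power2_norm_eq_inner power_mult_distrib)
    qed
    \<comment> \<open>Pair \<open>K x - K z\<close> with \<open>?h\<close>: the linear part
      contributes at least \<open>m * (norm ?h)\<^sup>2\<close>, the remainder takes away at most
      half of it, and Cauchy-Schwarz gives a lower bound on \<open>norm (K x - K z)\<close>.\<close>
    show "(m / 2)\<^sup>2 * (norm (x - z))\<^sup>2 \<le> (K x - K z) \<bullet> (K x - K z)"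
    proof -
      let ?h = "x - z"
      have "norm ?h < r6" using near[OF x] r by linarith
      then have l: "norm (K x - K z - ?A z *v ?h) \<le> m / 2 * norm ?h" by (rule lin)
      have "\<bar>?h \<bullet> (K x - K z - ?A z *v ?h)\<bar> \<le> norm ?h * (m / 2 * norm ?h)"
        using Cauchy_Schwarz_ineq2[of ?h "K x - K z - ?A z *v ?h"] mult_left_mono[OF l norm_ge_zero[of ?h]] by linarith
      then have "?h \<bullet> (?A z *v ?h) - m / 2 * (norm ?h)\<^sup>2 \<le> ?h \<bullet> (K x - K z)"
        unfolding inner_diff_right[of ?h "K x - K z"] power2_eq_square mult.left_commute[of "norm ?h" "m / 2"]
        by linarith
      moreover have "m * (norm ?h)\<^sup>2 \<le> ?h \<bullet> (?A z *v ?h)" using m(2) by (auto simp: rayleigh_bounds_def)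
      moreover have "?h \<bullet> (K x - K z) \<le> norm ?h * norm (K x - K z)" by (rule norm_cauchy_schwarz)
      ultimately have "norm ?h * (m / 2 * norm ?h) \<le> norm ?h * norm (K x - K z)"
        unfolding power2_eq_square mult.left_commute[of "norm ?h" "m / 2"] by linarith
      then have "m / 2 * norm ?h \<le> norm (K x - K z)"
        by (cases "norm ?h = 0") (simp_all add: mult_le_cancel_left)
      then have "(m / 2 * norm ?h)\<^sup>2 \<le> (norm (K x - K z))\<^sup>2" using m(1) by (intro power_mono) auto
      then show ?thesis unfolding power_mult_distrib by (simp only: power2_norm_eq_inner)
    qed
  qed
qed

lemma ricci_negative_gradient: "negative_gradient_on W (ricci_field K Kbar)"
proof -
  have "continuous_on W curvature_matrix"
    using lipschitz_near_isCont[OF lipschitz_near_curvature(2)] by (intro continuous_at_imp_continuous_on) blast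
  moreover have "((\<lambda>x. K x - Kbar) has_derivative (\<lambda>h. curvature_matrix x *v h)) (at x)" if "x \<in> W" for x
    using has_derivative_diff[OF curvature_has_derivative[OF that] has_derivative_const[of Kbar]] by simp
  ultimately have "\<exists>\<Phi>. \<forall>x\<in>W. GDERIV \<Phi> x :> K x - Kbar"
    by (intro symmetric_jacobian_potential[OF open_W convex_W _ curvature_matrix_symmetric])
  then show ?thesis by (simp add: negative_gradient_on_def ricci_field_def)
qed

text \<open>The gradient of half the energy is the transposed Jacobian applied to
  \<open>K \<alpha> - Kbar\<close>; by symmetry of the Jacobian this is minus the Calabi
  field.\<close>

lemma calabi_negative_gradient: "negative_gradient_on W (calabi_field K Kbar)"
  unfolding negative_gradient_on_def
proof (intro exI[of _ "\<lambda>\<alpha>. (1 / 2) *\<^sub>R ((K \<alpha> - Kbar) \<bullet> (K \<alpha> - Kbar))"] ballI)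
  fix \<alpha> assume a: "\<alpha> \<in> W"
  have V: "- calabi_field K Kbar \<alpha> = curvature_matrix \<alpha> *v (K \<alpha> - Kbar)"
    by (simp add: calabi_field_def laplacian_def jacobian_curvature[OF a] minus_matrix_vector_mult)
  have "(K \<alpha> - Kbar) \<bullet> (curvature_matrix \<alpha> *v h) = h \<bullet> (curvature_matrix \<alpha> *v (K \<alpha> - Kbar))" for h
    using inner_transpose_mult[of "K \<alpha> - Kbar" "curvature_matrix \<alpha>" h] curvature_matrix_symmetric[OF a]
    by (simp add: inner_commute)
  then show "GDERIV (\<lambda>\<alpha>. (1 / 2) *\<^sub>R ((K \<alpha> - Kbar) \<bullet> (K \<alpha> - Kbar))) \<alpha> :> - calabi_field K Kbar \<alpha>"
    unfolding gderiv_def V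
    by (intro has_derivative_eq_rhs[OF has_derivative_scaleR_right[OF energy_has_derivative[OF a]]]) (simp add: fun_eq_iff)
qed

end

theorem theorem1p3:
  fixes \<sigma> :: "'f::finite ored \<Rightarrow> 'f ored"
    and bd :: "'f black \<Rightarrow> 'b::finite"
    and \<eta> :: "'f edge \<Rightarrow> real"
    and Kbar :: "real^'b"
    and s :: real
  defines "W \<equiv> admissible \<sigma> bd \<eta>"
    and "K \<equiv> conformal_curvature \<sigma> bd \<eta>"
  assumes triangulation: "ideal_triangulation \<sigma> bd"
    and weight: "\<forall>e\<in>edges \<sigma>. \<eta> e > - 1"
    and face_condition: "\<forall>f k. \<eta> (opp_edge \<sigma> f k) +
           \<eta> (opp_edge \<sigma> f (k + 1)) * \<eta> (opp_edge \<sigma> f (k + 2)) \<ge> 0"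
    and Kbar_pos: "\<forall>i. Kbar $ i > 0"
  shows "negative_gradient_on W (ricci_field K Kbar) \<and>
      negative_gradient_on W (calabi_field K Kbar) \<and>
      (\<forall>\<alpha>bar\<in>W. K \<alpha>bar = Kbar \<longrightarrow>
        (\<exists>\<delta>>0. \<forall>\<alpha>0\<in>W. norm (\<alpha>0 - \<alpha>bar) < \<delta> \<longrightarrow>
          (\<forall>V\<in>{ricci_field K Kbar, calabi_field K Kbar, frac_calabi_field s K Kbar}.
            \<exists>\<alpha>. global_solution W V \<alpha>0 \<alpha> \<and> converges_exponentially \<alpha> \<alpha>bar))) \<and>
      (\<forall>\<alpha>0\<in>W. \<forall>V\<in>{ricci_field K Kbar, calabi_field K Kbar, frac_calabi_field s K Kbar}.
        \<forall>I \<alpha>. flow_solution W V \<alpha>0 I \<alpha> \<longrightarrow>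
          closure (\<alpha> ` I) \<inter> (top_of_set angle_box frontier_of W) = {})"
proof -
  interpret weighted_triangulation \<sigma> bd \<eta> by unfold_locales (rule triangulation)
  let ?Vs = "{ricci_field K Kbar, calabi_field K Kbar, frac_calabi_field s K Kbar}"
  note V_frac = flow_fields_frac[of _ Kbar s, folded W_def K_def]
  have "\<exists>\<delta>>0. \<forall>\<alpha>0\<in>W. norm (\<alpha>0 - z) < \<delta> \<longrightarrow>
      (\<forall>V\<in>?Vs. \<exists>\<alpha>. global_solution W V \<alpha>0 \<alpha> \<and> converges_exponentially \<alpha> z)"
    if z: "z \<in> W" "K z = Kbar" for z
  proof -
    have "\<exists>\<delta>>0. \<forall>\<alpha>0. norm (\<alpha>0 - z) < \<delta> \<longrightarrow>
        (\<exists>\<alpha>. global_solution W V \<alpha>0 \<alpha> \<and> converges_exponentially \<alpha> z)" if V: "V \<in> ?Vs" for V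
    proof -
      obtain s' where s': "flow_solution W V = flow_solution W (frac_calabi_field s' K Kbar)"
        using V by (rule V_frac)
      show ?thesis
        using exponential_stability[folded W_def K_def, OF z(1), of s'] z(2)
        unfolding global_solution_def s' by simp
    qed
    \<comment> \<open>The radius depends on the field; the minimum over the three fields serves all
      of them.\<close>
    then obtain d where d: "\<And>V. V \<in> ?Vs \<Longrightarrow> d V > 0" "\<And>V \<alpha>0. V \<in> ?Vs \<Longrightarrow> norm (\<alpha>0 - z) < d V \<Longrightarrow>
        \<exists>\<alpha>. global_solution W V \<alpha>0 \<alpha> \<and> converges_exponentially \<alpha> z"
      by metis
    show ?thesis
    proof (intro exI[of _ "Min (d ` ?Vs)"] conjI ballI impI)
      show "Min (d ` ?Vs) > 0" using d(1) by (subst Min_gr_iff) auto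
      fix \<alpha>0 V assume "norm (\<alpha>0 - z) < Min (d ` ?Vs)" and V: "V \<in> ?Vs"
      moreover have "Min (d ` ?Vs) \<le> d V" using V by (intro Min_le) auto
      ultimately show "\<exists>\<alpha>. global_solution W V \<alpha>0 \<alpha> \<and> converges_exponentially \<alpha> z" using d(2) by force
    qed
  qed
  moreover have "closure (\<alpha> ` I) \<inter> (top_of_set angle_box frontier_of W) = {}"
    if V: "V \<in> ?Vs" and flow: "flow_solution W V \<alpha>0 I \<alpha>" for \<alpha>0 V I \<alpha>
  proof -
    obtain s' where "flow_solution W V = flow_solution W (frac_calabi_field s' K Kbar)"
      using V by (rule V_frac)
    then show ?thesis using flow_avoids_frontier[folded W_def K_def] flow by simp
  qed
  ultimately show ?thesis
    using ricci_negative_gradient[folded W_def K_def] calabi_negative_gradient[folded W_def K_def] by blast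
qed

end
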